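(* Let $M=\mathbb{R}$ or $M=\mathbb{T}$, let $p>1$ be an integer, let $f(u)=u^p$ or $f(u)=-u^p$, and consider the Cauchy problem $$u_{tt}-u_{xx}+u_{xxxx}+(f(u))_{xx}=0,\qquad u=u(t,x):\mathbb{R}_+\times M\to\mathbb{R},\qquad u(0,x)=u_0(x),\quad u_t(0,x)=u_1(x).$$ Let $s\in\mathbb{R}$ satisfy $$s<-\frac{2}{p}\ \text{ if } p \text{ is odd},\qquad s<-\frac{1}{p}\ \text{ if } p\text{ is even}.$$ Then there exists $T>0$ such that, for $0<t<T$, the flow map $$S(t):H^{s}(M)\times H^{s-2}(M)\to H^{s}(M),\qquad S(t)(u_0,u_1)=u(t),$$ of this Cauchy problem is not $C^p$ Fréchet-differentiable at zero (i.e. at $(u_0,u_1)=(0,0)$).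
   Context: $H^s(M)$ denotes the usual $L^2$-based Sobolev space on $M$ of order $s\in\mathbb{R}$, where $M=\mathbb{R}$ is the non-periodic case and $M=\mathbb{T}$ (the circle) is the periodic case, with frequencies $\xi\in\mathbb{Z}$. The solution $u(t)=S(t)(u_0,u_1)$ of the Cauchy problem is understood through Duhamel's integral formulation $$S(t)(u_0,u_1)=L(u_0,u_1)(t)-\int_0^t L\big(0,(f(S(\tau)(u_0,u_1)))_{xx}\big)(t-\tau)\,d\tau,$$ where $L$ is the solution operator of the linear equation $u_{tt}-u_{xx}+u_{xxxx}=0$, given on the spatial Fourier side by $$\widehat{L(u_0,u_1)}(t,\xi)=\cos(t\lambda(\xi))\,\widehat{u}_0(\xi)+\frac{\sin(t\lambda(\xi))}{\lambda(\xi)}\,\widehat{u}_1(\xi),\qquad \lambda(\xi)=\sqrt{\xi^2+\xi^4},$$ with $\frac{\sin(t\lambda)}{\lambda}$ interpreted as $t$ when $\lambda=0$. In particular $S(t)(0,0)=0$. Meaning of the assertion: the flow map, as a map $(u_0,u_1)\mapsto u(t)$ from $H^s\times H^{s-2}$ to $H^s$ determined by this integral equation, cannot be $p$ times continuously Fréchet-differentiable at the origin. *)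

theory Defs
  imports "HOL-Analysis.Analysis" "HOL-Library.Function_Algebras"
begin

section \<open>Pointwise real vector space structure on functions\<close>

instantiation "fun" :: (type, real_vector) real_vector
begin

definition scaleR_fun :: "real \<Rightarrow> ('a \<Rightarrow> 'b) \<Rightarrow> 'a \<Rightarrow> 'b"
  where "scaleR_fun c f = (\<lambda>x. c *\<^sub>R f x)"

instance
  by standard (simp_all add: scaleR_fun_def fun_eq_iff algebra_simps)

end


section \<open>Seminormed spaces and Frechet differentiability\<close>

text \<open>
  The order of a Sobolev space is a real number, so these spaces cannot be types of class
  \<open>real_normed_vector\<close>; they are given by a carrier set and a seminorm on an ambient real vector
  space.  A seminorm is used because the elements of a Sobolev space on the line are functions of
  the frequency up to null sets: a vector of seminorm zero represents the zero class, and
  identities between vectors are understood up to seminorm zero.  The resulting notions are those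
  of the quotient normed space: differentiability at \<open>x\<close> implies continuity at \<open>x\<close>, so
  a differentiable map sends representatives of one class to representatives of one class.
\<close>

record 'a seminormed =
  vecs :: "'a set"
  snorm :: "'a \<Rightarrow> real"

definition prod_seminormed ::
  "'a seminormed \<Rightarrow> 'b seminormed \<Rightarrow> ('a \<times> 'b) seminormed" where
  "prod_seminormed X Y =
     \<lparr>vecs = vecs X \<times> vecs Y,
      snorm = (\<lambda>(x, y). sqrt ((snorm X x)\<^sup>2 + (snorm Y y)\<^sup>2))\<rparr>"

text \<open>A \<open>k\<close>-linear map takes the list of its \<open>k\<close> arguments; the following says that its operator
  norm is at most \<open>C\<close>.\<close>

definition opnorm_le ::
  "'a seminormed \<Rightarrow> 'b seminormed \<Rightarrow> nat \<Rightarrow> ('a list \<Rightarrow> 'b) \<Rightarrow> real \<Rightarrow> bool" where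
  "opnorm_le X Y k A C \<longleftrightarrow>
     (\<forall>hs. length hs = k \<and> set hs \<subseteq> vecs X \<longrightarrow>
        snorm Y (A hs) \<le> C * (\<Prod>h\<leftarrow>hs. snorm X h))"

definition bounded_multilinear ::
  "'a::real_vector seminormed \<Rightarrow> 'b::real_vector seminormed \<Rightarrow> nat \<Rightarrow> ('a list \<Rightarrow> 'b) \<Rightarrow> bool"
where
  "bounded_multilinear X Y k A \<longleftrightarrow>
     (\<forall>hs. length hs = k \<and> set hs \<subseteq> vecs X \<longrightarrow> A hs \<in> vecs Y) \<and>
     (\<forall>hs. length hs = k \<and> set hs \<subseteq> vecs X \<longrightarrow>
        (\<forall>i<k. \<forall>a\<in>vecs X. \<forall>b\<in>vecs X. \<forall>c d.
           snorm Y (A (hs[i := c *\<^sub>R a + d *\<^sub>R b])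
                    - (c *\<^sub>R A (hs[i := a]) + d *\<^sub>R A (hs[i := b]))) = 0)) \<and>
     (\<exists>C. opnorm_le X Y k A C)"

text \<open>
  \<open>D j x\<close> is the \<open>j\<close>-th Frechet derivative of \<open>F\<close> at \<open>x\<close>, a bounded \<open>j\<close>-linear map; \<open>D (Suc j) x\<close>
  is the Frechet derivative at \<open>x\<close> of \<open>D j\<close> (with respect to the operator norm), under the
  identification of a linear map into \<open>j\<close>-linear maps with a \<open>Suc j\<close>-linear map.  All derivatives
  up to order \<open>k\<close> exist in a neighbourhood of \<open>x0\<close> and the \<open>k\<close>-th one is continuous at \<open>x0\<close>.
  Every map that is \<open>C\<^sup>k\<close> on a neighbourhood of \<open>x0\<close> has this property.
\<close>

definition frechet_Ck_at ::
  "nat \<Rightarrow> 'a::real_vector seminormed \<Rightarrow> 'b::real_vector seminormed \<Rightarrow> ('a \<Rightarrow> 'b) \<Rightarrow> 'a \<Rightarrow> bool"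
where
  "frechet_Ck_at k X Y F x0 \<longleftrightarrow>
     (\<exists>r>0. \<exists>D :: nat \<Rightarrow> 'a \<Rightarrow> 'a list \<Rightarrow> 'b.
        (\<forall>x\<in>vecs X. snorm X (x - x0) < r \<longrightarrow>
           D 0 x [] = F x \<and>
           (\<forall>j\<le>k. bounded_multilinear X Y j (D j x)) \<and>
           (\<forall>j<k. \<forall>\<epsilon>>0. \<exists>\<delta>>0. \<forall>h\<in>vecs X. snorm X h < \<delta> \<longrightarrow>
              opnorm_le X Y j (\<lambda>hs. D j (x + h) hs - D j x hs - D (Suc j) x (h # hs))
                (\<epsilon> * snorm X h))) \<and>
        (\<forall>\<epsilon>>0. \<exists>\<delta>>0. \<forall>x\<in>vecs X. snorm X (x - x0) < \<delta> \<longrightarrow>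
           opnorm_le X Y k (\<lambda>hs. D k x hs - D k x0 hs) \<epsilon>))"


section \<open>The spatial domains and their Sobolev spaces\<close>

text \<open>\<open>Circle\<close> is the real line modulo \<open>2 * pi\<close>, with the integers as frequencies.\<close>

datatype spatial_domain = Line | Circle

fun space_measure :: "spatial_domain \<Rightarrow> real measure" where
  "space_measure Line = lborel"
| "space_measure Circle = restrict_space lborel {0..<2*pi}"

fun freq_measure :: "spatial_domain \<Rightarrow> real measure" where
  "freq_measure Line = lborel"
| "freq_measure Circle = count_space \<int>"

text \<open>
  A (possibly singular) real-valued distribution \<open>u\<close> in \<open>H\<^sup>s\<close> is represented by its Fourier
  transform, a locally square integrable function of the frequency, with the convention
  \<open>u^(\<xi>) = \<integral> exp (- i x \<xi>) u(x) dx\<close>.  The function \<open>u\<close> is real-valued iff its Fourier transform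
  \<open>a\<close> satisfies \<open>a (- \<xi>) = cnj (a \<xi>)\<close>.
\<close>

definition sobolev :: "spatial_domain \<Rightarrow> real \<Rightarrow> (real \<Rightarrow> complex) seminormed" where
  "sobolev M s =
     \<lparr>vecs = {a. a \<in> borel_measurable (freq_measure M) \<and>
                 (AE \<xi> in freq_measure M. a (- \<xi>) = cnj (a \<xi>)) \<and>
                 integrable (freq_measure M) (\<lambda>\<xi>. (1 + \<xi>\<^sup>2) powr s * (cmod (a \<xi>))\<^sup>2)},
      snorm = (\<lambda>a. sqrt (LINT \<xi>|freq_measure M. (1 + \<xi>\<^sup>2) powr s * (cmod (a \<xi>))\<^sup>2))\<rparr>"

definition fourier :: "spatial_domain \<Rightarrow> (real \<Rightarrow> real) \<Rightarrow> real \<Rightarrow> complex" where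
  "fourier M v \<xi> = (LINT x|space_measure M. cis (- (x * \<xi>)) * complex_of_real (v x))"

text \<open>The function with Fourier transform \<open>a\<close>, for integrable \<open>a\<close> with the above symmetry; the
  integral is then real.\<close>

definition inv_fourier :: "spatial_domain \<Rightarrow> (real \<Rightarrow> complex) \<Rightarrow> real \<Rightarrow> real" where
  "inv_fourier M a x = Re (LINT \<xi>|freq_measure M. cis (x * \<xi>) * a \<xi>) / (2 * pi)"


section \<open>The Cauchy problem\<close>

definition dispersion :: "real \<Rightarrow> real" where
  "dispersion \<xi> = sqrt (\<xi>^2 + \<xi>^4)"

definition lin_flow ::
  "(real \<Rightarrow> complex) \<times> (real \<Rightarrow> complex) \<Rightarrow> real \<Rightarrow> real \<Rightarrow> complex" where
  "lin_flow = (\<lambda>(a0, a1) t \<xi>.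
     complex_of_real (cos (t * dispersion \<xi>)) * a0 \<xi> +
     complex_of_real (if dispersion \<xi> = 0 then t
                      else sin (t * dispersion \<xi>) / dispersion \<xi>) * a1 \<xi>)"

text \<open>The Fourier transform of \<open>(f(u))\<^sub>x\<^sub>x\<close>, where \<open>a\<close> is the Fourier transform of \<open>u\<close>.\<close>

definition nonlin_xx ::
  "spatial_domain \<Rightarrow> (real \<Rightarrow> real) \<Rightarrow> (real \<Rightarrow> complex) \<Rightarrow> real \<Rightarrow> complex" where
  "nonlin_xx M f a \<xi> = - (complex_of_real (\<xi>\<^sup>2)) * fourier M (\<lambda>x. f (inv_fourier M a x)) \<xi>"

definition sobolev_data ::
  "spatial_domain \<Rightarrow> real \<Rightarrow> ((real \<Rightarrow> complex) \<times> (real \<Rightarrow> complex)) seminormed" where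
  "sobolev_data M s = prod_seminormed (sobolev M s) (sobolev M (s - 2))"

text \<open>
  \<open>u\<close> (given by its spatial Fourier transform at each time) is a solution in \<open>C([0,T]; H\<^sup>\<sigma>)\<close> of the
  integral equation.  This is used for \<open>\<sigma> > 1/2\<close> only: then \<open>u\<close> is a bounded, square integrable
  function, so \<open>f(u)\<close> is an honest integrable function for \<open>f(u) = \<plusminus>u\<^sup>p\<close>, \<open>p \<ge> 2\<close>, and the
  integrand below is continuous in time for each frequency.
\<close>

definition duhamel_solution ::
  "spatial_domain \<Rightarrow> (real \<Rightarrow> real) \<Rightarrow> real \<Rightarrow> real \<Rightarrow>
   (real \<Rightarrow> complex) \<times> (real \<Rightarrow> complex) \<Rightarrow> (real \<Rightarrow> real \<Rightarrow> complex) \<Rightarrow> bool" where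
  "duhamel_solution M f \<sigma> T d u \<longleftrightarrow>
     d \<in> vecs (sobolev_data M \<sigma>) \<and>
     (\<forall>t\<in>{0..T}. u t \<in> vecs (sobolev M \<sigma>)) \<and>
     (\<forall>t\<in>{0..T}. ((\<lambda>r. snorm (sobolev M \<sigma>) (u r - u t)) \<longlongrightarrow> 0) (at t within {0..T})) \<and>
     (\<forall>t\<in>{0..T}. AE \<xi> in freq_measure M.
        u t \<xi> = lin_flow d t \<xi>
               - (LINT \<tau>:{0..t}|lborel. lin_flow (\<lambda>_. 0, nonlin_xx M f (u \<tau>)) (t - \<tau>) \<xi>))"

text \<open>
  \<open>S t\<close> maps \<open>H\<^sup>s \<times> H\<^sup>s\<^sup>-\<^sup>2\<close> to \<open>H\<^sup>s\<close> and sends initial data to the value at time \<open>t\<close> of the solution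
  of the integral equation.  For \<open>s \<le> 1/2\<close> the nonlinearity is not defined on all of \<open>H\<^sup>s\<close>, so the
  equation determines \<open>S t\<close> on those data that have a solution in \<open>C([0,t]; H\<^sup>\<sigma>)\<close> for
  some \<open>\<sigma> > 1/2\<close> (where solutions are unique), and nothing is required elsewhere: \<open>S t\<close> is
  any extension of the solution map of regular data.  In particular totality of \<open>S t\<close> costs
  nothing, and no solvability for all regular data up to time \<open>t\<close> is presupposed.
\<close>

definition flow_map ::
  "spatial_domain \<Rightarrow> (real \<Rightarrow> real) \<Rightarrow> real \<Rightarrow>
   (real \<Rightarrow> (real \<Rightarrow> complex) \<times> (real \<Rightarrow> complex) \<Rightarrow> real \<Rightarrow> complex) \<Rightarrow> bool" where
  "flow_map M f s S \<longleftrightarrow>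
     (\<forall>t\<ge>0. \<forall>d\<in>vecs (sobolev_data M s). S t d \<in> vecs (sobolev M s)) \<and>
     (\<forall>t\<ge>0. \<forall>\<sigma>. \<sigma> > 1/2 \<and> \<sigma> \<ge> s \<longrightarrow>
        (\<forall>d u. duhamel_solution M f \<sigma> t d u \<longrightarrow>
           (AE \<xi> in freq_measure M. S t d \<xi> = u t \<xi>)))"

end

theory Submission
  imports Defs "HOL-Probability.Probability"
begin

text \<open>
  If the flow map were \<open>C\<^sup>p\<close> at zero, then along a ray of smooth data \<open>h \<phi>\<close> the \<open>p\<close>-th Taylor
  coefficient of the solution would be bounded by a multiple of the \<open>p\<close>-th power of the
  \<open>H\<^sup>s \<times> H\<^sup>s\<^sup>-\<^sup>2\<close> norm of \<open>\<phi>\<close>.  That coefficient is the first Duhamel iterate of the linear wave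
  issued by \<open>\<phi>\<close>.  For \<open>\<phi>\<close> take the data of a travelling wave, with time factor
  \<open>exp (- i t \<xi> sqrt (1 + \<xi>\<^sup>2))\<close>, concentrated at the frequencies \<open>\<plusminus>N\<close> and \<open>\<plusminus>K\<close>, where \<open>K = N + 1\<close> for
  even \<open>p\<close> and \<open>K = 2 N + 1\<close> for odd \<open>p\<close>.  The only way to combine \<open>p\<close> of these frequencies into
  an output frequency near \<open>1\<close> is \<open>K - N\<close>, respectively \<open>K - 2 N\<close>, up to cancelling pairs; since space
  and time frequencies of a travelling wave are locked, all contributions oscillate in time with
  a frequency comparable to \<open>N\<close>, respectively \<open>N\<^sup>2\<close>, and the imaginary parts of their time
  integrals have the same sign.  With amplitude \<open>N powr - s\<close> the data are bounded, while the iterate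
  at frequencies near \<open>1\<close> is at least of order \<open>N powr (- s p - 1)\<close>, respectively
  \<open>N powr (- s p - 2)\<close>, which is unbounded.

  Solutions for small regular data come from a contraction in the space of continuous functions
  decaying like \<open>1 / (1 + \<xi>\<^sup>2)\<close> on the Fourier side: the two derivatives of the nonlinearity are
  compensated by the factor \<open>1 / sqrt (\<xi>\<^sup>2 + \<xi>\<^sup>4)\<close>.
\<close>

section \<open>Frequency measures\<close>

text \<open>Differentiability is tested through one scalar functional: the integral of the imaginary
  part of the transform over a window around frequency \<open>1\<close>. It is bounded on
  \<open>H^s\<close> for every \<open>s\<close> because the window is bounded, the packets vanish
  there, and it is in the imaginary part that the time integrals keep a sign. So Taylor's theorem on
  the real line suffices. The equation fixes \<open>S t\<close> only on regular data. For each
  \<open>N\<close> separately the scaling parameter \<open>h\<close> tends to \<open>0\<close>, so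
  existence up to time \<open>t\<close> is no obstacle and its threshold may depend on
  \<open>N\<close>; uniformity in \<open>N\<close> is needed only for the norm of the data and for
  the lower bound on the iterate. The loss of powers of \<open>N\<close> is due to the time
  integral, which is of the order of the reciprocal time frequency: \<open>phase x\<close> stays
  within \<open>1/2\<close> of \<open>x^2\<close> for positive \<open>x\<close>, so
  \<open>phase K - phase N\<close> grows like \<open>2 N\<close> when \<open>K = N + 1\<close>, and
  \<open>phase K - 2 phase N\<close> like \<open>2 N^2\<close> when \<open>K = 2 N + 1\<close>. The
  width of the packets does not depend on \<open>N\<close>. Hence the line and the circle can share
  one argument: all that is used of the centres is that they are integers.\<close>

definition weight :: "real \<Rightarrow> real" where
  "weight x = 1 / (1 + x\<^sup>2)"

lemma weight_pos [simp]: "0 < weight x"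
  by (simp add: weight_def add_pos_nonneg)

lemma weight_nonneg [simp]: "0 \<le> weight x"
  using weight_pos less_imp_le by blast

lemma weight_neq_0 [simp]: "weight x \<noteq> 0"
  using weight_pos[of x] by linarith

lemma weight_le_1: "weight x \<le> 1"
  by (simp add: weight_def divide_le_eq add_pos_nonneg)

lemma weight_minus [simp]: "weight (- x) = weight x"
  by (simp add: weight_def)

lemma weight_commute: "weight (x - y) = weight (y - x)"
  by (simp add: weight_def power2_commute)

lemma continuous_on_weight [continuous_intros]:
  "continuous_on A f \<Longrightarrow> continuous_on A (\<lambda>x. weight (f x))"
  unfolding weight_def by (intro continuous_intros) (auto simp: add_nonneg_eq_0_iff)

lemma weight_measurable [measurable]: "weight \<in> borel_measurable borel"
  by (intro borel_measurable_continuous_onI continuous_intros)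

text \<open>The inequality \<open>1 + x^2 \<le> 2 ((1 + y^2) + (1 + (x - y)^2))\<close>, a
  consequence of \<open>(x - 2 y)^2 \<ge> 0\<close>, is divided by the product of the three factors.
  It makes the functions bounded by a multiple of \<open>weight\<close> stable under
  convolution.\<close>

lemma weight_mult_le: "weight y * weight (x - y) \<le> 2 * weight x * (weight y + weight (x - y))"
proof -
  define A where "A = 1 + y\<^sup>2"
  define B where "B = 1 + (x - y)\<^sup>2"
  define D where "D = 1 + x\<^sup>2"
  have "A > 0" "B > 0" "D > 0"
    by (auto simp: A_def B_def D_def add_pos_nonneg)
  have "0 \<le> (x - 2 * y)\<^sup>2" by simp
  hence "D \<le> 2 * (A + B)"
    by (simp add: A_def B_def D_def power2_eq_square algebra_simps)
  have "weight y * weight (x - y) = 1 / (A * B)"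
    by (simp add: weight_def A_def B_def)
  also have "\<dots> = D / (D * (A * B))" using \<open>D > 0\<close> by simp
  also have "\<dots> \<le> (2 * (A + B)) / (D * (A * B))"
    by (rule divide_right_mono[OF \<open>D \<le> 2 * (A + B)\<close>]) (use \<open>A > 0\<close> \<open>B > 0\<close> \<open>D > 0\<close> in simp)
  also have "\<dots> = 2 * (1 / D) * (1 / A + 1 / B)"
    using \<open>A > 0\<close> \<open>B > 0\<close> \<open>D > 0\<close> by (simp add: divide_simps)
  finally show ?thesis
    by (simp add: weight_def A_def B_def D_def)
qed

lemma weight_shift_le:
  assumes "\<bar>r\<bar> \<le> 1"
  shows "weight (x + r) \<le> 3 * weight x"
proof -
  have "x\<^sup>2 \<le> 2 * (x + r)\<^sup>2 + 2 * r\<^sup>2"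
  proof -
    have "0 \<le> (x + 2 * r)\<^sup>2" by simp
    thus ?thesis by (simp add: power2_eq_square algebra_simps)
  qed
  moreover have "r\<^sup>2 \<le> 1" using assms by (simp add: abs_square_le_1)
  moreover have "0 \<le> (x + r)\<^sup>2" by simp
  ultimately have "1 + x\<^sup>2 \<le> 3 * (1 + (x + r)\<^sup>2)"
    unfolding distrib_left mult_1_right by linarith
  thus ?thesis
    by (simp add: weight_def field_simps add_pos_nonneg)
qed

text \<open>What the line and the circle have in common. Frequencies are real numbers in both cases,
  so the weight bounds are asked for all real \<open>\<xi>\<close>, whereas translation invariance
  is asked only for shifts in \<open>space m\<close>, the integers for the circle.\<close>

locale frequency_measure = sigma_finite_measure m for m :: "real measure" +
  fixes weight_mass :: real
  assumes ident_measurable: "(\<lambda>x. x) \<in> borel_measurable m"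
    and integrable_weight_diff: "integrable m (\<lambda>\<eta>. weight (\<xi> - \<eta>))"
    and integral_weight_diff_le: "(LINT \<eta>|m. weight (\<xi> - \<eta>)) \<le> weight_mass"
    and integral_translate: "\<And>g :: real \<Rightarrow> complex. c \<in> space m \<Longrightarrow> (LINT \<eta>|m. g (\<eta> - c)) = (LINT \<eta>|m. g \<eta>)"
    and integral_reflect: "\<And>g :: real \<Rightarrow> complex. (LINT \<eta>|m. g (- \<eta>)) = (LINT \<eta>|m. g \<eta>)"
    and Ints_space: "\<int> \<subseteq> space m"
    and mass_near_0: "r > 0 \<Longrightarrow> 0 < (LINT \<eta>|m. indicator {-r..r} \<eta> :: real)"

section \<open>Lebesgue measure and counting measure on the integers\<close>

lemma integrable_weight_lborel: "integrable lborel weight"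
proof -
  have "integrable lborel (\<lambda>x::real. inverse (1 + x\<^sup>2))"
    using integrable_inverse_1_plus_square unfolding set_integrable_def by simp
  thus ?thesis by (simp add: weight_def[abs_def] inverse_eq_divide)
qed

lemma lborel_integrable_translate:
  fixes f :: "real \<Rightarrow> 'a::euclidean_space"
  shows "integrable lborel f \<Longrightarrow> integrable lborel (\<lambda>x. f (\<xi> - x))"
  using lborel_integrable_real_affine[of f "-1" \<xi>] by simp

lemma lborel_integral_translate:
  fixes f :: "real \<Rightarrow> 'a::euclidean_space"
  shows "(LINT x|lborel. f (\<xi> - x)) = (LINT x|lborel. f x)"
  using lborel_integral_real_affine[of "-1" f \<xi>] by simp

lemma frequency_measure_Line: "frequency_measure lborel (LINT x|lborel. weight x)"
proof (intro frequency_measure.intro frequency_measure_axioms.intro)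
  show "sigma_finite_measure (lborel :: real measure)" by unfold_locales
  show "integrable lborel (\<lambda>\<eta>. weight (\<xi> - \<eta>))" for \<xi>
    by (rule lborel_integrable_translate[OF integrable_weight_lborel])
  show "(LINT \<eta>|lborel. weight (\<xi> - \<eta>)) \<le> (LINT x|lborel. weight x)" for \<xi>
    by (simp add: lborel_integral_translate)
  fix g :: "real \<Rightarrow> complex"
  show "(LINT \<eta>|lborel. g (\<eta> - c)) = (LINT \<eta>|lborel. g \<eta>)" for c
    using lborel_integral_real_affine[of 1 g "-c"] by (simp add: algebra_simps)
  show "(LINT \<eta>|lborel. g (- \<eta>)) = (LINT \<eta>|lborel. g \<eta>)"
    using lborel_integral_translate[of g 0] by simp
next
  fix r :: real assume "r > 0"
  thus "0 < (LINT \<eta>|lborel. indicator {-r..r} \<eta> :: real)" by simp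
qed auto

lemma integrable_weight_Ints: "integrable (count_space \<int>) weight"
proof -
  have "summable (\<lambda>n. 1 / (1 + (real n)\<^sup>2))"
  proof (rule summable_comparison_test_ev)
    show "summable (\<lambda>n. inverse (real n ^ 2))" by (rule inverse_power_summable) simp
    show "\<forall>\<^sub>F n in sequentially. norm (1 / (1 + (real n)\<^sup>2)) \<le> inverse (real n ^ 2)"
      using eventually_gt_at_top[of 0]
      by eventually_elim (simp add: field_simps add_pos_nonneg)
  qed
  hence "summable (\<lambda>n. norm (weight (real n)))"
    by (simp add: weight_def)
  hence s: "Infinite_Set_Sum.abs_summable_on (\<lambda>n. weight (real n)) UNIV"
    by (simp add: abs_summable_on_nat_iff')
  have "Infinite_Set_Sum.abs_summable_on weight (range real)"
    by (rule abs_summable_on_reindex) (use s in simp)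
  moreover have "Infinite_Set_Sum.abs_summable_on weight ((\<lambda>n. - real n) ` UNIV)"
    by (rule abs_summable_on_reindex) (use s in simp)
  ultimately have "Infinite_Set_Sum.abs_summable_on weight (range real \<union> range (\<lambda>n. - real n))"
    by (rule abs_summable_on_union)
  moreover have "range real \<union> range (\<lambda>n. - real n) = \<int>"
  proof (intro equalityI subsetI)
    fix x :: real assume "x \<in> \<int>"
    then obtain k :: int where "x = of_int k" by (auto elim: Ints_cases)
    thus "x \<in> range real \<union> range (\<lambda>n. - real n)"
      by (cases k rule: int_cases2) auto
  qed auto
  ultimately show ?thesis by (simp add: Infinite_Set_Sum.abs_summable_on_def)
qed

text \<open>A shift by a real \<open>\<xi>\<close> does not preserve the integers. Rounding it down
  costs a factor \<open>3\<close> and leaves an integer shift, under which the sum of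
  \<open>weight\<close> is invariant.\<close>

lemma weight_diff_floor_le: "weight (\<xi> - \<eta>) \<le> 3 * weight (\<eta> - of_int \<lfloor>\<xi>\<rfloor>)"
proof -
  have "weight (\<xi> - \<eta>) = weight ((\<eta> - of_int \<lfloor>\<xi>\<rfloor>) + (of_int \<lfloor>\<xi>\<rfloor> - \<xi>))"
    by (simp add: weight_commute)
  also have "\<dots> \<le> 3 * weight (\<eta> - of_int \<lfloor>\<xi>\<rfloor>)"
    by (rule weight_shift_le) linarith
  finally show ?thesis .
qed

lemma bij_betw_Ints_translate: "c \<in> \<int> \<Longrightarrow> bij_betw (\<lambda>x::real. x - c) \<int> \<int>"
  by (rule bij_betw_byWitness[where f' = "\<lambda>x. x + c"]) auto

lemma frequency_measure_Circle:
  "frequency_measure (count_space \<int>) (3 * (LINT x|count_space \<int>. weight x))"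
proof (intro frequency_measure.intro frequency_measure_axioms.intro)
  have c: "countable (\<int> :: real set)" unfolding Ints_def by simp
  show "sigma_finite_measure (count_space (\<int> :: real set))"
    by (rule sigma_finite_measure_count_space_countable[OF c])
  have int: "integrable (count_space \<int>) (\<lambda>\<eta>. weight (\<eta> - of_int \<lfloor>\<xi>\<rfloor>))"
    and eq: "(LINT \<eta>|count_space \<int>. weight (\<eta> - of_int \<lfloor>\<xi>\<rfloor>)) = (LINT x|count_space \<int>. weight x)" for \<xi> :: real
  proof -
    have b: "bij_betw (\<lambda>x::real. x - of_int \<lfloor>\<xi>\<rfloor>) \<int> \<int>" by (rule bij_betw_Ints_translate) simp
    show "integrable (count_space \<int>) (\<lambda>\<eta>. weight (\<eta> - of_int \<lfloor>\<xi>\<rfloor>))"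
      using integrable_bij_count_space[OF b, of weight] integrable_weight_Ints by simp
    show "(LINT \<eta>|count_space \<int>. weight (\<eta> - of_int \<lfloor>\<xi>\<rfloor>)) = (LINT x|count_space \<int>. weight x)"
      using integral_bij_count_space[OF b, of weight] by simp
  qed
  show w: "integrable (count_space \<int>) (\<lambda>\<eta>. weight (\<xi> - \<eta>))" for \<xi>
    by (rule Bochner_Integration.integrable_bound[OF integrable_mult_right[OF int[of \<xi>], of 3]])
       (auto intro: weight_diff_floor_le)
  show "(LINT \<eta>|count_space \<int>. weight (\<xi> - \<eta>)) \<le> 3 * (LINT x|count_space \<int>. weight x)" for \<xi>
  proof -
    have "(LINT \<eta>|count_space \<int>. weight (\<xi> - \<eta>))
        \<le> (LINT \<eta>|count_space \<int>. 3 * weight (\<eta> - of_int \<lfloor>\<xi>\<rfloor>))"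
      by (intro integral_mono w integrable_mult_right int weight_diff_floor_le)
    also have "\<dots> = 3 * (LINT x|count_space \<int>. weight x)" by (simp add: eq)
    finally show ?thesis .
  qed
  fix g :: "real \<Rightarrow> complex"
  show "c \<in> space (count_space \<int>) \<Longrightarrow>
      (LINT \<eta>|count_space \<int>. g (\<eta> - c)) = (LINT \<eta>|count_space \<int>. g \<eta>)" for c
    using integral_bij_count_space[OF bij_betw_Ints_translate[of c], of g] by simp
  have "bij_betw (\<lambda>x::real. - x) \<int> \<int>"
    by (rule bij_betw_byWitness[where f' = "\<lambda>x. - x"]) auto
  from integral_bij_count_space[OF this, of g]
  show "(LINT \<eta>|count_space \<int>. g (- \<eta>)) = (LINT \<eta>|count_space \<int>. g \<eta>)" by simp
next
  fix r :: real assume r: "r > 0"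
  have fin: "finite ({-r..r} \<inter> \<int>)"
    using finite_int_segment[of "-r" r] by (rule finite_subset[rotated]) auto
  have *: "(LINT \<eta>|count_space \<int>. indicator {-r..r} \<eta> :: real) = real (card ({-r..r} \<inter> \<int>))"
  proof -
    have "(LINT \<eta>|count_space \<int>. indicator {-r..r} \<eta> :: real)
       = (LINT \<eta>|count_space \<int>. indicator ({-r..r} \<inter> \<int>) \<eta> :: real)"
      by (intro Bochner_Integration.integral_cong) (auto simp: indicator_def)
    also have "\<dots> = real (card ({-r..r} \<inter> \<int>))"
      using fin by (simp add: measure_count_space)
    finally show ?thesis .
  qed
  have "0 \<in> {-r..r} \<inter> \<int>" using r by auto
  with fin have "card ({-r..r} \<inter> \<int>) > 0" using card_gt_0_iff by blast
  thus "0 < (LINT \<eta>|count_space \<int>. indicator {-r..r} \<eta> :: real)" using * by simp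
qed auto

lemma frequency_measure_freq_measure: "\<exists>C. frequency_measure (freq_measure M) C"
  using frequency_measure_Line frequency_measure_Circle by (cases M) auto

section \<open>Convolution and Fourier synthesis\<close>

lemma continuous_on_LINT:
  fixes F :: "'p::metric_space \<Rightarrow> 'a \<Rightarrow> 'b::{banach, second_countable_topology}"
  assumes "\<And>y. y \<in> space M \<Longrightarrow> continuous_on UNIV (\<lambda>x. F x y)"
    and "\<And>x. F x \<in> borel_measurable M" and "integrable M w"
    and "\<And>x y. y \<in> space M \<Longrightarrow> norm (F x y) \<le> w y"
  shows "continuous_on UNIV (\<lambda>x. LINT y|M. F x y)"
proof (unfold continuous_on_sequentially o_def, intro allI ballI impI)
  fix X x assume "x \<in> UNIV" "(\<forall>n. X n \<in> UNIV) \<and> X \<longlonglongrightarrow> (x :: 'p)"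
  hence X: "X \<longlonglongrightarrow> x" by simp
  show "(\<lambda>n. LINT y|M. F (X n) y) \<longlonglongrightarrow> (LINT y|M. F x y)"
  proof (rule integral_dominated_convergence)
    show "AE y in M. (\<lambda>n. F (X n) y) \<longlonglongrightarrow> F x y"
    proof (rule AE_I2)
      fix y assume "y \<in> space M"
      from continuous_on_tendsto_compose[OF assms(1)[OF this] X]
      show "(\<lambda>n. F (X n) y) \<longlonglongrightarrow> F x y" by simp
    qed
  qed (use assms in auto)
qed

lemma integrable_dominated:
  fixes f :: "'a \<Rightarrow> 'b::{banach, second_countable_topology}" and g :: "'a \<Rightarrow> real"
  assumes "integrable M g" "f \<in> borel_measurable M" "\<And>x. x \<in> space M \<Longrightarrow> norm (f x) \<le> g x"
  shows "integrable M f"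
proof (rule Bochner_Integration.integrable_bound[OF assms(1,2)])
  show "AE x in M. norm (f x) \<le> norm (g x)"
    unfolding real_norm_def by (intro AE_I2 order_trans[OF assms(3) abs_ge_self])
qed

text \<open>Tonelli's criterion with the inner integral of the norm replaced by a majorant
  \<open>v\<close>, so that integrability on the product reduces to bounds in one variable.\<close>

lemma (in pair_sigma_finite) integrable_pair_bound:
  fixes f :: "'a \<Rightarrow> 'b \<Rightarrow> 'c::{banach, second_countable_topology}"
  assumes fm: "case_prod f \<in> borel_measurable (M1 \<Otimes>\<^sub>M M2)"
    and w: "\<And>x. x \<in> space M1 \<Longrightarrow> integrable M2 (w x)"
    and fw: "\<And>x y. norm (f x y) \<le> w x y"
    and v: "integrable M1 v" and wv: "\<And>x. x \<in> space M1 \<Longrightarrow> (LINT y|M2. w x y) \<le> v x"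
  shows "integrable (M1 \<Otimes>\<^sub>M M2) (case_prod f)"
proof (rule Fubini_integrable[OF fm])
  have fx: "f x \<in> borel_measurable M2" if "x \<in> space M1" for x
    using measurable_Pair2[OF fm that] by simp
  have fin: "integrable M2 (f x)" if "x \<in> space M1" for x
    by (rule integrable_dominated[OF w[OF that] fx[OF that] fw])
  show "AE x in M1. integrable M2 (\<lambda>y. case_prod f (x, y))"
    unfolding prod.case by (rule AE_I2) (rule fin)
  show "integrable M1 (\<lambda>x. LINT y|M2. norm (case_prod f (x, y)))"
  proof (rule Bochner_Integration.integrable_bound[OF v])
    have "(\<lambda>z. norm (case_prod f z)) \<in> borel_measurable (M1 \<Otimes>\<^sub>M M2)"
      by (rule measurable_compose[OF fm borel_measurable_norm])
    hence "case_prod (\<lambda>x y. norm (f x y)) \<in> borel_measurable (M1 \<Otimes>\<^sub>M M2)"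
      by (simp add: case_prod_unfold)
    thus "(\<lambda>x. LINT y|M2. norm (case_prod f (x, y))) \<in> borel_measurable M1"
      using M2.borel_measurable_lebesgue_integral[of "\<lambda>x y. norm (f x y)" M1] by simp
    show "AE x in M1. norm (LINT y|M2. norm (case_prod f (x, y))) \<le> norm (v x)"
    proof (rule AE_I2)
      fix x assume x: "x \<in> space M1"
      have "(LINT y|M2. norm (f x y)) \<le> (LINT y|M2. w x y)"
        by (intro integral_mono integrable_norm fin w fw x)
      with wv[OF x] show "norm (LINT y|M2. norm (case_prod f (x, y))) \<le> norm (v x)" by simp
    qed
  qed
qed

section \<open>The convolution algebra of functions decaying like \<open>weight\<close>\<close>

definition conv :: "real measure \<Rightarrow> (real \<Rightarrow> complex) \<Rightarrow> (real \<Rightarrow> complex) \<Rightarrow> real \<Rightarrow> complex" where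
  "conv m a b \<xi> = (LINT \<eta>|m. a \<eta> * b (\<xi> - \<eta>))"

text \<open>Index \<open>k\<close> means \<open>Suc k\<close> factors: on the line no function is a
  unit of convolution that could serve as the empty product.\<close>

primrec conv_power :: "real measure \<Rightarrow> (real \<Rightarrow> complex) \<Rightarrow> nat \<Rightarrow> real \<Rightarrow> complex" where
  "conv_power m a 0 = a"
| "conv_power m a (Suc k) = conv m a (conv_power m a k)"

definition synth :: "real measure \<Rightarrow> (real \<Rightarrow> complex) \<Rightarrow> real \<Rightarrow> complex" where
  "synth m a x = (LINT \<xi>|m. cis (x * \<xi>) * a \<xi>)"

text \<open>Continuity on all reals is demanded for the circle too. One function space then serves
  both domains, and identities hold at every frequency instead of almost everywhere.\<close>

definition decays :: "real \<Rightarrow> (real \<Rightarrow> complex) \<Rightarrow> bool" where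
  "decays R a \<longleftrightarrow> continuous_on UNIV a \<and> (\<forall>x. cmod (a x) \<le> R * weight x)"

definition hermitian :: "(real \<Rightarrow> complex) \<Rightarrow> bool" where
  "hermitian a \<longleftrightarrow> (\<forall>x. a (- x) = cnj (a x))"

lemma decays_continuous: "decays R a \<Longrightarrow> continuous_on UNIV a"
  by (simp add: decays_def)

lemma decays_le: "decays R a \<Longrightarrow> cmod (a x) \<le> R * weight x"
  by (simp add: decays_def)

lemma decays_measurable: "decays R a \<Longrightarrow> a \<in> borel_measurable borel"
  by (intro borel_measurable_continuous_onI decays_continuous)

lemma decays_nonneg:
  assumes "decays R a" shows "0 \<le> R"
proof -
  have "0 \<le> R * weight 0" using decays_le[OF assms, of 0] norm_ge_zero order_trans by blast
  thus ?thesis by (simp add: weight_def)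
qed

lemma decays_le_const:
  assumes "decays R a" shows "cmod (a x) \<le> R"
proof -
  have "R * weight x \<le> R * 1"
    by (rule mult_left_mono[OF weight_le_1 decays_nonneg[OF assms]])
  thus ?thesis using decays_le[OF assms, of x] by simp
qed

context frequency_measure
begin

lemma measurable_freq: "f \<in> borel_measurable borel \<Longrightarrow> f \<in> borel_measurable m"
  using measurable_compose[OF ident_measurable] by blast

lemma integrable_weight: "integrable m weight"
  using integrable_weight_diff[of 0] by simp

lemma integral_weight_le: "(LINT \<eta>|m. weight \<eta>) \<le> weight_mass"
  using integral_weight_diff_le[of 0] by simp

lemma weight_mass_nonneg: "0 \<le> weight_mass"
proof -
  have "0 \<le> (LINT \<eta>|m. weight \<eta>)" by simp
  thus ?thesis by (rule order_trans[OF _ integral_weight_le])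
qed

lemma weight_mult_integrable: "integrable m (\<lambda>\<eta>. weight \<eta> * weight (\<xi> - \<eta>))"
proof (rule Bochner_Integration.integrable_bound[OF integrable_weight])
  show "(\<lambda>\<eta>. weight \<eta> * weight (\<xi> - \<eta>)) \<in> borel_measurable m"
    by (rule measurable_freq) measurable
  show "AE x in m. norm (weight x * weight (\<xi> - x)) \<le> norm (weight x)"
    using weight_le_1 by (intro AE_I2) (auto simp: mult_le_cancel_left1 abs_mult)
qed

lemma integral_weight_mult_le:
  "(LINT \<eta>|m. weight \<eta> * weight (\<xi> - \<eta>)) \<le> 4 * weight_mass * weight \<xi>"
proof -
  have "(LINT \<eta>|m. weight \<eta> * weight (\<xi> - \<eta>))
      \<le> (LINT \<eta>|m. 2 * weight \<xi> * (weight \<eta> + weight (\<xi> - \<eta>)))"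
    by (intro integral_mono weight_mult_integrable weight_mult_le integrable_mult_right
        Bochner_Integration.integrable_add integrable_weight integrable_weight_diff)
  also have "\<dots> = 2 * weight \<xi> * ((LINT \<eta>|m. weight \<eta>) + (LINT \<eta>|m. weight (\<xi> - \<eta>)))"
    by (simp add: integrable_weight integrable_weight_diff)
  also have "\<dots> \<le> 2 * weight \<xi> * (weight_mass + weight_mass)"
    by (intro mult_left_mono add_mono integral_weight_le integral_weight_diff_le) simp
  finally show ?thesis by (simp add: algebra_simps)
qed

lemma decays_integrable:
  assumes "decays R a" shows "integrable m a"
proof (rule integrable_dominated)
  show "integrable m (\<lambda>x. R * weight x)" by (intro integrable_mult_right integrable_weight)
  show "a \<in> borel_measurable m" by (intro measurable_freq decays_measurable[OF assms])
qed (rule decays_le[OF assms])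

lemma mult_diff_measurable:
  assumes "a \<in> borel_measurable borel" "b \<in> borel_measurable borel"
  shows "(\<lambda>\<eta>. a \<eta> * b (\<xi> - \<eta>) :: complex) \<in> borel_measurable m"
proof -
  note assms[measurable]
  show ?thesis by (intro measurable_freq) measurable
qed

lemma norm_mult_diff_le:
  assumes "decays R a" "decays Q b"
  shows "cmod (a \<eta> * b (\<xi> - \<eta>)) \<le> R * Q * (weight \<eta> * weight (\<xi> - \<eta>))"
proof -
  have "cmod (a \<eta> * b (\<xi> - \<eta>)) \<le> (R * weight \<eta>) * (Q * weight (\<xi> - \<eta>))"
    unfolding norm_mult using decays_nonneg[OF assms(1)]
    by (intro mult_mono decays_le assms) auto
  thus ?thesis by (simp only: ac_simps)
qed

lemma conv_integrable:
  assumes "decays R a" "decays Q b"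
  shows "integrable m (\<lambda>\<eta>. a \<eta> * b (\<xi> - \<eta>))"
proof (rule integrable_dominated)
  show "integrable m (\<lambda>\<eta>. R * Q * (weight \<eta> * weight (\<xi> - \<eta>)))"
    by (intro integrable_mult_right weight_mult_integrable)
  show "(\<lambda>\<eta>. a \<eta> * b (\<xi> - \<eta>)) \<in> borel_measurable m"
    by (rule mult_diff_measurable[OF decays_measurable[OF assms(1)] decays_measurable[OF assms(2)]])
qed (rule norm_mult_diff_le[OF assms])

lemma norm_conv_le:
  assumes "decays R a" "decays Q b"
  shows "cmod (conv m a b \<xi>) \<le> 4 * weight_mass * R * Q * weight \<xi>"
proof -
  have "cmod (conv m a b \<xi>) \<le> (LINT \<eta>|m. R * Q * (weight \<eta> * weight (\<xi> - \<eta>)))"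
    unfolding conv_def
  proof (rule Bochner_Integration.integral_norm_bound_integral)
    show "integrable m (\<lambda>\<eta>. R * Q * (weight \<eta> * weight (\<xi> - \<eta>)))"
      by (intro integrable_mult_right weight_mult_integrable)
  qed (use conv_integrable[OF assms] norm_mult_diff_le[OF assms] in auto)
  also have "\<dots> = R * Q * (LINT \<eta>|m. (weight \<eta> * weight (\<xi> - \<eta>)))" by simp
  also have "\<dots> \<le> R * Q * (4 * weight_mass * weight \<xi>)"
    by (intro mult_left_mono integral_weight_mult_le mult_nonneg_nonneg
        decays_nonneg[OF assms(1)] decays_nonneg[OF assms(2)])
  finally show ?thesis by (simp add: algebra_simps)
qed

text \<open>The parameter will be time. The majorant keeps only the weight of the first factor, so
  it is the same at all points where continuity is tested.\<close>

lemma conv_continuous_param: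
  fixes a b :: "'p::metric_space \<Rightarrow> real \<Rightarrow> complex"
  assumes "continuous_on UNIV (case_prod a)" "continuous_on UNIV (case_prod b)"
    and "\<And>\<tau>. decays R (a \<tau>)" "\<And>\<tau>. decays Q (b \<tau>)"
  shows "continuous_on UNIV (\<lambda>(\<tau>, \<xi>). conv m (a \<tau>) (b \<tau>) \<xi>)"
proof -
  have "continuous_on UNIV (\<lambda>p. LINT \<eta>|m. a (fst p) \<eta> * b (fst p) (snd p - \<eta>))"
  proof (rule continuous_on_LINT)
    show "continuous_on UNIV (\<lambda>x. a (fst x) \<eta> * b (fst x) (snd x - \<eta>))" for \<eta>
    proof (intro continuous_intros)
      have "continuous_on UNIV (\<lambda>x::'p \<times> real. case_prod a (fst x, \<eta>))"
        by (rule continuous_on_compose2[OF assms(1)]) (auto intro!: continuous_intros)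
      thus "continuous_on UNIV (\<lambda>x::'p \<times> real. a (fst x) \<eta>)" by simp
      have "continuous_on UNIV (\<lambda>x::'p \<times> real. case_prod b (fst x, snd x - \<eta>))"
        by (rule continuous_on_compose2[OF assms(2)]) (auto intro!: continuous_intros)
      thus "continuous_on UNIV (\<lambda>x::'p \<times> real. b (fst x) (snd x - \<eta>))" by simp
    qed
    show "(\<lambda>\<eta>. a (fst x) \<eta> * b (fst x) (snd x - \<eta>)) \<in> borel_measurable m" for x
      by (rule mult_diff_measurable) (use assms decays_measurable in blast)+
    show "integrable m (\<lambda>\<eta>. R * Q * weight \<eta>)" by (intro integrable_mult_right integrable_weight)
    show "cmod (a (fst x) \<eta> * b (fst x) (snd x - \<eta>)) \<le> R * Q * weight \<eta>" for x \<eta>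
    proof -
      have "cmod (a (fst x) \<eta> * b (fst x) (snd x - \<eta>)) \<le> (R * weight \<eta>) * Q"
        unfolding norm_mult using decays_nonneg[OF assms(3)]
        by (intro mult_mono decays_le decays_le_const assms) auto
      thus ?thesis by (simp only: ac_simps)
    qed
  qed
  thus ?thesis by (simp add: conv_def case_prod_unfold)
qed

lemma decays_conv:
  assumes "decays R a" "decays Q b"
  shows "decays (4 * weight_mass * R * Q) (conv m a b)"
proof -
  have "continuous_on UNIV (\<lambda>(\<tau>::real, \<xi>). conv m a b \<xi>)"
    by (rule conv_continuous_param[where R = R and Q = Q])
       (auto simp: assms case_prod_unfold
         intro!: continuous_on_compose2[OF decays_continuous[OF assms(1)]]
           continuous_on_compose2[OF decays_continuous[OF assms(2)]] continuous_intros)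
  from continuous_on_compose2[OF this continuous_on_Pair[OF continuous_on_const continuous_on_id], of 0 UNIV]
  show ?thesis
    using norm_conv_le[OF assms] by (auto simp: decays_def)
qed

lemma decays_conv_power:
  assumes "decays R a"
  shows "decays ((4 * weight_mass) ^ k * R ^ Suc k) (conv_power m a k)"
proof (induction k)
  case (Suc k)
  from decays_conv[OF assms Suc] show ?case by (simp add: algebra_simps)
qed (use assms in simp)

lemma conv_power_continuous_param:
  fixes a :: "'p::metric_space \<Rightarrow> real \<Rightarrow> complex"
  assumes "continuous_on UNIV (case_prod a)" "\<And>\<tau>. decays R (a \<tau>)"
  shows "continuous_on UNIV (\<lambda>(\<tau>, \<xi>). conv_power m (a \<tau>) k \<xi>)"
proof (induction k)
  case (Suc k)
  from conv_continuous_param[OF assms(1) Suc assms(2) decays_conv_power[OF assms(2)]]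
  show ?case by simp
qed (use assms in \<open>simp add: case_prod_unfold\<close>)

lemma decays_diff:
  "decays R a \<Longrightarrow> decays Q b \<Longrightarrow> (\<And>x. cmod (a x - b x) \<le> \<delta> * weight x) \<Longrightarrow> decays \<delta> (\<lambda>x. a x - b x)"
  by (auto simp: decays_def intro!: continuous_intros)

text \<open>The factors of a product are exchanged one at a time; their number gives
  \<open>Suc k\<close>.\<close>

lemma conv_power_lipschitz:
  assumes "decays R a" "decays R b" and "\<And>x. cmod (a x - b x) \<le> \<delta> * weight x"
  shows "cmod (conv_power m a k x - conv_power m b k x)
           \<le> real (Suc k) * (4 * weight_mass) ^ k * R ^ k * \<delta> * weight x"
proof (induction k arbitrary: x)
  case (Suc k)
  let ?D = "4 * weight_mass"
  let ?A = "conv_power m a k" and ?B = "conv_power m b k"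
  note d = decays_diff[OF assms]
  note A = decays_conv_power[OF assms(1), of k]
  note B = decays_conv_power[OF assms(2), of k]
  note e = decays_diff[OF A B Suc.IH]
  have "conv m a ?A x - conv m b ?B x
      = conv m (\<lambda>x. a x - b x) ?A x + conv m b (\<lambda>x. ?A x - ?B x) x"
    using conv_integrable[OF assms(1) A, of x] conv_integrable[OF assms(2) A, of x]
       conv_integrable[OF assms(2) B, of x]
    by (simp add: conv_def algebra_simps)
  also have "cmod \<dots> \<le> ?D * \<delta> * (?D ^ k * R ^ Suc k) * weight x
      + ?D * R * (real (Suc k) * ?D ^ k * R ^ k * \<delta>) * weight x"
    by (rule norm_triangle_mono[OF norm_conv_le[OF d A] norm_conv_le[OF assms(2) e]])
  also have "\<dots> = real (Suc (Suc k)) * ?D ^ Suc k * R ^ Suc k * \<delta> * weight x"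
    by (simp add: algebra_simps)
  finally show ?case by simp
qed (use assms in simp)

lemma hermitian_conv:
  assumes "hermitian a" "hermitian b"
  shows "hermitian (conv m a b)"
proof -
  have "conv m a b (- \<xi>) = cnj (conv m a b \<xi>)" for \<xi>
  proof -
    have "conv m a b (- \<xi>) = (LINT \<eta>|m. a (- \<eta>) * b (- \<xi> - (- \<eta>)))"
      unfolding conv_def by (rule integral_reflect[symmetric])
    also have "\<dots> = (LINT \<eta>|m. cnj (a \<eta> * b (\<xi> - \<eta>)))"
    proof (rule Bochner_Integration.integral_cong)
      fix \<eta>
      have "b (- \<xi> - (- \<eta>)) = cnj (b (\<xi> - \<eta>))"
        using assms(2)[unfolded hermitian_def, rule_format, of "\<xi> - \<eta>"] by (simp add: algebra_simps)
      thus "a (- \<eta>) * b (- \<xi> - (- \<eta>)) = cnj (a \<eta> * b (\<xi> - \<eta>))"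
        using assms(1) by (simp add: hermitian_def)
    qed simp
    also have "\<dots> = cnj (conv m a b \<xi>)" unfolding conv_def by (rule Bochner_Integration.integral_cnj)
    finally show ?thesis .
  qed
  thus ?thesis by (simp add: hermitian_def)
qed

lemma hermitian_conv_power: "hermitian a \<Longrightarrow> hermitian (conv_power m a k)"
  by (induction k) (auto intro: hermitian_conv)

lemma synth_real:
  assumes "hermitian a"
  shows "Im (synth m a x) = 0"
proof -
  have "synth m a x = (LINT \<xi>|m. cis (x * (- \<xi>)) * a (- \<xi>))"
    unfolding synth_def by (rule integral_reflect[symmetric])
  also have "\<dots> = (LINT \<xi>|m. cnj (cis (x * \<xi>) * a \<xi>))"
    using assms by (simp add: hermitian_def cis_cnj)
  also have "\<dots> = cnj (synth m a x)" unfolding synth_def by (rule Bochner_Integration.integral_cnj)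
  finally show ?thesis by (metis cnj.simps(2) neg_equal_zero)
qed

section \<open>Synthesis turns convolution into multiplication\<close>

lemma pair_sigma_finite_freq: "pair_sigma_finite m m"
  by (intro pair_sigma_finite.intro sigma_finite_measure_axioms)

lemma fst_measurable_freq: "fst \<in> borel_measurable (m \<Otimes>\<^sub>M N)"
  by (rule measurable_compose[OF measurable_fst ident_measurable])

lemma snd_measurable_freq: "snd \<in> borel_measurable (N \<Otimes>\<^sub>M m)"
  by (rule measurable_compose[OF measurable_snd ident_measurable])

text \<open>Fubini, then a translation of the inner variable by \<open>\<eta>\<close>. This is
  legitimate on the circle because \<open>\<eta>\<close> is itself a frequency in
  \<open>space m\<close>.\<close>

lemma synth_conv:
  assumes a: "decays R a" and b: "decays Q b"
  shows "synth m (conv m a b) x = synth m a x * synth m b x"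
proof -
  interpret pair_sigma_finite m m by (rule pair_sigma_finite_freq)
  let ?f = "\<lambda>\<eta> \<xi>. cis (x * \<xi>) * (a \<eta> * b (\<xi> - \<eta>))"
  have am: "a \<in> borel_measurable borel" and bm: "b \<in> borel_measurable borel"
    using a b by (auto intro: decays_measurable)
  have cism: "cis \<in> borel_measurable borel"
    by (intro borel_measurable_continuous_onI continuous_intros)
  have fm: "case_prod ?f \<in> borel_measurable (m \<Otimes>\<^sub>M m)"
  proof -
    have 1: "(\<lambda>p. a (fst p)) \<in> borel_measurable (m \<Otimes>\<^sub>M m)"
      by (rule measurable_compose[OF fst_measurable_freq am])
    have 2: "(\<lambda>p. b (snd p - fst p)) \<in> borel_measurable (m \<Otimes>\<^sub>M m)"
      by (rule measurable_compose[OF borel_measurable_diff[OF snd_measurable_freq fst_measurable_freq] bm])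
    have 3: "(\<lambda>p. cis (x * snd p)) \<in> borel_measurable (m \<Otimes>\<^sub>M m)"
      by (rule measurable_compose[OF borel_measurable_times[OF borel_measurable_const snd_measurable_freq] cism])
    from borel_measurable_times[OF 3 borel_measurable_times[OF 1 2]] show ?thesis
      by (simp add: case_prod_unfold)
  qed
  have bd: "cmod (?f \<eta> \<xi>) \<le> R * Q * (weight \<eta> * weight (\<xi> - \<eta>))" for \<eta> \<xi>
    using norm_mult_diff_le[OF a b, of \<eta> \<xi>] by (simp add: norm_mult)
  have int: "integrable (m \<Otimes>\<^sub>M m) (case_prod ?f)"
  proof (rule integrable_pair_bound[OF fm _ bd])
    show "integrable m (\<lambda>\<xi>. R * Q * (weight \<eta> * weight (\<xi> - \<eta>)))" for \<eta>
      using integrable_weight_diff[of \<eta>] by (simp add: weight_commute[of _ \<eta>])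
    show "integrable m (\<lambda>\<eta>. R * Q * weight \<eta> * weight_mass)"
      using integrable_weight by simp
    show "(LINT \<xi>|m. R * Q * (weight \<eta> * weight (\<xi> - \<eta>))) \<le> R * Q * weight \<eta> * weight_mass" for \<eta>
    proof -
      have "(LINT \<xi>|m. R * Q * (weight \<eta> * weight (\<xi> - \<eta>))) = R * Q * weight \<eta> * (LINT \<xi>|m. weight (\<eta> - \<xi>))"
        by (simp add: weight_commute[of _ \<eta>])
      also have "\<dots> \<le> R * Q * weight \<eta> * weight_mass"
        using decays_nonneg[OF a] decays_nonneg[OF b]
        by (intro mult_left_mono integral_weight_diff_le) simp
      finally show ?thesis .
    qed
  qed
  have "synth m (conv m a b) x = (LINT \<xi>|m. LINT \<eta>|m. ?f \<eta> \<xi>)"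
    by (simp add: synth_def conv_def)
  also have "\<dots> = (LINT \<eta>|m. LINT \<xi>|m. ?f \<eta> \<xi>)"
    by (rule Fubini_integral[OF int])
  also have "\<dots> = (LINT \<eta>|m. cis (x * \<eta>) * a \<eta> * synth m b x)"
  proof (rule Bochner_Integration.integral_cong)
    fix \<eta> assume "\<eta> \<in> space m"
    have "(LINT \<xi>|m. ?f \<eta> \<xi>)
       = (LINT \<xi>|m. (\<lambda>\<zeta>. cis (x * \<eta>) * a \<eta> * (cis (x * \<zeta>) * b \<zeta>)) (\<xi> - \<eta>))"
    proof (rule Bochner_Integration.integral_cong)
      fix \<xi>
      have "cis (x * \<xi>) = cis (x * \<eta>) * cis (x * (\<xi> - \<eta>))"
        by (simp add: cis_mult algebra_simps)
      thus "?f \<eta> \<xi> = (\<lambda>\<zeta>. cis (x * \<eta>) * a \<eta> * (cis (x * \<zeta>) * b \<zeta>)) (\<xi> - \<eta>)"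
        by (simp add: algebra_simps)
    qed simp
    also have "\<dots> = (LINT \<zeta>|m. cis (x * \<eta>) * a \<eta> * (cis (x * \<zeta>) * b \<zeta>))"
      by (rule integral_translate) fact
    also have "\<dots> = cis (x * \<eta>) * a \<eta> * synth m b x"
      by (simp add: synth_def)
    finally show "(LINT \<xi>|m. ?f \<eta> \<xi>) = cis (x * \<eta>) * a \<eta> * synth m b x" .
  qed simp
  also have "\<dots> = synth m a x * synth m b x"
    by (simp add: synth_def)
  finally show ?thesis .
qed

lemma synth_conv_power:
  assumes "decays R a"
  shows "synth m (conv_power m a k) x = synth m a x ^ Suc k"
  by (induction k) (auto simp: synth_conv[OF assms decays_conv_power[OF assms]])

lemma continuous_on_synth:
  assumes "decays R a" shows "continuous_on UNIV (synth m a)"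
proof -
  have "continuous_on UNIV (\<lambda>x. LINT \<xi>|m. cis (x * \<xi>) * a \<xi>)"
  proof (rule continuous_on_LINT)
    note decays_measurable[OF assms, measurable]
    have [measurable]: "cis \<in> borel_measurable borel"
      by (intro borel_measurable_continuous_onI continuous_intros)
    show "(\<lambda>\<xi>. cis (x * \<xi>) * a \<xi>) \<in> borel_measurable m" for x
      by (intro measurable_freq) measurable
    show "integrable m (\<lambda>\<xi>. R * weight \<xi>)" by (intro integrable_mult_right integrable_weight)
  qed (auto intro!: continuous_intros simp: norm_mult decays_le[OF assms])
  thus ?thesis by (simp add: synth_def[abs_def])
qed

lemma norm_synth_le:
  assumes "decays R a" shows "cmod (synth m a x) \<le> R * weight_mass"
proof -
  have i: "integrable m (\<lambda>\<xi>. cis (x * \<xi>) * a \<xi>)"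
  proof (rule Bochner_Integration.integrable_bound[OF decays_integrable[OF assms]])
    note decays_measurable[OF assms, measurable]
    have [measurable]: "cis \<in> borel_measurable borel"
      by (intro borel_measurable_continuous_onI continuous_intros)
    show "(\<lambda>\<xi>. cis (x * \<xi>) * a \<xi>) \<in> borel_measurable m"
      by (intro measurable_freq) measurable
  qed (simp add: norm_mult)
  have "cmod (synth m a x) \<le> (LINT \<xi>|m. R * weight \<xi>)"
    unfolding synth_def
    by (rule Bochner_Integration.integral_norm_bound_integral[OF i])
       (auto simp: norm_mult decays_le[OF assms] intro!: integrable_weight)
  also have "\<dots> \<le> R * weight_mass"
    using integral_weight_le decays_nonneg[OF assms] by (simp add: mult_left_mono)
  finally show ?thesis .
qed

end

section \<open>Fourier inversion\<close>

lemma cis_borel_measurable [measurable]: "cis \<in> borel_measurable borel"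
  by (intro borel_measurable_continuous_onI continuous_intros)

lemma LINT_cis_std_normal:
  "(LINT z|lborel. cis (t * z) * complex_of_real (std_normal_density z)) = complex_of_real (exp (- (t\<^sup>2) / 2))"
proof -
  have "char std_normal_distribution t = (LINT z|lborel. std_normal_density z *\<^sub>R cis (t * z))"
    unfolding char_def
    by (subst integral_density) (auto simp: cis_conv_exp mult.commute)
  also have "\<dots> = (LINT z|lborel. cis (t * z) * complex_of_real (std_normal_density z))"
    by (simp add: scaleR_conv_of_real mult.commute)
  finally show ?thesis by (simp add: char_std_normal_distribution)
qed

lemma integrable_gaussian:
  assumes "\<delta> > 0"
  shows "integrable lborel (\<lambda>x. exp (- ((\<delta> * x)\<^sup>2) / 2) :: real)"
proof -
  have "integrable lborel (\<lambda>z. sqrt (2 * pi) * std_normal_density z)" by simp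
  hence "integrable lborel (\<lambda>z. exp (- z\<^sup>2 / 2) :: real)"
    by (simp add: std_normal_density_def)
  from lborel_integrable_real_affine[OF this, of \<delta> 0] assms show ?thesis by simp
qed

text \<open>The characteristic function of the normal law, rescaled: the transform of a wide
  Gaussian is \<open>2 pi\<close> times the normal density of standard deviation
  \<open>\<delta>\<close>, an approximate identity as \<open>\<delta>\<close> tends to
  \<open>0\<close>.\<close>

lemma LINT_cis_gaussian:
  assumes "\<delta> > 0"
  shows "(LINT x|lborel. cis (x * u) * complex_of_real (exp (- ((\<delta> * x)\<^sup>2) / 2)))
        = complex_of_real (2 * pi / \<delta> * std_normal_density (u / \<delta>))"
proof -
  have "(LINT z|lborel. cis (u / \<delta> * z) * complex_of_real (std_normal_density z))
    = \<bar>\<delta>\<bar> *\<^sub>R (LINT x|lborel. cis (u / \<delta> * (0 + \<delta> * x)) * complex_of_real (std_normal_density (0 + \<delta> * x)))"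
    by (rule lborel_integral_real_affine) (use assms in simp)
  also have "\<dots> = complex_of_real (\<delta> / sqrt (2 * pi)) * (LINT x|lborel. cis (x * u) * complex_of_real (exp (- ((\<delta> * x)\<^sup>2) / 2)))"
  proof -
    have "(LINT x|lborel. cis (u / \<delta> * (0 + \<delta> * x)) * complex_of_real (std_normal_density (0 + \<delta> * x)))
      = (LINT x|lborel. complex_of_real (1 / sqrt (2 * pi)) * (cis (x * u) * complex_of_real (exp (- ((\<delta> * x)\<^sup>2) / 2))))"
      using assms by (intro Bochner_Integration.integral_cong) (auto simp: std_normal_density_def mult_ac)
    thus ?thesis using assms by (simp add: scaleR_conv_of_real)
  qed
  finally have "(LINT x|lborel. cis (x * u) * complex_of_real (exp (- ((\<delta> * x)\<^sup>2) / 2)))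
     = complex_of_real (sqrt (2 * pi) / \<delta>) * complex_of_real (exp (- ((u / \<delta>)\<^sup>2) / 2))"
    unfolding LINT_cis_std_normal using assms by (simp add: field_simps)
  also have "\<dots> = complex_of_real (2 * pi / \<delta> * std_normal_density (u / \<delta>))"
  proof -
    have eq: "sqrt (2 * pi) = 2 * pi / sqrt (2 * pi)" by (simp add: real_div_sqrt)
    have "sqrt (2 * pi) / \<delta> * E = 2 * pi / \<delta> * (1 / sqrt (2 * pi) * E)" for E
      using arg_cong[OF eq, of "\<lambda>s. s / \<delta> * E"] by (simp add: mult_ac)
    thus ?thesis unfolding std_normal_density_def of_real_mult[symmetric] by (simp only: minus_divide_left)
  qed
  finally show ?thesis .
qed

interpretation line: frequency_measure lborel "LINT x|lborel. weight x"
  by (rule frequency_measure_Line)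

text \<open>The damping makes the double integral absolutely convergent, so Fubini applies; what
  remains is an average of \<open>b\<close> around \<open>\<xi>\<close> at scale
  \<open>\<delta>\<close>.\<close>

lemma synth_gaussian:
  fixes b :: "real \<Rightarrow> complex"
  assumes b: "decays R b" and \<delta>: "\<delta> > 0"
  shows "(LINT x|lborel. cis (- (x * \<xi>)) * complex_of_real (exp (- ((\<delta> * x)\<^sup>2) / 2)) * synth lborel b x)
       = 2 * pi * (LINT z|lborel. b (\<xi> + \<delta> * z) * complex_of_real (std_normal_density z))"
proof -
  let ?G = "\<lambda>x. exp (- ((\<delta> * x)\<^sup>2) / 2) :: real"
  let ?f = "\<lambda>x \<eta>. cis (- (x * \<xi>)) * complex_of_real (?G x) * (cis (x * \<eta>) * b \<eta>)"
  note decays_measurable[OF b, measurable]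
  have int: "integrable (lborel \<Otimes>\<^sub>M lborel) (case_prod ?f)"
  proof (rule lborel_pair.integrable_pair_bound)
    show "case_prod ?f \<in> borel_measurable (lborel \<Otimes>\<^sub>M lborel)" by measurable
    show "integrable lborel (\<lambda>\<eta>. ?G x * (R * weight \<eta>))" for x
      using integrable_weight_lborel by simp
    show "norm (?f x \<eta>) \<le> ?G x * (R * weight \<eta>)" for x \<eta>
      by (simp add: norm_mult decays_le[OF b])
    show "integrable lborel (\<lambda>x. ?G x * (R * (LINT \<eta>|lborel. weight \<eta>)))"
      using integrable_gaussian[OF \<delta>] by simp
  qed simp
  have "(LINT x|lborel. cis (- (x * \<xi>)) * complex_of_real (?G x) * synth lborel b x)
      = (LINT x|lborel. LINT \<eta>|lborel. ?f x \<eta>)"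
    by (simp add: synth_def)
  also have "\<dots> = (LINT \<eta>|lborel. LINT x|lborel. ?f x \<eta>)"
    by (rule lborel_pair.Fubini_integral[OF int, symmetric])
  also have "\<dots> = (LINT \<eta>|lborel. complex_of_real (2 * pi / \<delta> * std_normal_density ((\<eta> - \<xi>) / \<delta>)) * b \<eta>)"
  proof (rule Bochner_Integration.integral_cong)
    fix \<eta>
    have "(LINT x|lborel. ?f x \<eta>) = (LINT x|lborel. (cis (x * (\<eta> - \<xi>)) * complex_of_real (?G x)) * b \<eta>)"
    proof (rule Bochner_Integration.integral_cong)
      fix x
      have "cis (x * (\<eta> - \<xi>)) = cis (- (x * \<xi>)) * cis (x * \<eta>)"
        by (simp add: cis_mult algebra_simps)
      thus "?f x \<eta> = (cis (x * (\<eta> - \<xi>)) * complex_of_real (?G x)) * b \<eta>" by (simp add: mult_ac)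
    qed simp
    also have "\<dots> = complex_of_real (2 * pi / \<delta> * std_normal_density ((\<eta> - \<xi>) / \<delta>)) * b \<eta>"
      by (subst integral_mult_left_zero, subst LINT_cis_gaussian[OF \<delta>]) simp
    finally show "(LINT x|lborel. ?f x \<eta>) = complex_of_real (2 * pi / \<delta> * std_normal_density ((\<eta> - \<xi>) / \<delta>)) * b \<eta>" .
  qed simp
  also have "\<dots> = \<bar>\<delta>\<bar> *\<^sub>R (LINT z|lborel. complex_of_real (2 * pi / \<delta> * std_normal_density ((\<xi> + \<delta> * z - \<xi>) / \<delta>)) * b (\<xi> + \<delta> * z))"
    by (rule lborel_integral_real_affine) (use \<delta> in simp)
  also have "\<dots> = \<bar>\<delta>\<bar> *\<^sub>R (LINT z|lborel. complex_of_real (2 * pi / \<delta>) * (b (\<xi> + \<delta> * z) * complex_of_real (std_normal_density z)))"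
    using \<delta> by (simp add: mult_ac)
  also have "\<dots> = 2 * pi * (LINT z|lborel. b (\<xi> + \<delta> * z) * complex_of_real (std_normal_density z))"
    using \<delta> by (simp add: scaleR_conv_of_real)
  finally show ?thesis .
qed

lemma LINT_gaussian_approx:
  fixes b :: "real \<Rightarrow> complex"
  assumes b: "decays R b"
  shows "(\<lambda>n. LINT z|lborel. b (\<xi> + inverse (real (Suc n)) * z) * complex_of_real (std_normal_density z)) \<longlonglongrightarrow> b \<xi>"
proof -
  have "(\<lambda>n. LINT z|lborel. b (\<xi> + inverse (real (Suc n)) * z) * complex_of_real (std_normal_density z))
    \<longlonglongrightarrow> (LINT z|lborel. b \<xi> * complex_of_real (std_normal_density z))"
  proof (rule integral_dominated_convergence)
    note decays_measurable[OF b, measurable]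
    show "(\<lambda>z. b (\<xi> + inverse (real (Suc n)) * z) * complex_of_real (std_normal_density z)) \<in> borel_measurable lborel" for n
      by measurable
    show "(\<lambda>z. b \<xi> * complex_of_real (std_normal_density z)) \<in> borel_measurable lborel" by measurable
    show "integrable lborel (\<lambda>z. R * std_normal_density z)" by simp
    show "AE z in lborel. (\<lambda>n. b (\<xi> + inverse (real (Suc n)) * z) * complex_of_real (std_normal_density z))
        \<longlonglongrightarrow> b \<xi> * complex_of_real (std_normal_density z)"
    proof (intro AE_I2 tendsto_mult tendsto_const)
      fix z :: real
      have "(\<lambda>n. \<xi> + inverse (real (Suc n)) * z) \<longlonglongrightarrow> \<xi> + 0 * z"
        by (intro tendsto_intros LIMSEQ_inverse_real_of_nat)
      from continuous_on_tendsto_compose[OF decays_continuous[OF b] this]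
      show "(\<lambda>n. b (\<xi> + inverse (real (Suc n)) * z)) \<longlonglongrightarrow> b \<xi>" by simp
    qed
    show "AE z in lborel. norm (b (\<xi> + inverse (real (Suc n)) * z) * complex_of_real (std_normal_density z))
        \<le> R * std_normal_density z" for n
      by (intro AE_I2) (auto simp: norm_mult intro!: mult_right_mono decays_le_const[OF b])
  qed
  also have "(LINT z|lborel. b \<xi> * complex_of_real (std_normal_density z)) = b \<xi>"
    by (simp del: of_real_mult)
  finally show ?thesis .
qed

lemma gaussian_tendsto: "(\<lambda>n. exp (- ((inverse (real (Suc n)) * x)\<^sup>2) / 2)) \<longlonglongrightarrow> (1::real)"
proof -
  have "(\<lambda>n. exp (- ((inverse (real (Suc n)) * x)\<^sup>2) / 2)) \<longlonglongrightarrow> exp (- ((0 * x)\<^sup>2) / 2)"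
    by (intro tendsto_intros LIMSEQ_inverse_real_of_nat) simp
  thus ?thesis by simp
qed

text \<open>A substitute for Plancherel. The square of the real function
  \<open>synth lborel a\<close> is the synthesis of the self-convolution of \<open>a\<close>, so its
  Gaussian-damped integrals converge to \<open>2 pi\<close> times that convolution at
  \<open>0\<close>. They increase as the damping weakens, and monotone convergence
  concludes.\<close>

lemma square_integrable_synth:
  fixes a :: "real \<Rightarrow> complex"
  assumes a: "decays R a" "hermitian a"
  shows "integrable lborel (\<lambda>x. (Re (synth lborel a x))\<^sup>2)"
proof -
  let ?G = "\<lambda>n x. exp (- ((inverse (real (Suc n)) * x)\<^sup>2) / 2) :: real"
  let ?b = "conv lborel a a"
  note b = line.decays_conv[OF a(1) a(1)]
  note c = line.continuous_on_synth[OF a(1)]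
  have re: "synth lborel ?b x = complex_of_real ((Re (synth lborel a x))\<^sup>2)" for x
  proof -
    have "synth lborel a x = complex_of_real (Re (synth lborel a x))"
      using line.synth_real[OF a(2), of x] by (simp add: complex_eq_iff)
    thus ?thesis by (metis line.synth_conv[OF a(1) a(1)] of_real_mult power2_eq_square)
  qed
  have [measurable]: "(\<lambda>x. (Re (synth lborel a x))\<^sup>2) \<in> borel_measurable borel"
    by (intro borel_measurable_continuous_onI continuous_intros c)
  have i: "integrable lborel (\<lambda>x. ?G n x * (Re (synth lborel a x))\<^sup>2)" for n
  proof (rule integrable_dominated)
    show "integrable lborel (\<lambda>x. ?G n x * (R * (LINT x|lborel. weight x))\<^sup>2)"
      using integrable_gaussian[of "inverse (real (Suc n))"] by simp
    show "norm (?G n x * (Re (synth lborel a x))\<^sup>2) \<le> ?G n x * (R * (LINT x|lborel. weight x))\<^sup>2" for x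
    proof -
      have "\<bar>Re (synth lborel a x)\<bar> \<le> R * (LINT x|lborel. weight x)"
        using abs_Re_le_cmod line.norm_synth_le[OF a(1)] order_trans by blast
      hence "\<bar>Re (synth lborel a x)\<bar>\<^sup>2 \<le> (R * (LINT x|lborel. weight x))\<^sup>2"
        by (intro power_mono) auto
      thus ?thesis by (simp add: abs_mult)
    qed
  qed measurable
  have "(\<lambda>n. complex_of_real (LINT x|lborel. ?G n x * (Re (synth lborel a x))\<^sup>2)) \<longlonglongrightarrow> 2 * pi * ?b 0"
  proof -
    have "complex_of_real (LINT x|lborel. ?G n x * (Re (synth lborel a x))\<^sup>2)
      = 2 * pi * (LINT z|lborel. ?b (0 + inverse (real (Suc n)) * z) * complex_of_real (std_normal_density z))" for n
    proof -
      have "complex_of_real (LINT x|lborel. ?G n x * (Re (synth lborel a x))\<^sup>2)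
        = (LINT x|lborel. cis (- (x * 0)) * complex_of_real (?G n x) * synth lborel ?b x)"
        unfolding integral_complex_of_real[symmetric] re by (intro Bochner_Integration.integral_cong) auto
      also have "\<dots> = 2 * pi * (LINT z|lborel. ?b (0 + inverse (real (Suc n)) * z) * complex_of_real (std_normal_density z))"
        by (rule synth_gaussian[OF b]) simp
      finally show ?thesis .
    qed
    thus ?thesis using LINT_gaussian_approx[OF b, of 0] by (auto intro!: tendsto_intros)
  qed
  from tendsto_Re[OF this]
  have lim: "(\<lambda>n. LINT x|lborel. ?G n x * (Re (synth lborel a x))\<^sup>2) \<longlonglongrightarrow> Re (2 * pi * ?b 0)" by simp
  show ?thesis
  proof (rule integrable_monotone_convergence[OF i _ _ lim])
    show "AE x in lborel. mono (\<lambda>n. ?G n x * (Re (synth lborel a x))\<^sup>2)"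
    proof (intro AE_I2 monoI mult_right_mono)
      fix x :: real and k n :: nat assume "k \<le> n"
      hence "(inverse (real (Suc n)))\<^sup>2 \<le> (inverse (real (Suc k)))\<^sup>2"
        by (intro power_mono le_imp_inverse_le) auto
      hence "(inverse (real (Suc n)))\<^sup>2 * x\<^sup>2 \<le> (inverse (real (Suc k)))\<^sup>2 * x\<^sup>2"
        by (rule mult_right_mono) simp
      thus "?G k x \<le> ?G n x" by (simp only: power_mult_distrib) simp
    qed simp
    show "AE x in lborel. (\<lambda>n. ?G n x * (Re (synth lborel a x))\<^sup>2) \<longlonglongrightarrow> (Re (synth lborel a x))\<^sup>2"
      using tendsto_mult[OF gaussian_tendsto tendsto_const] by (intro AE_I2) fastforce
  qed measurable
qed

text \<open>Both sides are limits of the same damped integrals: the left one by dominated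
  convergence, the right one because the averages of \<open>b\<close> concentrate at
  \<open>\<xi>\<close>.\<close>

lemma fourier_inversion_line:
  fixes b :: "real \<Rightarrow> complex"
  assumes b: "decays R b" and i: "integrable lborel (synth lborel b)"
  shows "(LINT x|lborel. cis (- (x * \<xi>)) * synth lborel b x) = 2 * pi * b \<xi>"
proof (rule LIMSEQ_unique)
  let ?G = "\<lambda>n x. exp (- ((inverse (real (Suc n)) * x)\<^sup>2) / 2) :: real"
  have [measurable]: "synth lborel b \<in> borel_measurable borel"
    by (intro borel_measurable_continuous_onI line.continuous_on_synth[OF b])
  show "(\<lambda>n. LINT x|lborel. cis (- (x * \<xi>)) * complex_of_real (?G n x) * synth lborel b x)
      \<longlonglongrightarrow> (LINT x|lborel. cis (- (x * \<xi>)) * synth lborel b x)"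
  proof (rule integral_dominated_convergence)
    show "integrable lborel (\<lambda>x. cmod (synth lborel b x))" using i by (rule integrable_norm)
    show "AE x in lborel. (\<lambda>n. cis (- (x * \<xi>)) * complex_of_real (?G n x) * synth lborel b x)
      \<longlonglongrightarrow> cis (- (x * \<xi>)) * synth lborel b x"
    proof (rule AE_I2)
      fix x
      have "(\<lambda>n. cis (- (x * \<xi>)) * complex_of_real (?G n x) * synth lborel b x)
        \<longlonglongrightarrow> cis (- (x * \<xi>)) * complex_of_real 1 * synth lborel b x"
        by (intro tendsto_mult tendsto_const tendsto_of_real gaussian_tendsto)
      thus "(\<lambda>n. cis (- (x * \<xi>)) * complex_of_real (?G n x) * synth lborel b x)
        \<longlonglongrightarrow> cis (- (x * \<xi>)) * synth lborel b x" by simp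
    qed
    show "AE x in lborel. norm (cis (- (x * \<xi>)) * complex_of_real (?G n x) * synth lborel b x) \<le> cmod (synth lborel b x)" for n
      by (intro AE_I2) (simp add: norm_mult mult_left_le_one_le)
  qed measurable
  have "(LINT x|lborel. cis (- (x * \<xi>)) * complex_of_real (?G n x) * synth lborel b x)
     = 2 * pi * (LINT z|lborel. b (\<xi> + inverse (real (Suc n)) * z) * complex_of_real (std_normal_density z))" for n
    by (rule synth_gaussian[OF b]) simp
  thus "(\<lambda>n. LINT x|lborel. cis (- (x * \<xi>)) * complex_of_real (?G n x) * synth lborel b x) \<longlonglongrightarrow> 2 * pi * b \<xi>"
    using LINT_gaussian_approx[OF b] by (auto intro!: tendsto_intros)
qed

section \<open>Inversion on the circle by orthogonality\<close>

lemma LINT_cis_period: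
  assumes "k \<in> \<int>"
  shows "(LINT x|restrict_space lborel {0..<2*pi}. cis (x * k)) = (if k = 0 then 2 * pi else 0)"
proof -
  have "(LINT x|restrict_space lborel {0..<2*pi}. cis (x * k)) = (LINT x:{0..<2*pi}|lborel. cis (x * k))"
    by (simp add: integral_restrict_space set_lebesgue_integral_def)
  \<comment> \<open>The end point is a null set; the closed interval is the one suited to the
    fundamental theorem of calculus.\<close>
  also have "\<dots> = (LINT x:{0..2*pi}|lborel. cis (x * k))"
    unfolding set_lebesgue_integral_def
  proof (rule integral_cong_AE)
    show "AE x in lborel. indicator {0..<2*pi} x *\<^sub>R cis (x * k) = indicator {0..2*pi} x *\<^sub>R cis (x * k)"
      using AE_lborel_singleton[of "2*pi"] by eventually_elim (auto simp: indicator_def)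
  qed measurable
  also have "\<dots> = (if k = 0 then 2 * pi else 0)"
  proof (cases "k = 0")
    case True
    thus ?thesis by (simp add: set_lebesgue_integral_def scaleR_conv_of_real)
  next
    case False
    let ?F = "\<lambda>x. - \<i> / complex_of_real k * cis (x * k)"
    have "(LINT x:{0..2*pi}|lborel. cis (x * k)) = ?F (2 * pi) - ?F 0"
      unfolding set_lebesgue_integral_def
    proof (rule integral_FTC_Icc)
      show "(?F has_vector_derivative cis (x * k)) (at x within {0..2*pi})" for x
      proof -
        have "((\<lambda>z. - \<i> / complex_of_real k * exp (\<i> * (z * complex_of_real k))) has_field_derivative
            exp (\<i> * (complex_of_real x * complex_of_real k))) (at (complex_of_real x))"
          using False by (auto intro!: derivative_eq_intros)
        from has_vector_derivative_real_field[OF this, of "{0..2*pi}"] show ?thesis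
          by (simp add: cis_conv_exp)
      qed
      show "continuous_on {0..2*pi} (\<lambda>x. cis (x * k))" by (intro continuous_intros)
    qed simp
    moreover have "cis (2 * pi * k) = 1"
      using assms by (auto elim!: Ints_cases simp: cis_multiple_2pi)
    ultimately show ?thesis using False by simp
  qed
  finally show ?thesis .
qed

lemma finite_measure_Circle: "finite_measure (restrict_space lborel {0..<2*pi})"
  by (rule finite_measureI) (simp add: emeasure_restrict_space)

interpretation circle: frequency_measure "count_space \<int>" "3 * (LINT x|count_space \<int>. weight x)"
  by (rule frequency_measure_Circle)

text \<open>Summability of \<open>weight\<close> allows the exchange of sum and integral, after
  which orthogonality leaves only the term at \<open>\<xi>\<close>.\<close>

lemma fourier_inversion_circle:
  fixes b :: "real \<Rightarrow> complex"
  assumes b: "decays R b" and \<xi>: "\<xi> \<in> \<int>"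
  shows "(LINT x|restrict_space lborel {0..<2*pi}. cis (- (x * \<xi>)) * synth (count_space \<int>) b x) = 2 * pi * b \<xi>"
proof -
  let ?S = "restrict_space lborel {0..<2*pi} :: real measure"
  let ?Z = "count_space \<int> :: real measure"
  let ?f = "\<lambda>x \<eta>. cis (- (x * \<xi>)) * (cis (x * \<eta>) * b \<eta>)"
  interpret finite_measure ?S by (rule finite_measure_Circle)
  interpret pair_sigma_finite ?S ?Z
    by (intro pair_sigma_finite.intro sigma_finite_measure_axioms circle.sigma_finite_measure_axioms)
  have int: "integrable (?S \<Otimes>\<^sub>M ?Z) (case_prod ?f)"
  proof (rule integrable_pair_bound)
    have 1: "(\<lambda>p. b (snd p)) \<in> borel_measurable (?S \<Otimes>\<^sub>M ?Z)"
      by (rule measurable_compose[OF circle.snd_measurable_freq decays_measurable[OF b]])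
    have "(\<lambda>x. x) \<in> borel_measurable ?S"
      by (rule measurable_restrict_space1) simp
    from measurable_compose[OF measurable_fst this]
    have f: "fst \<in> borel_measurable (?S \<Otimes>\<^sub>M ?Z)" .
    note s = circle.snd_measurable_freq[of ?S]
    have "(\<lambda>p. cis (- (fst p * \<xi>)) * (cis (fst p * snd p) * b (snd p))) \<in> borel_measurable (?S \<Otimes>\<^sub>M ?Z)"
      by (intro borel_measurable_times 1 measurable_compose[OF _ cis_borel_measurable] borel_measurable_uminus f s
          borel_measurable_const)
    thus "case_prod ?f \<in> borel_measurable (?S \<Otimes>\<^sub>M ?Z)" by (simp add: case_prod_unfold)
    show "integrable ?Z (\<lambda>\<eta>. R * weight \<eta>)" for x
      using integrable_weight_Ints by simp
    show "norm (?f x \<eta>) \<le> R * weight \<eta>" for x \<eta>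
      by (simp add: norm_mult decays_le[OF b])
    show "integrable ?S (\<lambda>x. R * (LINT \<eta>|?Z. weight \<eta>))" by simp
  qed simp
  have "(LINT x|?S. cis (- (x * \<xi>)) * synth ?Z b x) = (LINT x|?S. LINT \<eta>|?Z. ?f x \<eta>)"
    by (simp add: synth_def)
  also have "\<dots> = (LINT \<eta>|?Z. LINT x|?S. ?f x \<eta>)"
    by (rule Fubini_integral[OF int, symmetric])
  also have "\<dots> = (LINT \<eta>|?Z. (2 * pi * b \<xi>) * indicator {\<xi>} \<eta>)"
  proof (rule Bochner_Integration.integral_cong)
    fix \<eta> assume "\<eta> \<in> space ?Z"
    hence "\<eta> - \<xi> \<in> \<int>" using \<xi> by simp
    have "(LINT x|?S. ?f x \<eta>) = (LINT x|?S. cis (x * (\<eta> - \<xi>)) * b \<eta>)"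
    proof (rule Bochner_Integration.integral_cong)
      fix x
      have "cis (x * (\<eta> - \<xi>)) = cis (- (x * \<xi>)) * cis (x * \<eta>)"
        by (simp add: cis_mult algebra_simps)
      thus "?f x \<eta> = cis (x * (\<eta> - \<xi>)) * b \<eta>" by (simp add: mult_ac)
    qed simp
    also have "\<dots> = (if \<eta> - \<xi> = 0 then 2 * pi else 0) * b \<eta>"
      by (subst integral_mult_left_zero, subst LINT_cis_period[OF \<open>\<eta> - \<xi> \<in> \<int>\<close>]) simp
    also have "\<dots> = (2 * pi * b \<xi>) * indicator {\<xi>} \<eta>" by auto
    finally show "(LINT x|?S. ?f x \<eta>) = (2 * pi * b \<xi>) * indicator {\<xi>} \<eta>" .
  qed simp
  also have "\<dots> = 2 * pi * b \<xi> * (LINT \<eta>|?Z. complex_of_real (indicator {\<xi>} \<eta>))"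
    unfolding integral_mult_right_zero[symmetric]
    by (intro Bochner_Integration.integral_cong) (auto simp: indicator_def)
  also have "(LINT \<eta>|?Z. complex_of_real (indicator {\<xi>} \<eta>)) = 1"
    unfolding integral_complex_of_real using \<xi> by (simp add: measure_count_space)
  finally show ?thesis by simp
qed

text \<open>Each of the \<open>Suc k\<close> factors carries \<open>1 / (2 pi)\<close> from
  \<open>inv_fourier\<close>, and inversion gives one factor \<open>2 pi\<close> back, hence the
  exponent \<open>k\<close>.\<close>

lemma fourier_power:
  fixes a :: "real \<Rightarrow> complex"
  assumes a: "decays R a" "hermitian a" and \<xi>: "\<xi> \<in> space (freq_measure M)" and k: "k \<ge> 1"
  shows "fourier M (\<lambda>x. (inv_fourier M a x) ^ Suc k) \<xi>
       = complex_of_real (1 / (2 * pi) ^ k) * conv_power (freq_measure M) a k \<xi>"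
proof -
  let ?m = "freq_measure M" and ?S = "space_measure M"
  obtain C where "frequency_measure ?m C" using frequency_measure_freq_measure by blast
  then interpret frequency_measure ?m C .
  have re: "complex_of_real (inv_fourier M a x) = synth ?m a x / (2 * pi)" for x
    using synth_real[OF a(2), of x] by (simp add: inv_fourier_def synth_def complex_eq_iff)
  have p: "complex_of_real ((inv_fourier M a x) ^ Suc k) = synth ?m (conv_power ?m a k) x / (2 * pi) ^ Suc k" for x
    unfolding of_real_power re synth_conv_power[OF a(1)] by (simp add: power_divide)
  note b = decays_conv_power[OF a(1), of k]
  have inv: "(LINT x|?S. cis (- (x * \<xi>)) * synth ?m (conv_power ?m a k) x) = 2 * pi * conv_power ?m a k \<xi>"
  proof (cases M)
    case Line
    \<comment> \<open>Two of the \<open>Suc k\<close> factors form an integrable square, available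
      because \<open>k \<ge> 1\<close>; the other \<open>k - 1\<close> are bounded.\<close>
    have "integrable lborel (synth lborel (conv_power lborel a k))"
    proof (rule integrable_dominated)
      let ?B = "R * (LINT x|lborel. weight x)"
      show "integrable lborel (\<lambda>x. ?B ^ (k - 1) * (Re (synth lborel a x))\<^sup>2)"
        using square_integrable_synth[OF a] by simp
      show "synth lborel (conv_power lborel a k) \<in> borel_measurable lborel"
        using borel_measurable_continuous_onI[OF line.continuous_on_synth[OF line.decays_conv_power[OF a(1)]]] by simp
      show "norm (synth lborel (conv_power lborel a k) x) \<le> ?B ^ (k - 1) * (Re (synth lborel a x))\<^sup>2" for x
      proof -
        have "norm (synth lborel a x) = \<bar>Re (synth lborel a x)\<bar>"
          using line.synth_real[OF a(2), of x] by (simp add: cmod_def)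
        moreover have "norm (synth lborel (conv_power lborel a k) x) = norm (synth lborel a x) ^ (k - 1) * (norm (synth lborel a x))\<^sup>2"
          unfolding line.synth_conv_power[OF a(1)] norm_power power_add[symmetric] using k by simp
        moreover have "norm (synth lborel a x) ^ (k - 1) \<le> ?B ^ (k - 1)"
          by (intro power_mono line.norm_synth_le[OF a(1)]) simp
        ultimately show ?thesis by (simp add: mult_right_mono)
      qed
    qed
    from fourier_inversion_line[OF line.decays_conv_power[OF a(1)] this] show ?thesis
      by (simp add: Line)
  next
    case Circle
    with \<xi> fourier_inversion_circle[OF circle.decays_conv_power[OF a(1)]] show ?thesis by simp
  qed
  have "fourier M (\<lambda>x. (inv_fourier M a x) ^ Suc k) \<xi>
     = (LINT x|?S. (cis (- (x * \<xi>)) * synth ?m (conv_power ?m a k) x) / (2 * pi) ^ Suc k)"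
    unfolding fourier_def p by simp
  also have "\<dots> = 2 * pi * conv_power ?m a k \<xi> / (2 * pi) ^ Suc k"
    by (subst integral_divide_zero, subst inv) simp
  also have "\<dots> = complex_of_real (1 / (2 * pi) ^ k) * conv_power ?m a k \<xi>"
    by (simp add: field_simps)
  finally show ?thesis .
qed

section \<open>The Duhamel operator\<close>

text \<open>For \<open>q \<ge> 0\<close> this is
  \<open>\<xi>^2 sin (q \<lambda>) / \<lambda>\<close> with \<open>\<lambda>\<close> the dispersion,
  after cancelling \<open>\<bar>\<xi>\<bar>\<close>: visibly bounded by \<open>1\<close>, and
  continuous also at \<open>\<xi> = 0\<close>. The truncation \<open>max q 0\<close> lets an
  integral over a fixed time interval stand for one that ends at the current time.\<close>

definition duhamel_kernel :: "real \<Rightarrow> real \<Rightarrow> real" where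
  "duhamel_kernel q \<xi> = \<bar>\<xi>\<bar> / sqrt (1 + \<xi>\<^sup>2) * sin (max q 0 * dispersion \<xi>)"

lemma dispersion_eq: "dispersion \<xi> = \<bar>\<xi>\<bar> * sqrt (1 + \<xi>\<^sup>2)"
proof -
  have "\<xi>\<^sup>2 + \<xi> ^ 4 = \<xi>\<^sup>2 * (1 + \<xi>\<^sup>2)" by (simp add: algebra_simps power2_eq_square power4_eq_xxxx)
  thus ?thesis by (simp add: dispersion_def real_sqrt_mult)
qed

lemma dispersion_nonneg [simp]: "0 \<le> dispersion \<xi>"
  by (simp add: dispersion_eq add_nonneg_nonneg)

lemma dispersion_minus [simp]: "dispersion (- \<xi>) = dispersion \<xi>"
  by (simp add: dispersion_eq)

lemma dispersion_eq_0_iff: "dispersion \<xi> = 0 \<longleftrightarrow> \<xi> = 0"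
  by (simp add: dispersion_eq add_nonneg_eq_0_iff)

lemma continuous_on_dispersion [continuous_intros]:
  "continuous_on A f \<Longrightarrow> continuous_on A (\<lambda>x. dispersion (f x))"
  unfolding dispersion_def by (intro continuous_intros)

lemma continuous_on_duhamel_kernel [continuous_intros]:
  fixes f g :: "'a::t2_space \<Rightarrow> real"
  shows
  "continuous_on A f \<Longrightarrow> continuous_on A g \<Longrightarrow> continuous_on A (\<lambda>x. duhamel_kernel (f x) (g x))"
  unfolding duhamel_kernel_def by (intro continuous_intros) (auto simp: add_nonneg_eq_0_iff)

lemma abs_duhamel_kernel_le: "\<bar>duhamel_kernel q \<xi>\<bar> \<le> 1"
proof -
  have "\<bar>\<xi>\<bar> \<le> sqrt (1 + \<xi>\<^sup>2)" by (rule real_le_rsqrt) simp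
  moreover have "0 < sqrt (1 + \<xi>\<^sup>2)" by (simp add: add_pos_nonneg)
  ultimately have "\<bar>\<xi>\<bar> / sqrt (1 + \<xi>\<^sup>2) \<le> 1" by simp
  moreover have "0 \<le> \<bar>\<xi>\<bar> / sqrt (1 + \<xi>\<^sup>2)" using \<open>0 < sqrt (1 + \<xi>\<^sup>2)\<close> by simp
  ultimately show ?thesis
    unfolding duhamel_kernel_def abs_mult by (intro mult_le_one) auto
qed

lemma duhamel_kernel_minus [simp]: "duhamel_kernel q (- \<xi>) = duhamel_kernel q \<xi>"
  by (simp add: duhamel_kernel_def)

lemma duhamel_kernel_eq:
  assumes "0 \<le> q"
  shows "duhamel_kernel q \<xi> = \<xi>\<^sup>2 * (if dispersion \<xi> = 0 then q else sin (q * dispersion \<xi>) / dispersion \<xi>)"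
proof (cases "\<xi> = 0")
  case False
  have "0 < sqrt (1 + \<xi>\<^sup>2)" by (simp add: add_pos_nonneg)
  hence "\<bar>\<xi>\<bar> / sqrt (1 + \<xi>\<^sup>2) = \<xi>\<^sup>2 / dispersion \<xi>"
    using False by (simp add: dispersion_eq power2_eq_square divide_simps)
  with False assms show ?thesis by (simp add: duhamel_kernel_def dispersion_eq_0_iff)
qed (simp add: duhamel_kernel_def)

text \<open>Curves are defined for all real times, so that they correspond to bounded continuous
  functions on the plane, a complete space. Being hermitian encodes real-valued solutions.\<close>

definition decaying_curve :: "real \<Rightarrow> (real \<Rightarrow> real \<Rightarrow> complex) \<Rightarrow> bool" where
  "decaying_curve R v \<longleftrightarrow> continuous_on UNIV (case_prod v) \<and> (\<forall>\<tau>. decays R (v \<tau>)) \<and> (\<forall>\<tau>. hermitian (v \<tau>))"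

lemma decaying_curveI:
  assumes "continuous_on UNIV (case_prod v)"
    and "\<And>\<tau> \<xi>. cmod (v \<tau> \<xi>) \<le> R * weight \<xi>" "\<And>\<tau>. hermitian (v \<tau>)"
  shows "decaying_curve R v"
proof -
  have "continuous_on UNIV (v \<tau>)" for \<tau>
    using continuous_on_compose2[OF assms(1) continuous_on_Pair[OF continuous_on_const continuous_on_id], of \<tau> UNIV]
    by simp
  thus ?thesis using assms by (simp add: decaying_curve_def decays_def)
qed

text \<open>The interval \<open>{0..t}\<close> is fixed while \<open>\<tau>\<close> varies; for
  \<open>r > \<tau>\<close> the kernel vanishes. The minus sign of the second derivative cancels the
  one of Duhamel's formula, and \<open>\<kappa>\<close> collects the sign of the nonlinearity and
  the powers of \<open>2 pi\<close>.\<close>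

definition duhamel :: "real measure \<Rightarrow> real \<Rightarrow> real \<Rightarrow> nat \<Rightarrow> (real \<Rightarrow> real \<Rightarrow> complex) \<Rightarrow> real \<Rightarrow> real \<Rightarrow> complex" where
  "duhamel m t \<kappa> k v \<tau> \<xi> = complex_of_real \<kappa> *
     (LINT r|lborel. indicator {0..t} r *\<^sub>R (complex_of_real (duhamel_kernel (\<tau> - r) \<xi>) * conv_power m (v r) k \<xi>))"

lemma integrable_indicator_Icc: "integrable lborel (indicator {a..b :: real} :: real \<Rightarrow> real)"
  by (rule integrable_real_indicator) (simp_all add: emeasure_lborel_Icc_eq)

lemma norm_indicator_scaleR_le:
  "norm z \<le> C \<Longrightarrow> norm (indicator A r *\<^sub>R z) \<le> indicator A r * C"
  by (auto simp: indicator_def)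

context frequency_measure
begin

context
  fixes t \<kappa> R :: real and v :: "real \<Rightarrow> real \<Rightarrow> complex" and k :: nat
  assumes v: "decaying_curve R v" and t: "0 \<le> t"
begin

lemma curve_continuous: "continuous_on UNIV (case_prod v)"
  and curve_decays: "decays R (v \<tau>)"
  and curve_hermitian: "hermitian (v \<tau>)"
  using v by (auto simp: decaying_curve_def)

lemma duhamel_integrand_measurable:
  "(\<lambda>r. indicator {0..t} r *\<^sub>R (complex_of_real (duhamel_kernel (\<tau> - r) \<xi>) * conv_power m (v r) k \<xi>)) \<in> borel_measurable lborel"
proof -
  have "continuous_on UNIV (\<lambda>r. conv_power m (v r) k \<xi>)"
  proof -
    have "continuous_on UNIV (\<lambda>r. (\<lambda>(\<tau>, \<xi>). conv_power m (v \<tau>) k \<xi>) (r, \<xi>))"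
      by (rule continuous_on_compose2[OF conv_power_continuous_param[OF curve_continuous curve_decays]])
         (auto intro!: continuous_intros)
    thus ?thesis by simp
  qed
  hence [measurable]: "(\<lambda>r. conv_power m (v r) k \<xi>) \<in> borel_measurable borel"
    by (rule borel_measurable_continuous_onI)
  have [measurable]: "(\<lambda>r. duhamel_kernel (\<tau> - r) \<xi>) \<in> borel_measurable borel"
    by (intro borel_measurable_continuous_onI continuous_intros)
  show ?thesis by measurable
qed

lemma norm_duhamel_integrand_le:
  "cmod (complex_of_real (duhamel_kernel q \<xi>) * z) \<le> cmod z"
  using mult_right_mono[OF abs_duhamel_kernel_le[of q \<xi>], of "cmod z"] by (simp add: norm_mult)

lemma duhamel_integrable:
  "integrable lborel (\<lambda>r. indicator {0..t} r *\<^sub>R (complex_of_real (duhamel_kernel (\<tau> - r) \<xi>) * conv_power m (v r) k \<xi>))"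
proof (rule integrable_dominated[OF _ duhamel_integrand_measurable])
  let ?Q = "(4 * weight_mass) ^ k * R ^ Suc k"
  show "integrable lborel (\<lambda>r. indicator {0..t} r * ?Q)" using integrable_indicator_Icc by simp
  show "norm (indicator {0..t} r *\<^sub>R (complex_of_real (duhamel_kernel (\<tau> - r) \<xi>) * conv_power m (v r) k \<xi>))
      \<le> indicator {0..t} r * ?Q" for r :: real
    by (intro norm_indicator_scaleR_le order_trans[OF norm_duhamel_integrand_le]
        decays_le_const[OF decays_conv_power[OF curve_decays]])
qed

lemma norm_duhamel_le:
  "cmod (duhamel m t \<kappa> k v \<tau> \<xi>) \<le> \<bar>\<kappa>\<bar> * t * (4 * weight_mass) ^ k * R ^ Suc k * weight \<xi>"
proof -
  let ?Q = "(4 * weight_mass) ^ k * R ^ Suc k * weight \<xi>"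
  have "cmod (LINT r|lborel. indicator {0..t} r *\<^sub>R (complex_of_real (duhamel_kernel (\<tau> - r) \<xi>) * conv_power m (v r) k \<xi>))
     \<le> (LINT r|lborel. indicator {0..t} r * ?Q)"
    by (rule Bochner_Integration.integral_norm_bound_integral[OF duhamel_integrable])
       (simp add: integrable_indicator_Icc, intro norm_indicator_scaleR_le order_trans[OF norm_duhamel_integrand_le]
        decays_le[OF decays_conv_power[OF curve_decays]])
  also have "\<dots> = t * ?Q" using t by simp
  finally have "\<bar>\<kappa>\<bar> * cmod (LINT r|lborel. indicator {0..t} r *\<^sub>R (complex_of_real (duhamel_kernel (\<tau> - r) \<xi>) * conv_power m (v r) k \<xi>))
     \<le> \<bar>\<kappa>\<bar> * (t * ?Q)" by (rule mult_left_mono) simp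
  thus ?thesis by (simp add: duhamel_def norm_mult mult.assoc)
qed

lemma duhamel_continuous: "continuous_on UNIV (\<lambda>(\<tau>, \<xi>). duhamel m t \<kappa> k v \<tau> \<xi>)"
proof -
  let ?Q = "(4 * weight_mass) ^ k * R ^ Suc k"
  have "continuous_on UNIV (\<lambda>p. LINT r|lborel. indicator {0..t} r *\<^sub>R
      (complex_of_real (duhamel_kernel (fst p - r) (snd p)) * conv_power m (v r) k (snd p)))"
  proof (rule continuous_on_LINT[OF _ duhamel_integrand_measurable])
    show "integrable lborel (\<lambda>r. indicator {0..t} r * ?Q)" using integrable_indicator_Icc by simp
    show "norm (indicator {0..t} r *\<^sub>R (complex_of_real (duhamel_kernel (fst p - r) (snd p)) * conv_power m (v r) k (snd p)))
        \<le> indicator {0..t} r * ?Q" for r and p :: "real \<times> real"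
      by (intro norm_indicator_scaleR_le order_trans[OF norm_duhamel_integrand_le]
          decays_le_const[OF decays_conv_power[OF curve_decays]])
    show "continuous_on UNIV (\<lambda>p :: real \<times> real. indicator {0..t} r *\<^sub>R
      (complex_of_real (duhamel_kernel (fst p - r) (snd p)) * conv_power m (v r) k (snd p)))" for r
      by (intro continuous_intros continuous_on_compose2[OF decays_continuous[OF decays_conv_power[OF curve_decays]]])
         auto
  qed
  thus ?thesis unfolding duhamel_def case_prod_unfold by (intro continuous_intros)
qed

lemma hermitian_duhamel: "hermitian (duhamel m t \<kappa> k v \<tau>)"
proof -
  have "conv_power m (v r) k (- \<xi>) = cnj (conv_power m (v r) k \<xi>)" for r \<xi>
    using hermitian_conv_power[OF curve_hermitian] by (simp add: hermitian_def)
  hence "(LINT r|lborel. indicator {0..t} r *\<^sub>R (complex_of_real (duhamel_kernel (\<tau> - r) (- \<xi>)) * conv_power m (v r) k (- \<xi>)))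
    = (LINT r|lborel. cnj (indicator {0..t} r *\<^sub>R (complex_of_real (duhamel_kernel (\<tau> - r) \<xi>) * conv_power m (v r) k \<xi>)))" for \<xi>
    by simp
  thus ?thesis unfolding hermitian_def duhamel_def Bochner_Integration.integral_cnj by simp
qed

end

section \<open>Small solutions by contraction\<close>

lemma duhamel_lipschitz:
  assumes v: "decaying_curve R v" and w: "decaying_curve R w" and t: "0 \<le> t"
    and d: "\<And>\<tau> \<xi>. cmod (v \<tau> \<xi> - w \<tau> \<xi>) \<le> \<delta> * weight \<xi>"
  shows "cmod (duhamel m t \<kappa> k v \<tau> \<xi> - duhamel m t \<kappa> k w \<tau> \<xi>)
     \<le> \<bar>\<kappa>\<bar> * t * real (Suc k) * (4 * weight_mass) ^ k * R ^ k * \<delta> * weight \<xi>"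
proof -
  let ?Q = "real (Suc k) * (4 * weight_mass) ^ k * R ^ k * \<delta> * weight \<xi>"
  let ?I = "\<lambda>v r. indicator {0..t} r *\<^sub>R (complex_of_real (duhamel_kernel (\<tau> - r) \<xi>) * conv_power m (v r) k \<xi>)"
  note i = duhamel_integrable[OF v t] duhamel_integrable[OF w t]
  have "cmod (LINT r|lborel. ?I v r - ?I w r) \<le> (LINT r|lborel. indicator {0..t} r * ?Q)"
  proof (rule Bochner_Integration.integral_norm_bound_integral)
    fix r :: real
    have "cmod (complex_of_real (duhamel_kernel (\<tau> - r) \<xi>) * (conv_power m (v r) k \<xi> - conv_power m (w r) k \<xi>)) \<le> ?Q"
      by (intro order_trans[OF norm_duhamel_integrand_le[OF v t]] conv_power_lipschitz curve_decays[OF v t] curve_decays[OF w t] d)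
    from norm_indicator_scaleR_le[OF this, of "{0..t}" r]
    show "cmod (?I v r - ?I w r) \<le> indicator {0..t} r * ?Q"
      by (simp add: algebra_simps)
  qed (use i integrable_indicator_Icc in simp_all)
  also have "\<dots> = t * ?Q" using t by simp
  finally have "\<bar>\<kappa>\<bar> * cmod (LINT r|lborel. ?I v r - ?I w r) \<le> \<bar>\<kappa>\<bar> * (t * ?Q)"
    by (rule mult_left_mono) simp
  moreover have "duhamel m t \<kappa> k v \<tau> \<xi> - duhamel m t \<kappa> k w \<tau> \<xi> = complex_of_real \<kappa> * (LINT r|lborel. ?I v r - ?I w r)"
    unfolding duhamel_def using i by (simp add: right_diff_distrib)
  ultimately show ?thesis by (simp add: norm_mult mult.assoc)
qed

text \<open>Banach's fixed point theorem for the quotients of curves by \<open>weight\<close>, in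
  the supremum norm. The ball of radius \<open>2 \<rho>\<close> is mapped to itself since the
  Duhamel term contributes at most \<open>\<rho>\<close>.\<close>

lemma duhamel_fixed_point:
  assumes L: "decaying_curve \<rho> L" and t: "0 \<le> t"
    and small: "\<bar>\<kappa>\<bar> * t * real (Suc k) * (4 * weight_mass) ^ k * (2 * \<rho>) ^ k \<le> 1 / 2"
  obtains v where "decaying_curve (2 * \<rho>) v" "\<And>\<tau> \<xi>. v \<tau> \<xi> = L \<tau> \<xi> + duhamel m t \<kappa> k v \<tau> \<xi>"
proof -
  have \<rho>: "0 \<le> \<rho>" using decays_nonneg[OF curve_decays[OF L t]] .
  define S where "S = {g :: (real \<times> real) \<Rightarrow>\<^sub>C complex. \<forall>\<tau> \<xi>. cmod (g (\<tau>, \<xi>)) \<le> 2 * \<rho> \<and> g (\<tau>, - \<xi>) = cnj (g (\<tau>, \<xi>))}"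
  define V where "V g \<tau> \<xi> = complex_of_real (weight \<xi>) * apply_bcontfun g (\<tau>, \<xi>)" for g :: "(real \<times> real) \<Rightarrow>\<^sub>C complex" and \<tau> \<xi>
  define Q where "Q g \<tau> \<xi> = (L \<tau> \<xi> + duhamel m t \<kappa> k (V g) \<tau> \<xi>)" for g \<tau> \<xi>
  define \<Phi> where "\<Phi> g = Bcontfun (\<lambda>(\<tau>, \<xi>). Q g \<tau> \<xi> / complex_of_real (weight \<xi>))" for g
  have V: "decaying_curve (2 * \<rho>) (V g)" if "g \<in> S" for g
  proof (rule decaying_curveI)
    show "continuous_on UNIV (case_prod (V g))"
      unfolding V_def case_prod_unfold by (intro continuous_intros) auto
    show "cmod (V g \<tau> \<xi>) \<le> 2 * \<rho> * weight \<xi>" for \<tau> \<xi>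
      using mult_right_mono[of "cmod (g (\<tau>, \<xi>))" "2 * \<rho>" "weight \<xi>"] that
      by (simp add: V_def norm_mult S_def mult.commute)
    show "hermitian (V g \<tau>)" for \<tau>
      using that by (simp add: V_def S_def hermitian_def)
  qed
  have dist_V: "cmod (V g \<tau> \<xi> - V h \<tau> \<xi>) \<le> dist g h * weight \<xi>" for g h \<tau> \<xi>
  proof -
    have "cmod (V g \<tau> \<xi> - V h \<tau> \<xi>) = weight \<xi> * dist (g (\<tau>, \<xi>)) (h (\<tau>, \<xi>))"
      by (simp add: V_def dist_norm norm_mult right_diff_distrib[symmetric])
    thus ?thesis using mult_left_mono[OF dist_bounded[of g "(\<tau>, \<xi>)" h], of "weight \<xi>"] by (simp add: mult.commute)
  qed
  have Q: "decaying_curve (2 * \<rho>) (Q g)" if "g \<in> S" for g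
  proof (rule decaying_curveI)
    show "continuous_on UNIV (case_prod (Q g))"
      using continuous_on_add[OF curve_continuous[OF L t] duhamel_continuous[OF V[OF that] t]]
      by (simp add: Q_def case_prod_unfold)
    show "cmod (Q g \<tau> \<xi>) \<le> 2 * \<rho> * weight \<xi>" for \<tau> \<xi>
    proof -
      \<comment> \<open>The smallness condition is written for the Lipschitz bound; as
        \<open>Suc k \<ge> 1\<close>, it also covers the size of the Duhamel term.\<close>
      let ?X = "\<bar>\<kappa>\<bar> * t * (4 * weight_mass) ^ k * (2 * \<rho>) ^ k"
      have X0: "0 \<le> ?X" using \<rho> t weight_mass_nonneg by simp
      hence "?X * 1 \<le> ?X * real (Suc k)" by (intro mult_left_mono) auto
      also have "\<dots> \<le> 1 / 2" using small by (simp only: ac_simps)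
      finally have X: "?X \<le> 1 / 2" by simp
      have "cmod (duhamel m t \<kappa> k (V g) \<tau> \<xi>) \<le> ?X * (2 * \<rho> * weight \<xi>)"
        using norm_duhamel_le[OF V[OF that] t, of \<kappa> k \<tau> \<xi>] by (simp add: mult_ac)
      also have "\<dots> \<le> 1 / 2 * (2 * \<rho> * weight \<xi>)"
        using \<rho> by (intro mult_right_mono X) simp
      finally have "cmod (duhamel m t \<kappa> k (V g) \<tau> \<xi>) \<le> \<rho> * weight \<xi>" by simp
      from norm_triangle_mono[OF decays_le[OF curve_decays[OF L t]] this, of \<tau> \<xi>]
      show ?thesis by (simp add: Q_def)
    qed
    show "hermitian (Q g \<tau>)" for \<tau>
      using curve_hermitian[OF L t] hermitian_duhamel[OF V[OF that] t]
      by (simp add: hermitian_def Q_def)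
  qed
  have \<Phi>: "\<Phi> g (\<tau>, \<xi>) = Q g \<tau> \<xi> / complex_of_real (weight \<xi>)" if "g \<in> S" for g \<tau> \<xi>
  proof -
    have "(\<lambda>(\<tau>, \<xi>). Q g \<tau> \<xi> / complex_of_real (weight \<xi>)) \<in> bcontfun"
    proof (rule bcontfun_normI)
      show "continuous_on UNIV (\<lambda>(\<tau>, \<xi>). Q g \<tau> \<xi> / complex_of_real (weight \<xi>))"
        using curve_continuous[OF Q[OF that] t] unfolding case_prod_unfold
        by (intro continuous_intros) auto
      show "norm (case x of (\<tau>, \<xi>) \<Rightarrow> Q g \<tau> \<xi> / complex_of_real (weight \<xi>)) \<le> 2 * \<rho>" for x
        using decays_le[OF curve_decays[OF Q[OF that] t], of "fst x" "snd x"]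
        by (simp add: case_prod_unfold norm_divide pos_divide_le_eq)
    qed
    thus ?thesis by (simp add: \<Phi>_def Bcontfun_inverse)
  qed
  have "closed S"
  proof (unfold closed_sequential_limits, intro allI impI, elim conjE)
    fix G g assume G: "\<forall>n. G n \<in> S" and lim: "G \<longlonglongrightarrow> g"
    have ev: "(\<lambda>n. G n x) \<longlonglongrightarrow> g x" for x
      using tendsto_uniform_limitI[OF tendsto_bcontfun_uniform_limit[OF lim]] by simp
    have "cmod (g (\<tau>, \<xi>)) \<le> 2 * \<rho>" for \<tau> \<xi>
      using G by (intro LIMSEQ_le_const2[OF tendsto_norm[OF ev]]) (auto simp: S_def)
    moreover have "g (\<tau>, - \<xi>) = cnj (g (\<tau>, \<xi>))" for \<tau> \<xi>
    proof (rule LIMSEQ_unique[OF ev])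
      show "(\<lambda>n. G n (\<tau>, - \<xi>)) \<longlonglongrightarrow> cnj (g (\<tau>, \<xi>))"
        using tendsto_cnj[OF ev[of "(\<tau>, \<xi>)"]] G by (simp add: S_def)
    qed
    ultimately show "g \<in> S" by (simp add: S_def)
  qed
  have "\<exists>!g\<in>S. \<Phi> g = g"
  proof (rule Banach_fix[OF complete_eq_closed[THEN iffD2, OF \<open>closed S\<close>]])
    have "0 \<in> S" using \<rho> by (simp add: S_def)
    thus "S \<noteq> {}" by blast
    show "\<Phi> ` S \<subseteq> S"
    proof (intro image_subsetI)
      fix g assume g: "g \<in> S"
      show "\<Phi> g \<in> S"
        using decays_le[OF curve_decays[OF Q[OF g] t]] curve_hermitian[OF Q[OF g] t]
        by (subst S_def) (auto simp: \<Phi>[OF g] norm_divide pos_divide_le_eq hermitian_def)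
    qed
    show "dist (\<Phi> g) (\<Phi> h) \<le> 1 / 2 * dist g h" if "g \<in> S" "h \<in> S" for g h
    proof (rule dist_bound)
      fix x :: "real \<times> real"
      obtain \<tau> \<xi> where x: "x = (\<tau>, \<xi>)" by (cases x)
      have "cmod (Q g \<tau> \<xi> - Q h \<tau> \<xi>) \<le> \<bar>\<kappa>\<bar> * t * real (Suc k) * (4 * weight_mass) ^ k * (2 * \<rho>) ^ k * dist g h * weight \<xi>"
        using duhamel_lipschitz[OF V[OF that(1)] V[OF that(2)] t dist_V] by (simp add: Q_def)
      also have "\<dots> \<le> 1 / 2 * dist g h * weight \<xi>"
        by (intro mult_right_mono small) auto
      finally show "dist (\<Phi> g x) (\<Phi> h x) \<le> 1 / 2 * dist g h"
        by (simp add: x \<Phi> that dist_norm diff_divide_distrib[symmetric] norm_divide pos_divide_le_eq)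
    qed
  qed auto
  then obtain g where g: "g \<in> S" "\<Phi> g = g" by blast
  have "V g \<tau> \<xi> = Q g \<tau> \<xi>" for \<tau> \<xi>
    using \<Phi>[OF g(1), of \<tau> \<xi>] g(2) by (simp add: V_def field_simps)
  with V[OF g(1)] show ?thesis by (intro that[of "V g"]) (auto simp: Q_def)
qed

end

section \<open>Travelling waves and their time frequencies\<close>

text \<open>The dispersion with the sign of the frequency: oddness is what makes
  \<open>wave a\<close> hermitian for even \<open>a\<close>, hence a real travelling packet.\<close>

definition phase :: "real \<Rightarrow> real" where
  "phase x = x * sqrt (1 + x\<^sup>2)"

lemma phase_minus [simp]: "phase (- x) = - phase x"
  by (simp add: phase_def)

lemma continuous_on_phase [continuous_intros]:
  "continuous_on A f \<Longrightarrow> continuous_on A (\<lambda>x. phase (f x))"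
  unfolding phase_def by (intro continuous_intros)

lemma phase_eq: "phase x = sgn x * dispersion x"
  by (simp add: phase_def dispersion_eq sgn_if)

text \<open>\<open>(x^2 + 1/2)^2 = x^2 (1 + x^2) + 1/4\<close>. Up to bounded errors, integer
  combinations of phases can thus be read off from squares.\<close>

lemma phase_bounds:
  assumes "0 \<le> x"
  shows "x\<^sup>2 \<le> phase x" "phase x \<le> x\<^sup>2 + 1 / 2"
proof -
  have "x * x \<le> x * sqrt (1 + x\<^sup>2)"
    using assms by (intro mult_left_mono real_le_rsqrt) auto
  thus "x\<^sup>2 \<le> phase x" by (simp add: phase_def power2_eq_square)
  have "phase x = sqrt (x\<^sup>2 * (1 + x\<^sup>2))"
    using assms by (simp add: phase_def real_sqrt_mult)
  also have "\<dots> \<le> x\<^sup>2 + 1 / 2"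
    by (rule real_le_lsqrt) (auto simp: power2_eq_square algebra_simps)
  finally show "phase x \<le> x\<^sup>2 + 1 / 2" .
qed

lemma sqrt_1_plus_square_diff_le: "\<bar>sqrt (1 + x\<^sup>2) - sqrt (1 + y\<^sup>2)\<bar> \<le> \<bar>x - y\<bar>"
proof -
  have le: "sqrt (1 + a\<^sup>2) - sqrt (1 + b\<^sup>2) \<le> \<bar>a - b\<bar>" for a b :: real
    using real_sqrt_sum_squares_triangle_ineq[of 1 0 b "a - b"] by simp
  from le[of x y] le[of y x] show ?thesis by linarith
qed

lemma sqrt_1_plus_square_le: "sqrt (1 + x\<^sup>2) \<le> 1 + \<bar>x\<bar>"
  by (rule real_le_lsqrt) (auto simp: power2_eq_square algebra_simps)

text \<open>The constant grows linearly with the frequency, so the phases within one packet spread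
  over a range of order \<open>\<delta> K\<close>. For odd \<open>k\<close> this is comparable to
  the phase difference that has to keep its sign, which is why \<open>\<delta>\<close> must be small
  depending on \<open>k\<close>.\<close>

lemma phase_lipschitz:
  assumes "\<bar>x\<bar> \<le> B" "\<bar>y\<bar> \<le> B"
  shows "\<bar>phase x - phase y\<bar> \<le> \<bar>x - y\<bar> * (1 + 2 * B)"
proof -
  have "phase x - phase y = (x - y) * sqrt (1 + x\<^sup>2) + y * (sqrt (1 + x\<^sup>2) - sqrt (1 + y\<^sup>2))"
    by (simp add: phase_def algebra_simps)
  also have "\<bar>\<dots>\<bar> \<le> \<bar>x - y\<bar> * (1 + B) + B * \<bar>x - y\<bar>"
  proof (rule order_trans[OF abs_triangle_ineq add_mono])
    show "\<bar>(x - y) * sqrt (1 + x\<^sup>2)\<bar> \<le> \<bar>x - y\<bar> * (1 + B)"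
      unfolding abs_mult using sqrt_1_plus_square_le[of x] assms(1)
      by (intro mult_left_mono) (auto simp: abs_of_nonneg)
    show "\<bar>y * (sqrt (1 + x\<^sup>2) - sqrt (1 + y\<^sup>2))\<bar> \<le> B * \<bar>x - y\<bar>"
      unfolding abs_mult using assms by (intro mult_mono sqrt_1_plus_square_diff_le) auto
  qed
  finally show ?thesis by (simp add: algebra_simps)
qed

definition wave :: "(real \<Rightarrow> real) \<Rightarrow> real \<Rightarrow> real \<Rightarrow> complex" where
  "wave a \<tau> \<xi> = complex_of_real (a \<xi>) * cis (- (\<tau> * phase \<xi>))"

text \<open>The time frequencies of \<open>e\<^sup>i\<^sup>x\<^sup>\<xi>\<close> in the \<open>Suc k\<close>-th power of the travelling wave packet \<open>wave a\<close>.\<close>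

primrec phase_sums :: "(real \<Rightarrow> real) \<Rightarrow> nat \<Rightarrow> real \<Rightarrow> real set" where
  "phase_sums a 0 \<xi> = (if a \<xi> \<noteq> 0 then {phase \<xi>} else {})"
| "phase_sums a (Suc k) \<xi> = {phase \<eta> + w | \<eta> w. a \<eta> \<noteq> 0 \<and> w \<in> phase_sums a k (\<xi> - \<eta>)}"

lemma decaying_curve_wave:
  assumes "decays R (\<lambda>\<xi>. complex_of_real (a \<xi>))" "\<And>\<xi>. a (- \<xi>) = a \<xi>"
  shows "decaying_curve R (wave a)"
proof (rule decaying_curveI)
  have "continuous_on UNIV (\<lambda>x. complex_of_real (a (snd x)))"
    by (rule continuous_on_compose2[OF decays_continuous[OF assms(1)]]) (auto intro!: continuous_intros)
  thus "continuous_on UNIV (case_prod (wave a))"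
    unfolding wave_def case_prod_unfold by (rule continuous_on_mult) (intro continuous_intros)
  show "cmod (wave a \<tau> \<xi>) \<le> R * weight \<xi>" for \<tau> \<xi>
    using decays_le[OF assms(1), of \<xi>] by (simp add: wave_def norm_mult)
  show "hermitian (wave a \<tau>)" for \<tau>
    using assms(2) by (simp add: hermitian_def wave_def cis_cnj)
qed

section \<open>Time oscillation of convolution powers of a wave\<close>

context frequency_measure
begin

lemma continuous_borel_measurable_pair:
  fixes c :: "real \<times> real \<Rightarrow> complex"
  assumes "continuous_on UNIV c"
  shows "c \<in> borel_measurable (lborel \<Otimes>\<^sub>M m)"
proof -
  have 1: "c \<in> borel_measurable (borel \<Otimes>\<^sub>M borel)"
    using borel_measurable_continuous_onI[OF assms] by (simp add: borel_prod)
  have 2: "(\<lambda>p. (fst p, snd p)) \<in> (lborel \<Otimes>\<^sub>M m) \<rightarrow>\<^sub>M (borel \<Otimes>\<^sub>M borel)"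
    by (intro measurable_Pair snd_measurable_freq) simp
  from measurable_compose[OF 2 1] show ?thesis by simp
qed

lemma conv_power_real:
  fixes a :: "real \<Rightarrow> real"
  assumes "decays R (\<lambda>\<xi>. complex_of_real (a \<xi>))"
  shows "Re (conv_power m (\<lambda>\<xi>. complex_of_real (a \<xi>)) (Suc k) \<xi>)
     = (LINT \<eta>|m. a \<eta> * Re (conv_power m (\<lambda>\<xi>. complex_of_real (a \<xi>)) k (\<xi> - \<eta>)))"
  using integral_Re[OF conv_integrable[OF assms decays_conv_power[OF assms, of k], of \<xi>]]
  by (simp add: conv_def)

text \<open>A convolution power of a wave superposes, with non-negative weights, oscillations whose
  time frequencies lie in \<open>phase_sums\<close>. A bound on the imaginary part shared by all of
  them survives the superposition, with the total weight as factor. For the induction the phase of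
  one factor is absorbed into the offset \<open>w0\<close>, which is therefore arbitrary.\<close>

lemma wave_resonance:
  fixes a h :: "real \<Rightarrow> real"
  assumes a: "decays R (\<lambda>\<xi>. complex_of_real (a \<xi>))" "\<And>\<xi>. a (- \<xi>) = a \<xi>" "\<And>\<xi>. 0 \<le> a \<xi>"
    and h: "h \<in> borel_measurable borel" "\<And>r. \<bar>h r\<bar> \<le> indicator {0..t} r" and t: "0 \<le> t"
    and "\<And>w. w \<in> phase_sums a k \<xi> \<Longrightarrow> Im (LINT r|lborel. complex_of_real (h r) * cis (- ((w0 + w) * r))) \<le> - c"
  shows "Im (LINT r|lborel. complex_of_real (h r) * cis (- (w0 * r)) * conv_power m (wave a r) k \<xi>)
    \<le> - c * Re (conv_power m (\<lambda>\<xi>. complex_of_real (a \<xi>)) k \<xi>)"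
  using assms(7)
proof (induction k arbitrary: \<xi> w0)
  case 0
  have "(LINT r|lborel. complex_of_real (h r) * cis (- (w0 * r)) * wave a r \<xi>)
    = (LINT r|lborel. complex_of_real (a \<xi>) * (complex_of_real (h r) * cis (- ((w0 + phase \<xi>) * r))))"
  proof (rule Bochner_Integration.integral_cong)
    fix r
    have "cis (- ((w0 + phase \<xi>) * r)) = cis (- (w0 * r)) * cis (- (r * phase \<xi>))"
      by (simp add: cis_mult algebra_simps)
    thus "complex_of_real (h r) * cis (- (w0 * r)) * wave a r \<xi> =
        complex_of_real (a \<xi>) * (complex_of_real (h r) * cis (- ((w0 + phase \<xi>) * r)))"
      by (simp add: wave_def)
  qed simp
  also have "\<dots> = complex_of_real (a \<xi>) * (LINT r|lborel. complex_of_real (h r) * cis (- ((w0 + phase \<xi>) * r)))"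
    by (rule integral_mult_right_zero)
  finally have *: "Im (LINT r|lborel. complex_of_real (h r) * cis (- (w0 * r)) * wave a r \<xi>)
     = a \<xi> * Im (LINT r|lborel. complex_of_real (h r) * cis (- ((w0 + phase \<xi>) * r)))" by simp
  show ?case
  proof (cases "a \<xi> = 0")
    case False
    hence "Im (LINT r|lborel. complex_of_real (h r) * cis (- ((w0 + phase \<xi>) * r))) \<le> - c"
      by (intro 0) simp
    from mult_left_mono[OF this a(3)[of \<xi>]] show ?thesis unfolding conv_power.simps * by (simp add: mult.commute)
  qed (simp add: *)
next
  case (Suc k)
  let ?A = "\<lambda>\<xi>. complex_of_real (a \<xi>)"
  let ?C = "conv_power m ?A k"
  let ?f = "\<lambda>r \<eta>. complex_of_real (h r) * cis (- (w0 * r)) * (wave a r \<eta> * conv_power m (wave a r) k (\<xi> - \<eta>))"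
  let ?F = "\<lambda>w \<zeta>. (LINT r|lborel. complex_of_real (h r) * cis (- (w * r)) * conv_power m (wave a r) k \<zeta>)"
  let ?Q = "(4 * weight_mass) ^ k * R ^ Suc k"
  note wv = decaying_curve_wave[OF a(1,2)]
  note wc = curve_continuous[OF wv t] and wd = curve_decays[OF wv t]
  interpret P: pair_sigma_finite lborel m
    by (intro pair_sigma_finite.intro sigma_finite_measure_axioms lborel.sigma_finite_measure_axioms)
  have int: "integrable (lborel \<Otimes>\<^sub>M m) (case_prod ?f)"
  proof (rule P.integrable_pair_bound)
    have 1: "(\<lambda>p. complex_of_real (h (fst p))) \<in> borel_measurable (lborel \<Otimes>\<^sub>M m)"
      using h(1) by (intro measurable_compose[OF _ borel_measurable_of_real] measurable_compose[OF measurable_fst]) simp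
    have 2: "(\<lambda>p. cis (- (w0 * fst p)) * (wave a (fst p) (snd p) * conv_power m (wave a (fst p)) k (\<xi> - snd p)))
         \<in> borel_measurable (lborel \<Otimes>\<^sub>M m)"
    proof (rule continuous_borel_measurable_pair)
      have "continuous_on UNIV (\<lambda>p. (\<lambda>(\<tau>, \<xi>). conv_power m (wave a \<tau>) k \<xi>) (fst p, \<xi> - snd p))"
        by (rule continuous_on_compose2[OF conv_power_continuous_param[OF wc wd]]) (auto intro!: continuous_intros)
      thus "continuous_on UNIV (\<lambda>p. cis (- (w0 * fst p)) * (wave a (fst p) (snd p) * conv_power m (wave a (fst p)) k (\<xi> - snd p)))"
        using wc by (intro continuous_intros) (auto simp: case_prod_unfold)
    qed
    from borel_measurable_times[OF 1 2] show "case_prod ?f \<in> borel_measurable (lborel \<Otimes>\<^sub>M m)"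
      by (simp add: case_prod_unfold mult.assoc)
    show "integrable m (\<lambda>\<eta>. indicator {0..t} r * (R * weight \<eta> * ?Q))" for r :: real
      by (intro integrable_mult_right integrable_mult_left integrable_weight)
    show "integrable lborel (\<lambda>r. indicator {0..t} r * (R * (LINT \<eta>|m. weight \<eta>) * ?Q))"
      by (intro integrable_mult_left integrable_indicator_Icc)
    show "norm (?f r \<eta>) \<le> indicator {0..t} r * (R * weight \<eta> * ?Q)" for r \<eta>
      unfolding norm_mult norm_cis norm_of_real mult_1_right
      using decays_nonneg[OF a(1)]
      by (intro mult_mono h(2) decays_le[OF wd] decays_le_const[OF decays_conv_power[OF wd]]) auto
  qed simp
  have "(LINT r|lborel. complex_of_real (h r) * cis (- (w0 * r)) * conv_power m (wave a r) (Suc k) \<xi>)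
     = (LINT r|lborel. LINT \<eta>|m. ?f r \<eta>)"
    by (simp add: conv_def)
  also have "\<dots> = (LINT \<eta>|m. LINT r|lborel. ?f r \<eta>)"
    by (rule P.Fubini_integral[OF int, symmetric])
  \<comment> \<open>The factor split off depends on time only through its phase, which joins the
    offset.\<close>
  also have sw: "(\<lambda>\<eta>. LINT r|lborel. ?f r \<eta>) = (\<lambda>\<eta>. ?A \<eta> * ?F (w0 + phase \<eta>) (\<xi> - \<eta>))"
  proof
    fix \<eta>
    have "(LINT r|lborel. ?f r \<eta>) = (LINT r|lborel. ?A \<eta> * (complex_of_real (h r) * cis (- ((w0 + phase \<eta>) * r)) * conv_power m (wave a r) k (\<xi> - \<eta>)))"
    proof (rule Bochner_Integration.integral_cong)
      fix r
      have "cis (- ((w0 + phase \<eta>) * r)) = cis (- (w0 * r)) * cis (- (r * phase \<eta>))"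
        by (simp add: cis_mult algebra_simps)
      thus "?f r \<eta> = ?A \<eta> * (complex_of_real (h r) * cis (- ((w0 + phase \<eta>) * r)) * conv_power m (wave a r) k (\<xi> - \<eta>))"
        by (simp add: wave_def)
    qed simp
    also have "\<dots> = ?A \<eta> * ?F (w0 + phase \<eta>) (\<xi> - \<eta>)" by (rule integral_mult_right_zero)
    finally show "(LINT r|lborel. ?f r \<eta>) = ?A \<eta> * ?F (w0 + phase \<eta>) (\<xi> - \<eta>)" .
  qed
  finally have eq: "(LINT r|lborel. complex_of_real (h r) * cis (- (w0 * r)) * conv_power m (wave a r) (Suc k) \<xi>)
     = (LINT \<eta>|m. ?A \<eta> * ?F (w0 + phase \<eta>) (\<xi> - \<eta>))" .
  have i1: "integrable m (\<lambda>\<eta>. ?A \<eta> * ?F (w0 + phase \<eta>) (\<xi> - \<eta>))"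
    using P.integrable_snd[OF int] unfolding sw by simp
  have i2: "integrable m (\<lambda>\<eta>. ?A \<eta> * ?C (\<xi> - \<eta>))"
    by (rule conv_integrable[OF a(1) decays_conv_power[OF a(1)]])
  have "Im (LINT \<eta>|m. ?A \<eta> * ?F (w0 + phase \<eta>) (\<xi> - \<eta>)) = (LINT \<eta>|m. Im (?A \<eta> * ?F (w0 + phase \<eta>) (\<xi> - \<eta>)))"
    by (rule integral_Im[OF i1, symmetric])
  also have "\<dots> \<le> (LINT \<eta>|m. - c * Re (?A \<eta> * ?C (\<xi> - \<eta>)))"
  proof (rule integral_mono)
    show "integrable m (\<lambda>\<eta>. Im (?A \<eta> * ?F (w0 + phase \<eta>) (\<xi> - \<eta>)))" by (rule integrable_Im[OF i1])
    show "integrable m (\<lambda>\<eta>. - c * Re (?A \<eta> * ?C (\<xi> - \<eta>)))" by (intro integrable_mult_right integrable_Re[OF i2])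
    fix \<eta>
    show "Im (?A \<eta> * ?F (w0 + phase \<eta>) (\<xi> - \<eta>)) \<le> - c * Re (?A \<eta> * ?C (\<xi> - \<eta>))"
    proof (cases "a \<eta> = 0")
      case False
      have "Im (?F (w0 + phase \<eta>) (\<xi> - \<eta>)) \<le> - c * Re (?C (\<xi> - \<eta>))"
      proof (rule Suc.IH)
        fix w assume "w \<in> phase_sums a k (\<xi> - \<eta>)"
        with False have "phase \<eta> + w \<in> phase_sums a (Suc k) \<xi>" by auto
        from Suc.prems[OF this]
        show "Im (LINT r|lborel. complex_of_real (h r) * cis (- ((w0 + phase \<eta> + w) * r))) \<le> - c"
          by (simp add: add.assoc)
      qed
      from mult_left_mono[OF this a(3)[of \<eta>]] show ?thesis by (simp add: mult_ac)
    qed simp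
  qed
  also have "\<dots> = - c * (LINT \<eta>|m. Re (?A \<eta> * ?C (\<xi> - \<eta>)))"
    by (rule integral_mult_right_zero)
  also have "(LINT \<eta>|m. Re (?A \<eta> * ?C (\<xi> - \<eta>))) = Re (conv_power m ?A (Suc k) \<xi>)"
    unfolding conv_power.simps conv_def by (rule integral_Re[OF i2])
  finally show ?case unfolding eq .
qed

end

section \<open>The Duhamel kernel against a fast oscillation\<close>

lemma LINT_sin_sin:
  fixes \<mu> \<omega> t :: real
  assumes "0 \<le> t" "\<mu>\<^sup>2 \<noteq> \<omega>\<^sup>2"
  shows "(LINT r|lborel. indicator {0..t} r *\<^sub>R (sin (\<mu> * (t - r)) * sin (\<omega> * r)))
     = (\<mu> * sin (\<omega> * t) - \<omega> * sin (\<mu> * t)) / (\<mu>\<^sup>2 - \<omega>\<^sup>2)"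
proof -
  let ?D = "\<mu>\<^sup>2 - \<omega>\<^sup>2"
  let ?G = "\<lambda>r. (\<omega> * sin (\<mu> * (t - r)) * cos (\<omega> * r) + \<mu> * cos (\<mu> * (t - r)) * sin (\<omega> * r)) / ?D"
  have D: "?D \<noteq> 0" using assms by simp
  have "(LINT r|lborel. indicator {0..t} r *\<^sub>R (sin (\<mu> * (t - r)) * sin (\<omega> * r))) = ?G t - ?G 0"
  proof (rule integral_FTC_Icc[OF assms(1)])
    fix r :: real
    have "((\<lambda>r. \<omega> * sin (\<mu> * (t - r)) * cos (\<omega> * r) + \<mu> * cos (\<mu> * (t - r)) * sin (\<omega> * r)) has_real_derivative
        ?D * (sin (\<mu> * (t - r)) * sin (\<omega> * r))) (at r within {0..t})"
      by (auto intro!: derivative_eq_intros simp: algebra_simps power2_eq_square)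
    from DERIV_cdivide[OF this, of ?D] D
    show "(?G has_vector_derivative sin (\<mu> * (t - r)) * sin (\<omega> * r)) (at r within {0..t})"
      by (simp add: has_real_derivative_iff_has_vector_derivative)
    show "continuous_on {0..t} (\<lambda>r. sin (\<mu> * (t - r)) * sin (\<omega> * r))" by (intro continuous_intros)
  qed
  also have "?G t - ?G 0 = (\<mu> * sin (\<omega> * t) - \<omega> * sin (\<mu> * t)) / ?D"
    by (simp add: diff_divide_distrib)
  finally show ?thesis .
qed

text \<open>Up to a non-positive factor the integral is \<open>(\<omega> sin (\<mu> t) - \<mu> sin
  (\<omega> t)) / (\<omega>^2 - \<mu>^2)\<close>, with \<open>\<mu>\<close> the dispersion at
  \<open>\<xi>\<close>. Since \<open>\<mu> \<le> \<omega> s0 / 2\<close>, the second term cannot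
  outweigh half of the first, whatever its sign, and the denominator is at most
  \<open>\<omega>^2\<close>.\<close>

lemma kernel_oscillation_bound:
  assumes t: "0 \<le> t" and s0: "0 < s0" "s0 \<le> sin (dispersion \<xi> * t)"
    and \<omega>: "\<omega> \<ge> 2 * dispersion \<xi> / s0" and \<omega>0: "\<omega> > 0"
  shows "Im (LINT r|lborel. complex_of_real (indicator {0..t} r * duhamel_kernel (t - r) \<xi>) * cis (- (\<omega> * r)))
     \<le> - (\<bar>\<xi>\<bar> / sqrt (1 + \<xi>\<^sup>2) * s0 / (2 * \<omega>))"
proof -
  let ?\<mu> = "dispersion \<xi>" and ?c = "\<bar>\<xi>\<bar> / sqrt (1 + \<xi>\<^sup>2)"
  have c: "0 \<le> ?c" by simp
  have "s0 \<le> 1" using s0(2) sin_le_one order_trans by blast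
  have sm: "2 * ?\<mu> \<le> s0 * \<omega>" using \<omega> s0 by (simp add: pos_divide_le_eq mult.commute)
  also have "s0 * \<omega> \<le> \<omega>" using \<open>s0 \<le> 1\<close> \<omega>0 by simp
  finally have "?\<mu> < \<omega>" using \<omega>0 dispersion_nonneg[of \<xi>] by linarith
  hence sq: "?\<mu>\<^sup>2 < \<omega>\<^sup>2" by (intro power_strict_mono) auto
  have i: "integrable lborel (\<lambda>r. complex_of_real (indicator {0..t} r * duhamel_kernel (t - r) \<xi>) * cis (- (\<omega> * r)))"
  proof (rule integrable_dominated[OF integrable_indicator_Icc])
    have [measurable]: "(\<lambda>r. duhamel_kernel (t - r) \<xi>) \<in> borel_measurable borel"
      by (intro borel_measurable_continuous_onI continuous_intros)
    show "(\<lambda>r. complex_of_real (indicator {0..t} r * duhamel_kernel (t - r) \<xi>) * cis (- (\<omega> * r))) \<in> borel_measurable lborel"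
      by measurable
    show "norm (complex_of_real (indicator {0..t} r * duhamel_kernel (t - r) \<xi>) * cis (- (\<omega> * r))) \<le> indicator {0..t} r" for r
      using abs_duhamel_kernel_le by (auto simp: norm_mult indicator_def)
  qed
  have "Im (LINT r|lborel. complex_of_real (indicator {0..t} r * duhamel_kernel (t - r) \<xi>) * cis (- (\<omega> * r)))
      = (LINT r|lborel. Im (complex_of_real (indicator {0..t} r * duhamel_kernel (t - r) \<xi>) * cis (- (\<omega> * r))))"
    by (rule integral_Im[OF i, symmetric])
  also have "\<dots> = (LINT r|lborel. - ?c * (indicator {0..t} r *\<^sub>R (sin (?\<mu> * (t - r)) * sin (\<omega> * r))))"
    by (rule Bochner_Integration.integral_cong) (auto simp: indicator_def duhamel_kernel_def mult_ac)
  also have "\<dots> = - ?c * ((?\<mu> * sin (\<omega> * t) - \<omega> * sin (?\<mu> * t)) / (?\<mu>\<^sup>2 - \<omega>\<^sup>2))"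
    using sq by (subst integral_mult_right_zero, subst LINT_sin_sin[OF t]) auto
  also have "(?\<mu> * sin (\<omega> * t) - \<omega> * sin (?\<mu> * t)) / (?\<mu>\<^sup>2 - \<omega>\<^sup>2)
     = (\<omega> * sin (?\<mu> * t) - ?\<mu> * sin (\<omega> * t)) / (\<omega>\<^sup>2 - ?\<mu>\<^sup>2)"
    by (metis minus_diff_eq minus_divide_divide)
  also have "- ?c * \<dots> \<le> - ?c * (s0 / (2 * \<omega>))"
  proof (rule mult_left_mono_neg)
    have "\<omega> * s0 \<le> \<omega> * sin (?\<mu> * t)" using \<omega>0 s0 by simp
    moreover have "?\<mu> * sin (\<omega> * t) \<le> ?\<mu> * 1" by (intro mult_left_mono) auto
    ultimately have num: "\<omega> * s0 / 2 \<le> \<omega> * sin (?\<mu> * t) - ?\<mu> * sin (\<omega> * t)"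
      using sm by (simp add: mult.commute)
    have "s0 / (2 * \<omega>) = (\<omega> * s0 / 2) / \<omega>\<^sup>2" using \<omega>0 by (simp add: power2_eq_square)
    also have "\<dots> \<le> (\<omega> * s0 / 2) / (\<omega>\<^sup>2 - ?\<mu>\<^sup>2)"
      using sq \<omega>0 s0 by (intro divide_left_mono) auto
    also have "\<dots> \<le> (\<omega> * sin (?\<mu> * t) - ?\<mu> * sin (\<omega> * t)) / (\<omega>\<^sup>2 - ?\<mu>\<^sup>2)"
      using sq by (intro divide_right_mono num) auto
    finally show "s0 / (2 * \<omega>) \<le> (\<omega> * sin (?\<mu> * t) - ?\<mu> * sin (\<omega> * t)) / (\<omega>\<^sup>2 - ?\<mu>\<^sup>2)" .
  qed (use c in simp)
  finally show ?thesis by simp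
qed

section \<open>Wave packets\<close>

text \<open>A tent instead of an indicator function, because \<open>decays\<close> asks for
  continuity.\<close>

definition bump :: "real \<Rightarrow> real \<Rightarrow> real" where
  "bump \<delta> x = max 0 (\<delta> - \<bar>x\<bar>)"

text \<open>Even, as real data require, and non-negative, as the superposition argument
  requires.\<close>

definition packet :: "real \<Rightarrow> nat \<Rightarrow> nat \<Rightarrow> real \<Rightarrow> real" where
  "packet \<delta> N K \<xi> = bump \<delta> (\<xi> - real N) + bump \<delta> (\<xi> + real N) + bump \<delta> (\<xi> - real K) + bump \<delta> (\<xi> + real K)"

lemma bump_nonneg [simp]: "0 \<le> bump \<delta> x"
  by (simp add: bump_def)

lemma bump_neq_0: "bump \<delta> x \<noteq> 0 \<Longrightarrow> \<bar>x\<bar> < \<delta>"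
  by (simp add: bump_def max_def split: if_splits)

lemma bump_minus [simp]: "bump \<delta> (- x) = bump \<delta> x"
  by (simp add: bump_def)

lemma packet_nonneg [simp]: "0 \<le> packet \<delta> N K \<xi>"
  by (simp add: packet_def)

lemma packet_minus [simp]: "packet \<delta> N K (- \<xi>) = packet \<delta> N K \<xi>"
proof -
  have "bump \<delta> (- \<xi> - c) = bump \<delta> (\<xi> + c)" "bump \<delta> (- \<xi> + c) = bump \<delta> (\<xi> - c)" for c
    using bump_minus[of \<delta> "\<xi> + c"] bump_minus[of \<delta> "\<xi> - c"] by simp_all
  thus ?thesis by (simp add: packet_def)
qed

lemma packet_neq_0D:
  assumes "packet \<delta> N K \<xi> \<noteq> 0"
  shows "\<exists>c\<in>{real N, - real N, real K, - real K}. \<bar>\<xi> - c\<bar> < \<delta>"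
  using assms bump_neq_0[of \<delta> "\<xi> - real N"] bump_neq_0[of \<delta> "\<xi> + real N"]
    bump_neq_0[of \<delta> "\<xi> - real K"] bump_neq_0[of \<delta> "\<xi> + real K"]
  by (cases "bump \<delta> (\<xi> - real N) = 0"; cases "bump \<delta> (\<xi> + real N) = 0"; cases "bump \<delta> (\<xi> - real K) = 0")
     (auto simp: packet_def)

lemma packet_ge:
  assumes "c \<in> {real N, - real N, real K, - real K}" "\<bar>\<xi> - c\<bar> \<le> \<delta> / 2"
  shows "\<delta> / 2 \<le> packet \<delta> N K \<xi>"
proof -
  have "\<delta> / 2 \<le> bump \<delta> (\<xi> - c)" unfolding bump_def using assms(2) by (intro order_trans[OF _ max.cobounded2]) linarith
  also have "\<dots> \<le> packet \<delta> N K \<xi>" using assms(1) by (auto simp: packet_def)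
  finally show ?thesis .
qed

lemma packet_le: "0 \<le> \<delta> \<Longrightarrow> packet \<delta> N K \<xi> \<le> 4 * \<delta>"
  by (simp add: packet_def bump_def)

text \<open>The constant grows like \<open>K^2\<close>. This only influences how small the data must
  be for the contraction, which may depend on \<open>N\<close>.\<close>

lemma packet_le_sum_weight:
  assumes "0 < \<delta>" "\<delta> \<le> 1" "N \<le> K"
  shows "packet \<delta> N K \<xi> \<le> 4 * \<delta> * (1 + (real K + 1)\<^sup>2) * weight \<xi>"
proof (cases "packet \<delta> N K \<xi> = 0")
  case True
  thus ?thesis using assms by simp
next
  case False
  have "\<bar>\<xi>\<bar> \<le> real K + 1" using packet_neq_0D[OF False] assms by auto
  hence "\<xi>\<^sup>2 \<le> (real K + 1)\<^sup>2" using abs_le_square_iff[of \<xi> "real K + 1"] by simp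
  hence "1 \<le> (1 + (real K + 1)\<^sup>2) * weight \<xi>" by (simp add: weight_def add_pos_nonneg)
  from mult_left_mono[OF this, of "4 * \<delta>"]
  have "4 * \<delta> \<le> 4 * \<delta> * ((1 + (real K + 1)\<^sup>2) * weight \<xi>)" using assms by simp
  from order_trans[OF packet_le this] show ?thesis using assms by (simp add: mult.assoc)
qed

lemma decays_packet:
  assumes "0 < \<delta>" "\<delta> \<le> 1" "N \<le> K" "0 \<le> A"
  shows "decays (A * (4 * \<delta> * (1 + (real K + 1)\<^sup>2))) (\<lambda>\<xi>. complex_of_real (A * packet \<delta> N K \<xi>))"
  unfolding decays_def
proof (intro conjI allI)
  show "continuous_on UNIV (\<lambda>\<xi>. complex_of_real (A * packet \<delta> N K \<xi>))"
    unfolding packet_def bump_def by (intro continuous_intros)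
  show "cmod (complex_of_real (A * packet \<delta> N K \<xi>)) \<le> A * (4 * \<delta> * (1 + (real K + 1)\<^sup>2)) * weight \<xi>" for \<xi>
    unfolding norm_of_real using mult_left_mono[OF packet_le_sum_weight[OF assms(1-3), of \<xi>] assms(4)] assms(4)
    by (simp add: mult.assoc)
qed

text \<open>\<open>2 K + 3\<close> is the Lipschitz constant of \<open>phase\<close> for arguments
  of size at most \<open>K + 1\<close>, which includes the support of the packet.\<close>

lemma packet_near_lattice:
  assumes "packet \<delta> N K \<xi> \<noteq> 0" "N \<le> K" "\<delta> \<le> 1"
  shows "\<exists>(\<alpha>::int) (\<beta>::int). \<bar>\<beta>\<bar> \<le> (1::int) \<and> \<bar>\<xi> - (\<alpha> * real N + \<beta> * real K)\<bar> \<le> \<delta>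
     \<and> \<bar>phase \<xi> - (\<alpha> * phase (real N) + \<beta> * phase (real K))\<bar> \<le> \<delta> * (2 * real K + 3)"
proof -
  have close: "\<bar>phase \<xi> - phase c\<bar> \<le> \<delta> * (2 * real K + 3)" if "\<bar>\<xi> - c\<bar> < \<delta>" "\<bar>c\<bar> \<le> real K" for c
  proof -
    have "\<bar>phase \<xi> - phase c\<bar> \<le> \<bar>\<xi> - c\<bar> * (1 + 2 * (real K + 1))"
      using that assms by (intro phase_lipschitz) auto
    also have "\<dots> \<le> \<delta> * (1 + 2 * (real K + 1))" using that by (intro mult_right_mono) auto
    finally show ?thesis by (simp add: algebra_simps)
  qed
  from packet_neq_0D[OF assms(1)] consider "\<bar>\<xi> - real N\<bar> < \<delta>" | "\<bar>\<xi> - (- real N)\<bar> < \<delta>"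
    | "\<bar>\<xi> - real K\<bar> < \<delta>" | "\<bar>\<xi> - (- real K)\<bar> < \<delta>" by auto
  thus ?thesis
  proof cases
    case 1 show ?thesis using close[OF 1] 1 assms by (intro exI[of _ 1] exI[of _ 0]) auto
  next
    case 2 show ?thesis using close[OF 2] 2 assms by (intro exI[of _ "-1"] exI[of _ 0]) auto
  next
    case 3 show ?thesis using close[OF 3] 3 assms by (intro exI[of _ 0] exI[of _ 1]) auto
  next
    case 4 show ?thesis using close[OF 4] 4 assms by (intro exI[of _ 0] exI[of _ "-1"]) auto
  qed
qed

text \<open>The same two integers approximate the space frequency and the time frequency: this is
  the locking of the two. A bound on \<open>\<beta>\<close> suffices, since the space frequency will
  determine \<open>\<alpha>\<close> from it.\<close>

lemma phase_sums_near_lattice: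
  fixes X Y P Q :: real
  assumes "\<And>\<xi>. a \<xi> \<noteq> 0 \<Longrightarrow> \<exists>(\<alpha>::int) (\<beta>::int). \<bar>\<beta>\<bar> \<le> (1::int) \<and> \<bar>\<xi> - (\<alpha> * X + \<beta> * Y)\<bar> \<le> \<delta>
     \<and> \<bar>phase \<xi> - (\<alpha> * P + \<beta> * Q)\<bar> \<le> e"
    and "w \<in> phase_sums a k \<xi>"
  shows "\<exists>(\<alpha>::int) (\<beta>::int). \<bar>\<beta>\<bar> \<le> int (Suc k) \<and> \<bar>\<xi> - (\<alpha> * X + \<beta> * Y)\<bar> \<le> real (Suc k) * \<delta>
     \<and> \<bar>w - (\<alpha> * P + \<beta> * Q)\<bar> \<le> real (Suc k) * e"
  using assms(2)
proof (induction k arbitrary: w \<xi>)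
  case 0
  hence "a \<xi> \<noteq> 0" "w = phase \<xi>" by (auto split: if_splits)
  thus ?case using assms(1) by simp
next
  case (Suc k)
  then obtain \<eta> w' where w: "w = phase \<eta> + w'" "a \<eta> \<noteq> 0" "w' \<in> phase_sums a k (\<xi> - \<eta>)" by auto
  from assms(1)[OF w(2)] obtain \<alpha> :: int and \<beta> :: int where 1: "\<bar>\<beta>\<bar> \<le> (1::int)" "\<bar>\<eta> - (\<alpha> * X + \<beta> * Y)\<bar> \<le> \<delta>"
      "\<bar>phase \<eta> - (\<alpha> * P + \<beta> * Q)\<bar> \<le> e" by blast
  from Suc.IH[OF w(3)] obtain \<alpha>' :: int and \<beta>' :: int where 2: "\<bar>\<beta>'\<bar> \<le> int (Suc k)"
      "\<bar>\<xi> - \<eta> - (\<alpha>' * X + \<beta>' * Y)\<bar> \<le> real (Suc k) * \<delta>"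
      "\<bar>w' - (\<alpha>' * P + \<beta>' * Q)\<bar> \<le> real (Suc k) * e" by blast
  have "\<xi> - (of_int (\<alpha> + \<alpha>') * X + of_int (\<beta> + \<beta>') * Y)
      = (\<eta> - (\<alpha> * X + \<beta> * Y)) + (\<xi> - \<eta> - (\<alpha>' * X + \<beta>' * Y))"
    by (simp add: algebra_simps)
  also have "\<bar>\<dots>\<bar> \<le> \<delta> + real (Suc k) * \<delta>" by (rule order_trans[OF abs_triangle_ineq add_mono[OF 1(2) 2(2)]])
  also have "\<dots> = real (Suc (Suc k)) * \<delta>" by (simp add: algebra_simps)
  finally have *: "\<bar>\<xi> - (of_int (\<alpha> + \<alpha>') * X + of_int (\<beta> + \<beta>') * Y)\<bar> \<le> real (Suc (Suc k)) * \<delta>" .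
  have "w - (of_int (\<alpha> + \<alpha>') * P + of_int (\<beta> + \<beta>') * Q)
      = (phase \<eta> - (\<alpha> * P + \<beta> * Q)) + (w' - (\<alpha>' * P + \<beta>' * Q))"
    by (simp add: algebra_simps w)
  also have "\<bar>\<dots>\<bar> \<le> e + real (Suc k) * e" by (rule order_trans[OF abs_triangle_ineq add_mono[OF 1(3) 2(3)]])
  also have "\<dots> = real (Suc (Suc k)) * e" by (simp add: algebra_simps)
  finally have "\<bar>w - (of_int (\<alpha> + \<alpha>') * P + of_int (\<beta> + \<beta>') * Q)\<bar> \<le> real (Suc (Suc k)) * e" .
  with * 1(1) 2(1) show ?case by (intro exI[of _ "\<alpha> + \<alpha>'"] exI[of _ "\<beta> + \<beta>'"]) auto
qed

section \<open>Which sums of packet centres give the output frequency \<open>1\<close>\<close>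

primrec center_sums :: "real set \<Rightarrow> nat \<Rightarrow> real set" where
  "center_sums C 0 = C"
| "center_sums C (Suc k) = {c + x | c x. c \<in> C \<and> x \<in> center_sums C k}"

lemma center_sums_Suc_Suc:
  assumes "c \<in> C" "- c \<in> C" "x \<in> center_sums C k"
  shows "x \<in> center_sums C (Suc (Suc k))"
proof -
  have "- c + x \<in> center_sums C (Suc k)" unfolding center_sums.simps(2) using assms(2,3) by blast
  hence "c + (- c + x) \<in> center_sums C (Suc (Suc k))"
    unfolding center_sums.simps(2)[of C "Suc k"] using assms(1) by blast
  thus ?thesis by simp
qed

text \<open>With \<open>p = Suc k\<close>, even \<open>k\<close> means odd \<open>p\<close>. An odd
  number of centres reaches \<open>1\<close> as \<open>K - N - N\<close>, an even number as
  \<open>K - N\<close>.\<close>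

definition second_frequency :: "nat \<Rightarrow> nat \<Rightarrow> nat" where
  "second_frequency k N = (if even k then 2 * N + 1 else N + 1)"

text \<open>The power of \<open>N\<close> to which the time frequency of the surviving combination
  is comparable, hence the power lost in the time integral.\<close>

definition phase_exponent :: "nat \<Rightarrow> nat" where
  "phase_exponent k = (if even k then 2 else 1)"

text \<open>The basic combination of two or three centres is padded with cancelling pairs
  \<open>N\<close>, \<open>- N\<close>, which preserves the parity of the number of terms.\<close>

lemma one_mem_center_sums:
  assumes "k \<ge> 1" and "K = second_frequency k N"
  shows "1 \<in> center_sums {real N, - real N, real K, - real K} k"
proof (cases "even k")
  case True
  let ?C = "{real N, - real N, real K, - real K}"
  have K: "real K = 2 * real N + 1" using assms True by (simp add: second_frequency_def)
  have "1 \<in> center_sums ?C (2 * j + 2)" for j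
  proof (induction j)
    case 0
    have "real K \<in> center_sums ?C 0" by simp
    hence "- real N + real K \<in> center_sums ?C (Suc 0)" unfolding center_sums.simps(2) by blast
    hence "- real N + (- real N + real K) \<in> center_sums ?C (Suc (Suc 0))"
      unfolding center_sums.simps(2)[of _ "Suc 0"] by blast
    thus ?case by (simp add: K numeral_2_eq_2)
  next
    case (Suc j)
    from center_sums_Suc_Suc[OF _ _ this, of "real N"] show ?case by simp
  qed
  moreover have "k = 2 * (k div 2 - 1) + 2" using True assms(1) by auto
  ultimately show ?thesis by metis
next
  case False
  let ?C = "{real N, - real N, real K, - real K}"
  have K: "real K = real N + 1" using assms False by (simp add: second_frequency_def)
  have "1 \<in> center_sums ?C (2 * j + 1)" for j
  proof (induction j)
    case 0
    have "real K \<in> center_sums ?C 0" by simp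
    hence "- real N + real K \<in> center_sums ?C (Suc 0)" unfolding center_sums.simps(2) by blast
    thus ?case by (simp add: K)
  next
    case (Suc j)
    from center_sums_Suc_Suc[OF _ _ this, of "real N"] show ?case by simp
  qed
  moreover from False obtain j where "k = 2 * j + 1" by (elim oddE)
  ultimately show ?thesis by simp
qed

text \<open>Inserting \<open>K\<close> into \<open>\<alpha> N + \<beta> K = 1\<close> gives
  \<open>g N = 1 - \<beta>\<close> for an integer \<open>g\<close>. As
  \<open>\<bar>1 - \<beta>\<bar> < N\<close>, both sides vanish. Thus for large \<open>N\<close> the
  coefficients, and with them the approximate time frequency, are unique; cancelling pairs do not
  enter them.\<close>

lemma lattice_unit:
  fixes \<alpha> \<beta> :: int
  assumes "K = second_frequency k N" "\<bar>\<beta>\<bar> \<le> int (Suc k)" "N > k + 2"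
    and "\<bar>real_of_int (\<alpha> * int N + \<beta> * int K) - 1\<bar> < 1"
  shows "\<beta> = 1 \<and> \<alpha> = (if even k then - 2 else - 1)"
proof -
  have *: "\<alpha> * int N + \<beta> * int K = 1" using assms(4) by linarith
  define g where "g = (if even k then \<alpha> + 2 * \<beta> else \<alpha> + \<beta>)"
  have g: "g * int N = 1 - \<beta>"
    using * assms(1) by (auto simp: g_def second_frequency_def algebra_simps)
  have "\<bar>1 - \<beta>\<bar> < int N" using assms(2,3) by linarith
  have "g = 0"
  proof (rule ccontr)
    assume "g \<noteq> 0"
    hence "1 * int N \<le> \<bar>g\<bar> * int N" by (intro mult_right_mono) auto
    also have "\<dots> = \<bar>1 - \<beta>\<bar>" by (simp add: g[symmetric] abs_mult)
    finally show False using \<open>\<bar>1 - \<beta>\<bar> < int N\<close> by simp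
  qed
  with g have "\<beta> = 1" by simp
  with \<open>g = 0\<close> show ?thesis by (auto simp: g_def split: if_splits)
qed

text \<open>The main terms are \<open>K^2 - 2 N^2 = 2 N^2 + 4 N + 1\<close> for even
  \<open>k\<close> and \<open>K^2 - N^2 = 2 N + 1\<close> for odd \<open>k\<close>. The errors of
  \<open>phase_bounds\<close> and the tolerance, about \<open>K / 4\<close>, are too small to spoil
  them once \<open>N \<ge> 5\<close>.\<close>

lemma resonance_frequency_bounds:
  assumes "K = second_frequency k N" "N \<ge> 5"
    and "\<bar>w - ((if even k then - 2 else - 1) * phase (real N) + phase (real K))\<bar> \<le> (2 * real K + 3) / 8"
  shows "real N ^ phase_exponent k \<le> w" "w \<le> 4 * real N ^ phase_exponent k"
proof -
  have N: "5 \<le> real N" using assms(2) by simp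
  note b = phase_bounds[of "real N", OF of_nat_0_le_iff] phase_bounds[of "real K", OF of_nat_0_le_iff]
  have sq: "5 * real N \<le> (real N)\<^sup>2" using N by (simp add: power2_eq_square)
  show "real N ^ phase_exponent k \<le> w" "w \<le> 4 * real N ^ phase_exponent k"
  proof -
    have "real N ^ phase_exponent k \<le> w \<and> w \<le> 4 * real N ^ phase_exponent k"
    proof (cases "even k")
      case True
      hence K: "real K = 2 * real N + 1" using assms by (simp add: second_frequency_def)
      have K2: "(real K)\<^sup>2 = 4 * (real N)\<^sup>2 + 4 * real N + 1" by (simp add: K power2_eq_square algebra_simps)
      have F: "\<bar>w - (- 2 * phase (real N) + phase (real K))\<bar> \<le> (2 * real K + 3) / 8"
        using assms(3) True by simp
      have "(real N)\<^sup>2 \<le> w" using F K2 b sq N K by argo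
      moreover have "w \<le> 4 * (real N)\<^sup>2" using F K2 b sq N K by argo
      ultimately show ?thesis using True by (simp add: phase_exponent_def)
    next
      case False
      hence K: "real K = real N + 1" using assms by (simp add: second_frequency_def)
      have K2: "(real K)\<^sup>2 = (real N)\<^sup>2 + 2 * real N + 1" by (simp add: K power2_eq_square algebra_simps)
      have F: "\<bar>w - (- 1 * phase (real N) + phase (real K))\<bar> \<le> (2 * real K + 3) / 8"
        using assms(3) False by simp
      have "real N \<le> w" using F K2 b sq N K by argo
      moreover have "w \<le> 4 * real N" using F K2 b sq N K by argo
      ultimately show ?thesis using False by (simp add: phase_exponent_def)
    qed
    thus "real N ^ phase_exponent k \<le> w" "w \<le> 4 * real N ^ phase_exponent k" by auto
  qed
qed

section \<open>Lower bounds for convolution powers and for the first iterate\<close>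

context frequency_measure
begin

lemma integral_translate_real:
  fixes g :: "real \<Rightarrow> real"
  assumes "c \<in> space m"
  shows "(LINT \<eta>|m. g (\<eta> - c)) = (LINT \<eta>|m. g \<eta>)"
  using integral_translate[OF assms, of "\<lambda>x. complex_of_real (g x)"] by (simp only: integral_complex_of_real of_real_eq_iff)

lemma integrable_indicator_cbox: "integrable m (indicator {a..b} :: real \<Rightarrow> real)"
proof (rule integrable_dominated)
  let ?B = "1 + (\<bar>a\<bar> + \<bar>b\<bar>)\<^sup>2"
  show "integrable m (\<lambda>x. ?B * weight x)" by (intro integrable_mult_right integrable_weight)
  show "(indicator {a..b} :: real \<Rightarrow> real) \<in> borel_measurable m" by (intro measurable_freq) simp
  show "norm (indicator {a..b} x :: real) \<le> ?B * weight x" for x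
  proof (cases "x \<in> {a..b}")
    case True
    hence "\<bar>x\<bar> \<le> \<bar>\<bar>a\<bar> + \<bar>b\<bar>\<bar>" by auto
    hence "x\<^sup>2 \<le> (\<bar>a\<bar> + \<bar>b\<bar>)\<^sup>2" by (simp only: abs_le_square_iff)
    with True show ?thesis by (simp add: weight_def add_pos_nonneg)
  qed (simp add: add_nonneg_nonneg)
qed

definition ball_mass :: "real \<Rightarrow> real" where
  "ball_mass r = (LINT \<eta>|m. indicator {-r..r} \<eta>)"

lemma ball_mass_pos: "0 < r \<Longrightarrow> 0 < ball_mass r"
  unfolding ball_mass_def by (rule mass_near_0)

lemma ball_mass_eq:
  assumes "c \<in> \<int>"
  shows "(LINT \<eta>|m. indicator {c - r..c + r} \<eta>) = ball_mass r"
proof -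
  have "(LINT \<eta>|m. indicator {c - r..c + r} \<eta> :: real) = (LINT \<eta>|m. indicator {-r..r} (\<eta> - c))"
    by (intro Bochner_Integration.integral_cong) (auto simp: indicator_def)
  thus ?thesis using integral_translate_real[of c "indicator {-r..r}"] assms Ints_space
    by (auto simp: ball_mass_def)
qed

lemma conv_power_nonneg:
  fixes a :: "real \<Rightarrow> real"
  assumes "decays R (\<lambda>\<xi>. complex_of_real (a \<xi>))" "\<And>\<xi>. 0 \<le> a \<xi>"
  shows "0 \<le> Re (conv_power m (\<lambda>\<xi>. complex_of_real (a \<xi>)) k \<xi>)"
proof (induction k arbitrary: \<xi>)
  case (Suc k)
  show ?case unfolding conv_power_real[OF assms(1)]
    using Suc assms(2) by (intro Bochner_Integration.integral_nonneg) auto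
qed (use assms in simp)

text \<open>Each integration is restricted to a ball around a centre. The deviations allowed for the
  output and for the new variable add up to the one allowed for the remaining factors, hence the
  halving. Balls around integers have equal mass, so the bound is blind to the size of the
  centres.\<close>

lemma conv_power_lower_bound:
  fixes a :: "real \<Rightarrow> real"
  assumes a: "decays R (\<lambda>\<xi>. complex_of_real (a \<xi>))" "\<And>\<xi>. 0 \<le> a \<xi>"
    and B: "0 \<le> B" and \<delta>: "0 < \<delta>" and C: "C \<subseteq> \<int>"
    and ge: "\<And>c \<xi>. c \<in> C \<Longrightarrow> \<bar>\<xi> - c\<bar> \<le> \<delta> / 2 \<Longrightarrow> B \<le> a \<xi>"
    and "x \<in> center_sums C k" "\<bar>\<xi> - x\<bar> \<le> \<delta> / 2 ^ Suc k"
  shows "B ^ Suc k * (\<Prod>j<k. ball_mass (\<delta> / 2 ^ (j + 2))) \<le> Re (conv_power m (\<lambda>\<xi>. complex_of_real (a \<xi>)) k \<xi>)"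
  using assms(7,8)
proof (induction k arbitrary: x \<xi>)
  case 0
  thus ?case using ge by simp
next
  case (Suc k)
  then obtain c x' where x: "x = c + x'" "c \<in> C" "x' \<in> center_sums C k" by auto
  let ?r = "\<delta> / 2 ^ (k + 2)"
  let ?g = "B ^ Suc k * (\<Prod>j<k. ball_mass (\<delta> / 2 ^ (j + 2)))"
  let ?A = "\<lambda>\<xi>. complex_of_real (a \<xi>)"
  have "0 \<le> ball_mass (\<delta> / 2 ^ (j + 2))" for j
    by (rule less_imp_le[OF ball_mass_pos]) (use \<delta> in simp)
  hence g0: "0 \<le> ?g" using B by (intro mult_nonneg_nonneg prod_nonneg) auto
  have "B ^ Suc (Suc k) * (\<Prod>j<Suc k. ball_mass (\<delta> / 2 ^ (j + 2))) = (LINT \<eta>|m. indicator {c - ?r..c + ?r} \<eta> * (B * ?g))"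
    using ball_mass_eq[of c ?r] x(2) C by (auto simp: mult_ac)
  also have "\<dots> \<le> (LINT \<eta>|m. a \<eta> * Re (conv_power m ?A k (\<xi> - \<eta>)))"
  proof (rule integral_mono)
    show "integrable m (\<lambda>\<eta>. indicator {c - ?r..c + ?r} \<eta> * (B * ?g))"
      by (intro integrable_mult_left integrable_indicator_cbox)
    show "integrable m (\<lambda>\<eta>. a \<eta> * Re (conv_power m ?A k (\<xi> - \<eta>)))"
      using integrable_Re[OF conv_integrable[OF a(1) decays_conv_power[OF a(1), of k], of \<xi>]] by simp
    fix \<eta>
    show "indicator {c - ?r..c + ?r} \<eta> * (B * ?g) \<le> a \<eta> * Re (conv_power m ?A k (\<xi> - \<eta>))"
    proof (cases "\<eta> \<in> {c - ?r..c + ?r}")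
      case True
      hence e: "\<bar>\<eta> - c\<bar> \<le> ?r" by auto
      have "(1 :: real) \<le> 2 * 2 ^ k" using one_le_power[of "2::real" k] by linarith
      hence "?r \<le> \<delta> / 2" using \<delta> by (intro divide_left_mono) auto
      with e have "B \<le> a \<eta>" by (intro ge[OF x(2)]) simp
      moreover have "?g \<le> Re (conv_power m ?A k (\<xi> - \<eta>))"
      proof (rule Suc.IH[OF x(3)])
        have "\<bar>\<xi> - \<eta> - x'\<bar> \<le> \<bar>\<xi> - x\<bar> + \<bar>\<eta> - c\<bar>" unfolding x(1) by linarith
        also have "\<dots> \<le> ?r + ?r" using Suc.prems(2) e by (intro add_mono) auto
        also have "\<dots> = \<delta> / 2 ^ Suc k" by simp
        finally show "\<bar>\<xi> - \<eta> - x'\<bar> \<le> \<delta> / 2 ^ Suc k" .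
      qed
      ultimately have "B * ?g \<le> a \<eta> * Re (conv_power m ?A k (\<xi> - \<eta>))" using g0 a(2) by (intro mult_mono) auto
      with True show ?thesis by simp
    next
      case False
      thus ?thesis using conv_power_nonneg[OF a] a(2) by simp
    qed
  qed
  also have "\<dots> = Re (conv_power m ?A (Suc k) \<xi>)" by (rule conv_power_real[OF a(1), symmetric])
  finally show ?case .
qed

lemma resonant_output:
  fixes k :: nat and t :: real
  assumes t: "0 < t" "t < 1" and k: "k \<ge> 1"
  defines "\<delta> \<equiv> 1 / (8 * real (Suc k))"
  defines "r \<equiv> \<delta> / 2 ^ Suc k"
  obtains c N0 where "c > 0"
    and "\<And>N A. N \<ge> N0 \<Longrightarrow> 0 \<le> A \<Longrightarrow>
       c * A ^ Suc k / real N ^ phase_exponent k \<le>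
       - (LINT \<xi>|m. indicator {1 - r..1 + r} \<xi> *
           Im (duhamel m t 1 k (wave (\<lambda>\<xi>. A * packet \<delta> N (second_frequency k N) \<xi>)) t \<xi>))"
proof -
  have \<delta>: "0 < \<delta>" "\<delta> \<le> 1 / 8" "real (Suc k) * \<delta> = 1 / 8"
    using k by (auto simp: \<delta>_def field_simps)
  have "(1 :: real) \<le> 2 * 2 ^ k" using one_le_power[of "2::real" k] by linarith
  hence r: "0 < r" "r \<le> \<delta>" using \<delta> by (auto simp: r_def field_simps)
  \<comment> \<open>On the window the dispersion lies in \<open>[1/2, 2]\<close>, so its product
    with \<open>t\<close> lies in \<open>[t/2, 2 t]\<close>, which is inside \<open>(0, pi)\<close>
    because \<open>t < 1\<close>. The minimum of \<open>sin\<close> there is positive and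
    independent of \<open>N\<close>.\<close>
  have "compact {t / 2..2 * t}" "{t / 2..2 * t} \<noteq> {}" using t by auto
  moreover have "continuous_on {t / 2..2 * t} sin" by (intro continuous_intros)
  ultimately obtain x0 where x0: "x0 \<in> {t / 2..2 * t}" "\<And>x. x \<in> {t / 2..2 * t} \<Longrightarrow> sin x0 \<le> sin x"
    using continuous_attains_inf[of "{t / 2..2 * t}" sin] by blast
  define s0 where "s0 = sin x0"
  have s0: "s0 > 0" unfolding s0_def using x0(1) t pi_gt3 by (intro sin_gt_zero) auto
  define \<gamma> where "\<gamma> = (\<Prod>j<k. ball_mass (\<delta> / 2 ^ (j + 2)))"
  have bm: "0 < ball_mass (\<delta> / 2 ^ (j + 2))" for j
    by (rule ball_mass_pos) (use \<delta> in simp)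
  have \<gamma>: "\<gamma> > 0" unfolding \<gamma>_def by (rule prod_pos) (use bm in blast)
  \<comment> \<open>The three factors come from the time integral, from the convolution power, and
    from the mass of the window.\<close>
  define c where "c = s0 / 16 * ((\<delta> / 2) ^ Suc k * \<gamma>) * ball_mass r"
  \<comment> \<open>\<open>N1\<close> makes the time frequency exceed \<open>2 \<mu> / s0\<close>,
    as the dispersion \<open>\<mu>\<close> is at most \<open>2\<close> on the window;
    \<open>k + 5\<close> covers the lattice argument and the phase bounds.\<close>
  obtain N1 :: nat where N1: "4 / s0 \<le> real N1" using real_arch_simple by blast
  define N0 where "N0 = max N1 (k + 5)"
  show ?thesis
  proof (rule that[of c N0])
    show "c > 0" unfolding c_def using s0 \<gamma> \<delta> ball_mass_pos[OF r(1)] by simp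
    fix N A assume N: "N \<ge> N0" and A: "(0::real) \<le> A"
    define K where "K = second_frequency k N"
    define a where "a = (\<lambda>\<xi>. A * packet \<delta> N K \<xi>)"
    define e where "e = phase_exponent k"
    have N5: "N \<ge> 5" "N > k + 2" "N1 \<le> N" using N by (auto simp: N0_def)
    have NK: "N \<le> K" by (simp add: K_def second_frequency_def)
    have pN: "0 < real N ^ e" using N5 by simp
    have eN: "real N \<le> real N ^ e" using N5 by (simp add: e_def phase_exponent_def self_le_power)
    have da: "decays (A * (4 * \<delta> * (1 + (real K + 1)\<^sup>2))) (\<lambda>\<xi>. complex_of_real (a \<xi>))"
      unfolding a_def by (rule decays_packet) (use \<delta> NK A in auto)
    have sym: "a (- \<xi>) = a \<xi>" and a0: "0 \<le> a \<xi>" for \<xi>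
      using A by (simp_all add: a_def)
    note curve = decaying_curve_wave[OF da sym]
    have pointwise: "Im (duhamel m t 1 k (wave a) t \<xi>) \<le> - (s0 / (16 * real N ^ e) * ((A * (\<delta> / 2)) ^ Suc k * \<gamma>))"
      if \<xi>: "\<xi> \<in> {1 - r..1 + r}" for \<xi>
    proof -
      have x: "7 / 8 \<le> \<xi>" "\<xi> \<le> 9 / 8" using \<xi> r \<delta> by auto
      have disp: "dispersion \<xi> = phase \<xi>" using x by (simp add: phase_eq)
      have "(7 / 8)\<^sup>2 \<le> \<xi>\<^sup>2" "\<xi>\<^sup>2 \<le> (9 / 8)\<^sup>2" using x by (auto intro!: power_mono)
      hence sq: "1 / 2 \<le> \<xi>\<^sup>2" "\<xi>\<^sup>2 \<le> 3 / 2" by (auto simp: power2_eq_square)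
      have mu: "1 / 2 \<le> dispersion \<xi>" "dispersion \<xi> \<le> 2"
        using phase_bounds[of \<xi>] x sq unfolding disp by auto
      have "t * (1 / 2) \<le> t * dispersion \<xi>" "t * dispersion \<xi> \<le> t * 2"
        using t mu by (auto intro!: mult_left_mono)
      hence sin: "s0 \<le> sin (dispersion \<xi> * t)"
        unfolding s0_def by (intro x0(2)) (auto simp: mult.commute)
      have half: "1 / 2 \<le> \<bar>\<xi>\<bar> / sqrt (1 + \<xi>\<^sup>2)"
      proof -
        have "sqrt (1 + \<xi>\<^sup>2) \<le> 2 * \<bar>\<xi>\<bar>"
          by (rule real_le_lsqrt) (use sq in \<open>auto simp: power_mult_distrib\<close>)
        moreover have "0 < sqrt (1 + \<xi>\<^sup>2)" by (simp add: add_pos_nonneg)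
        ultimately show ?thesis by (simp add: field_simps)
      qed
      let ?h = "\<lambda>q. indicator {0..t} q * duhamel_kernel (t - q) \<xi>"
      have "Im (LINT q|lborel. complex_of_real (?h q) * cis (- (0 * q)) * conv_power m (wave a q) k \<xi>)
         \<le> - (s0 / (16 * real N ^ e)) * Re (conv_power m (\<lambda>\<xi>. complex_of_real (a \<xi>)) k \<xi>)"
      proof (rule wave_resonance[OF da sym a0])
        have [measurable]: "(\<lambda>q. duhamel_kernel (t - q) \<xi>) \<in> borel_measurable borel"
          by (intro borel_measurable_continuous_onI continuous_intros)
        show "?h \<in> borel_measurable borel" by measurable
        show "\<bar>?h q\<bar> \<le> indicator {0..t} q" for q
          using abs_duhamel_kernel_le by (auto simp: indicator_def)
        fix w assume w: "w \<in> phase_sums a k \<xi>"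
        have "\<exists>(\<alpha>::int) (\<beta>::int). \<bar>\<beta>\<bar> \<le> int (Suc k) \<and> \<bar>\<xi> - (\<alpha> * real N + \<beta> * real K)\<bar> \<le> real (Suc k) * \<delta>
            \<and> \<bar>w - (\<alpha> * phase (real N) + \<beta> * phase (real K))\<bar> \<le> real (Suc k) * (\<delta> * (2 * real K + 3))"
        proof (rule phase_sums_near_lattice[where X = "real N" and Y = "real K" and P = "phase (real N)" and Q = "phase (real K)", OF _ w])
          fix \<eta> assume "a \<eta> \<noteq> 0"
          hence "packet \<delta> N K \<eta> \<noteq> 0" by (auto simp: a_def)
          thus "\<exists>(\<alpha>::int) (\<beta>::int). \<bar>\<beta>\<bar> \<le> (1::int) \<and> \<bar>\<eta> - (\<alpha> * real N + \<beta> * real K)\<bar> \<le> \<delta>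
              \<and> \<bar>phase \<eta> - (\<alpha> * phase (real N) + \<beta> * phase (real K))\<bar> \<le> \<delta> * (2 * real K + 3)"
            by (rule packet_near_lattice) (use NK \<delta> in auto)
        qed
        then obtain \<alpha> :: int and \<beta> :: int where ab: "\<bar>\<beta>\<bar> \<le> int (Suc k)"
            "\<bar>\<xi> - (\<alpha> * real N + \<beta> * real K)\<bar> \<le> 1 / 8"
            "\<bar>w - (\<alpha> * phase (real N) + \<beta> * phase (real K))\<bar> \<le> 1 / 8 * (2 * real K + 3)"
          unfolding mult.assoc[symmetric] \<delta>(3) by blast
        \<comment> \<open>The window and the lattice approximation each deviate by at most
          \<open>1/8\<close>, so the lattice value is within \<open>1\<close> of the integer
          \<open>1\<close>.\<close>
        define S where "S = \<alpha> * real N + \<beta> * real K"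
        have "\<bar>S - 1\<bar> < 1" using ab(2)[folded S_def] x by linarith
        hence "\<bar>real_of_int (\<alpha> * int N + \<beta> * int K) - 1\<bar> < 1" by (simp add: S_def)
        from lattice_unit[OF K_def ab(1) N5(2) this]
        have \<beta>: "\<beta> = 1" and \<alpha>: "\<alpha> = (if even k then - 2 else - 1)" by auto
        have "\<bar>w - ((if even k then - 2 else - 1) * phase (real N) + phase (real K))\<bar> \<le> (2 * real K + 3) / 8"
          using ab(3) unfolding \<alpha> \<beta> by (simp split: if_splits)
        from resonance_frequency_bounds[OF K_def N5(1) this]
        have wb: "real N ^ e \<le> w" "w \<le> 4 * real N ^ e" by (auto simp: e_def)
        have w0: "w > 0" using wb pN by linarith
        have "2 * dispersion \<xi> / s0 \<le> 4 / s0" using mu s0 by (intro divide_right_mono) auto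
        also have "\<dots> \<le> real N" using N1 N5(3) by linarith
        finally have "2 * dispersion \<xi> / s0 \<le> w" using eN wb by linarith
        from kernel_oscillation_bound[OF less_imp_le[OF t(1)] s0 sin this w0]
        have "Im (LINT q|lborel. complex_of_real (?h q) * cis (- (w * q)))
          \<le> - (\<bar>\<xi>\<bar> / sqrt (1 + \<xi>\<^sup>2) * s0 / (2 * w))" .
        also have "\<dots> \<le> - (s0 / (16 * real N ^ e))"
        proof -
          \<comment> \<open>The \<open>16\<close> combines \<open>w \<le> 4 N^e\<close> with the
            lower bound \<open>1/2\<close> for the kernel amplitude and the \<open>2\<close> of the
            oscillation bound.\<close>
          have "s0 / (16 * real N ^ e) \<le> s0 / (4 * w)" using wb w0 s0 mult_pos_pos[OF w0 pN] by (intro divide_left_mono) auto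
          also have "\<dots> = 1 / 2 * (s0 / (2 * w))" by simp
          also have "\<dots> \<le> \<bar>\<xi>\<bar> / sqrt (1 + \<xi>\<^sup>2) * (s0 / (2 * w))"
            using s0 w0 by (intro mult_right_mono half) auto
          finally show ?thesis by simp
        qed
        finally show "Im (LINT q|lborel. complex_of_real (?h q) * cis (- ((0 + w) * q))) \<le> - (s0 / (16 * real N ^ e))"
          by simp
      qed (use t in auto)
      also have "\<dots> \<le> - (s0 / (16 * real N ^ e)) * ((A * (\<delta> / 2)) ^ Suc k * \<gamma>)"
      proof (rule mult_left_mono_neg)
        show "(A * (\<delta> / 2)) ^ Suc k * \<gamma> \<le> Re (conv_power m (\<lambda>\<xi>. complex_of_real (a \<xi>)) k \<xi>)"
          unfolding \<gamma>_def
        proof (rule conv_power_lower_bound[OF da a0 _ \<delta>(1) _ _ one_mem_center_sums[OF k K_def]])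
          show "A * (\<delta> / 2) \<le> a \<zeta>" if "c \<in> {real N, - real N, real K, - real K}" "\<bar>\<zeta> - c\<bar> \<le> \<delta> / 2" for c \<zeta>
            unfolding a_def by (intro mult_left_mono packet_ge[OF that] A)
          show "\<bar>\<xi> - 1\<bar> \<le> \<delta> / 2 ^ Suc k" using \<xi> unfolding r_def by auto
        qed (use A \<delta> in auto)
        show "- (s0 / (16 * real N ^ e)) \<le> 0" using s0 pN by simp
      qed
      finally have "Im (LINT q|lborel. complex_of_real (?h q) * cis (- (0 * q)) * conv_power m (wave a q) k \<xi>)
         \<le> - (s0 / (16 * real N ^ e) * ((A * (\<delta> / 2)) ^ Suc k * \<gamma>))" by simp
      moreover have "duhamel m t 1 k (wave a) t \<xi> = (LINT q|lborel. complex_of_real (?h q) * cis (- (0 * q)) * conv_power m (wave a q) k \<xi>)"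
        by (simp add: duhamel_def scaleR_conv_of_real mult.assoc)
      ultimately show ?thesis by simp
    qed
    let ?v = "s0 / (16 * real N ^ e) * ((A * (\<delta> / 2)) ^ Suc k * \<gamma>)"
    have "c * A ^ Suc k / real N ^ e = (LINT \<xi>|m. indicator {1 - r..1 + r} \<xi> * ?v)"
      using ball_mass_eq[of 1 r] by (simp add: c_def power_mult_distrib power_divide mult_ac)
    also have "\<dots> \<le> (LINT \<xi>|m. - (indicator {1 - r..1 + r} \<xi> * Im (duhamel m t 1 k (wave a) t \<xi>)))"
    proof (rule integral_mono)
      show "integrable m (\<lambda>\<xi>. indicator {1 - r..1 + r} \<xi> * ?v)"
        by (intro integrable_mult_left integrable_indicator_cbox)
      let ?R = "A * (4 * \<delta> * (1 + (real K + 1)\<^sup>2))"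
      let ?Q = "\<bar>1\<bar> * t * (4 * weight_mass) ^ k * ?R ^ Suc k"
      have dec: "decays ?Q (duhamel m t 1 k (wave a) t)"
      proof (rule curve_decays[of ?Q "duhamel m t 1 k (wave a)" t])
        show "decaying_curve ?Q (duhamel m t 1 k (wave a))"
        proof (rule decaying_curveI)
          show "continuous_on UNIV (case_prod (duhamel m t 1 k (wave a)))"
            using duhamel_continuous[OF curve, of t 1 k] t by simp
          show "cmod (duhamel m t 1 k (wave a) \<tau> \<xi>) \<le> ?Q * weight \<xi>" for \<tau> \<xi>
            by (rule norm_duhamel_le[OF curve]) (use t in simp)
          show "hermitian (duhamel m t 1 k (wave a) \<tau>)" for \<tau>
            by (rule hermitian_duhamel[OF curve]) (use t in simp)
        qed
      qed (use t in simp)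
      show "integrable m (\<lambda>\<xi>. - (indicator {1 - r..1 + r} \<xi> * Im (duhamel m t 1 k (wave a) t \<xi>)))"
      proof (intro Bochner_Integration.integrable_minus integrable_dominated[OF integrable_norm[OF decays_integrable[OF dec]]])
        note decays_measurable[OF dec, measurable]
        show "(\<lambda>\<xi>. indicator {1 - r..1 + r} \<xi> * Im (duhamel m t 1 k (wave a) t \<xi>)) \<in> borel_measurable m"
          by (intro measurable_freq) measurable
        show "norm (indicator {1 - r..1 + r} \<xi> * Im (duhamel m t 1 k (wave a) t \<xi>)) \<le> norm (duhamel m t 1 k (wave a) t \<xi>)" for \<xi>
          using abs_Im_le_cmod by (auto simp: indicator_def)
      qed
      show "indicator {1 - r..1 + r} \<xi> * ?v \<le> - (indicator {1 - r..1 + r} \<xi> * Im (duhamel m t 1 k (wave a) t \<xi>))" for \<xi>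
        using pointwise[of \<xi>] by (auto simp: indicator_def)
    qed
    finally show "c * A ^ Suc k / real N ^ phase_exponent k \<le>
       - (LINT \<xi>|m. indicator {1 - r..1 + r} \<xi> *
           Im (duhamel m t 1 k (wave (\<lambda>\<xi>. A * packet \<delta> N (second_frequency k N) \<xi>)) t \<xi>))"
      by (simp add: a_def K_def e_def)
  qed
qed

end

section \<open>Taylor coefficients of differentiable maps\<close>

text \<open>Letting \<open>h\<close> tend to \<open>0\<close> removes the constant term; division by
  \<open>h\<close> then lowers the degree in the hypothesis.\<close>

lemma polynomial_eq_0_of_small:
  fixes c :: "nat \<Rightarrow> real"
  assumes "((\<lambda>h. (\<Sum>j\<le>n. c j * h ^ j) / h ^ n) \<longlongrightarrow> 0) (at_right 0)"
  shows "\<forall>j\<le>n. c j = 0"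
  using assms
proof (induction n arbitrary: c)
  case 0
  hence "((\<lambda>h::real. c 0) \<longlongrightarrow> 0) (at_right 0)" by simp
  thus ?case by (simp add: tendsto_const_iff)
next
  case (Suc n)
  have pos: "\<forall>\<^sub>F h in at_right (0::real). h > 0" by (rule eventually_at_right_less)
  have 1: "((\<lambda>h. (\<Sum>j\<le>Suc n. c j * h ^ j) / h ^ Suc n * h ^ Suc n) \<longlongrightarrow> 0 * 0 ^ Suc n) (at_right 0)"
    by (intro tendsto_mult Suc.prems tendsto_power tendsto_ident_at)
  have 2: "\<forall>\<^sub>F h in at_right 0. (\<Sum>j\<le>Suc n. c j * h ^ j) / h ^ Suc n * h ^ Suc n = (\<Sum>j\<le>Suc n. c j * h ^ j)"
    using pos by eventually_elim simp
  from Lim_transform_eventually[OF 1 2]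
  have lim0: "((\<lambda>h. \<Sum>j\<le>Suc n. c j * h ^ j) \<longlongrightarrow> 0) (at_right 0)" by simp
  have "((\<lambda>h. \<Sum>j\<le>Suc n. c j * h ^ j) \<longlongrightarrow> (\<Sum>j\<le>Suc n. c j * 0 ^ j)) (at_right 0)"
    by (intro tendsto_sum tendsto_mult tendsto_const tendsto_power tendsto_ident_at)
  from tendsto_unique[OF trivial_limit_at_right_real lim0 this]
  have "(\<Sum>j\<le>Suc n. c j * 0 ^ j) = 0" by simp
  moreover have "(\<Sum>j\<le>Suc n. c j * 0 ^ j) = c 0"
    by (subst sum.atMost_Suc_shift) simp
  ultimately have c0: "c 0 = 0" by simp
  have 3: "\<forall>\<^sub>F h in at_right 0. (\<Sum>j\<le>Suc n. c j * h ^ j) / h ^ Suc n = (\<Sum>j\<le>n. c (Suc j) * h ^ j) / h ^ n"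
    using pos
  proof eventually_elim
    case (elim h)
    have "(\<Sum>j\<le>Suc n. c j * h ^ j) = h * (\<Sum>j\<le>n. c (Suc j) * h ^ j)"
      by (subst sum.atMost_Suc_shift) (simp add: c0 sum_distrib_left mult_ac)
    thus ?case using elim by simp
  qed
  from Suc.IH[OF Lim_transform_eventually[OF Suc.prems 3]]
  have c1: "c (Suc j) = 0" if "j \<le> n" for j using that by simp
  show ?case
  proof (intro allI impI)
    fix j assume "j \<le> Suc n"
    thus "c j = 0" using c0 c1 by (cases j) auto
  qed
qed

text \<open>Uniqueness of the Taylor polynomial. The Lagrange remainder asks for \<open>G p\<close>
  near \<open>0\<close> and for its continuity at \<open>0\<close>, which is the information
  contained in \<open>frechet_Ck_at\<close>.\<close>

lemma taylor_remainder_small: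
  fixes G :: "nat \<Rightarrow> real \<Rightarrow> real"
  assumes \<rho>: "0 < \<rho>" and p: "0 < p"
    and deriv: "\<And>j x. j < p \<Longrightarrow> \<bar>x\<bar> < \<rho> \<Longrightarrow> (G j has_real_derivative G (Suc j) x) (at x)"
    and cont: "(G p \<longlongrightarrow> G p 0) (at_right 0)"
    and expand: "((\<lambda>h. (G 0 h - \<alpha> * h ^ p) / h ^ p) \<longlongrightarrow> 0) (at_right 0)"
  shows "G p 0 = fact p * \<alpha>"
proof -
  \<comment> \<open>The coefficients of the Taylor polynomial minus the monomial
    \<open>\<alpha> h^p\<close>.\<close>
  define c where "c j = (if j < p then G j 0 / fact j else G p 0 / fact p - \<alpha>)" for j
  have ev: "\<forall>\<^sub>F h in at_right (0::real). 0 < h \<and> h < \<rho>"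
    using \<rho> eventually_at_right_less[of 0] by (auto simp: eventually_at_right_field intro!: exI[of _ \<rho>])
  have "((\<lambda>h. (G 0 h - (\<Sum>j<p. G j 0 / fact j * h ^ j) - G p 0 / fact p * h ^ p) / h ^ p) \<longlongrightarrow> 0) (at_right 0)"
  proof (rule tendstoI)
    fix e :: real assume e: "e > 0"
    from tendstoD[OF cont e] obtain b where b: "b > 0" "\<And>y. 0 < y \<Longrightarrow> y < b \<Longrightarrow> dist (G p y) (G p 0) < e"
      by (auto simp: eventually_at_right_field)
    have ev2: "\<forall>\<^sub>F h in at_right (0::real). h < b"
      using b(1) by (auto simp: eventually_at_right_field intro!: exI[of _ b])
    from ev ev2 show "\<forall>\<^sub>F h in at_right 0. dist ((G 0 h - (\<Sum>j<p. G j 0 / fact j * h ^ j) - G p 0 / fact p * h ^ p) / h ^ p) 0 < e"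
    proof eventually_elim
      case (elim h)
      have "\<exists>\<theta>>0. \<theta> < h \<and> G 0 h = (\<Sum>j<p. G j 0 / fact j * h ^ j) + G p \<theta> / fact p * h ^ p"
        using elim p by (intro Maclaurin) (auto intro!: deriv)
      then obtain \<theta> where \<theta>: "0 < \<theta>" "\<theta> < h" "G 0 h = (\<Sum>j<p. G j 0 / fact j * h ^ j) + G p \<theta> / fact p * h ^ p" by blast
      have "(G 0 h - (\<Sum>j<p. G j 0 / fact j * h ^ j) - G p 0 / fact p * h ^ p) / h ^ p = (G p \<theta> - G p 0) / fact p"
        using elim by (simp add: \<theta>(3) diff_divide_distrib left_diff_distrib)
      moreover have "\<bar>(G p \<theta> - G p 0) / fact p\<bar> \<le> \<bar>G p \<theta> - G p 0\<bar>"
      proof -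
        have "\<bar>G p \<theta> - G p 0\<bar> / fact p \<le> \<bar>G p \<theta> - G p 0\<bar> / 1"
          by (intro divide_left_mono) (auto simp: fact_ge_1)
        thus ?thesis by (simp add: abs_divide)
      qed
      moreover have "\<bar>G p \<theta> - G p 0\<bar> < e" using b(2)[of \<theta>] \<theta> elim by (simp add: dist_real_def)
      ultimately show ?case by (simp add: dist_real_def)
    qed
  qed
  from tendsto_diff[OF expand this]
  have "((\<lambda>h. (G 0 h - \<alpha> * h ^ p) / h ^ p - (G 0 h - (\<Sum>j<p. G j 0 / fact j * h ^ j) - G p 0 / fact p * h ^ p) / h ^ p) \<longlongrightarrow> 0) (at_right 0)"
    by simp
  also have "(\<lambda>h. (G 0 h - \<alpha> * h ^ p) / h ^ p - (G 0 h - (\<Sum>j<p. G j 0 / fact j * h ^ j) - G p 0 / fact p * h ^ p) / h ^ p)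
    = (\<lambda>h. (\<Sum>j\<le>p. c j * h ^ j) / h ^ p)"
  proof
    fix h
    have "(\<Sum>j\<le>p. c j * h ^ j) = (\<Sum>j<p. G j 0 / fact j * h ^ j) + (G p 0 / fact p - \<alpha>) * h ^ p"
      by (simp add: lessThan_Suc_atMost[symmetric] c_def)
    thus "(G 0 h - \<alpha> * h ^ p) / h ^ p - (G 0 h - (\<Sum>j<p. G j 0 / fact j * h ^ j) - G p 0 / fact p * h ^ p) / h ^ p
       = (\<Sum>j\<le>p. c j * h ^ j) / h ^ p"
      by (simp add: diff_divide_distrib[symmetric] algebra_simps)
  qed
  finally have "c p = 0" using polynomial_eq_0_of_small by blast
  thus ?thesis by (simp add: c_def field_simps)
qed

lemma half_fraction_less:
  fixes e Z :: real
  assumes "0 < e" "0 \<le> Z"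
  shows "Z * (e / (2 * (Z + 1))) < e"
proof -
  have "Z * e < (2 * (Z + 1)) * e" using assms by (intro mult_strict_right_mono) auto
  thus ?thesis using assms by (simp add: pos_divide_less_eq mult.commute)
qed

text \<open>Along the ray through \<open>\<phi>\<close> the scalars
  \<open>l (D j (\<epsilon> \<phi>) (\<phi>, ..., \<phi>))\<close> are successive derivatives, so
  the coefficient is \<open>l (D p 0 (\<phi>, ..., \<phi>)) / p!\<close>. The bound \<open>B\<close>
  depends on the norms of \<open>l\<close> and \<open>D p 0\<close>, not on \<open>\<phi>\<close>.
  As \<open>l\<close> is bounded, it vanishes on vectors of seminorm zero, so identities that hold
  up to seminorm zero become exact under \<open>l\<close>.\<close>

lemma frechet_Ck_coefficient_bound:
  fixes X :: "'a::real_vector seminormed" and Y :: "'b::real_vector seminormed"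
  assumes Ck: "frechet_Ck_at p X Y F 0" and p: "0 < p"
    and X: "\<And>c x. x \<in> vecs X \<Longrightarrow> c *\<^sub>R x \<in> vecs X" "\<And>c x. x \<in> vecs X \<Longrightarrow> snorm X (c *\<^sub>R x) = \<bar>c\<bar> * snorm X x"
      "\<And>x. x \<in> vecs X \<Longrightarrow> 0 \<le> snorm X x"
    and Y: "\<And>c y. y \<in> vecs Y \<Longrightarrow> c *\<^sub>R y \<in> vecs Y" "\<And>x y. x \<in> vecs Y \<Longrightarrow> y \<in> vecs Y \<Longrightarrow> x + y \<in> vecs Y"
    and l: "\<And>c y. y \<in> vecs Y \<Longrightarrow> l (c *\<^sub>R y) = c * l y" "\<And>x y. x \<in> vecs Y \<Longrightarrow> y \<in> vecs Y \<Longrightarrow> l (x + y) = l x + l y"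
      "\<And>y. y \<in> vecs Y \<Longrightarrow> \<bar>l y\<bar> \<le> C * snorm Y y" and C: "0 \<le> C"
  obtains B where "\<And>\<phi> \<alpha>. \<phi> \<in> vecs X \<Longrightarrow> ((\<lambda>h. (l (F (h *\<^sub>R \<phi>)) - \<alpha> * h ^ p) / h ^ p) \<longlongrightarrow> 0) (at_right 0) \<Longrightarrow>
      \<bar>\<alpha>\<bar> \<le> B * snorm X \<phi> ^ p"
proof -
  have Ydiff: "x - y \<in> vecs Y" "l (x - y) = l x - l y" if "x \<in> vecs Y" "y \<in> vecs Y" for x y
    using Y(2)[OF that(1) Y(1)[OF that(2), of "-1"]] l(2)[OF that(1) Y(1)[OF that(2), of "-1"]] l(1)[OF that(2), of "-1"]
    by simp_all
  from Ck[unfolded frechet_Ck_at_def diff_0_right] obtain r D where r: "r > 0"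
    and D': "\<forall>x\<in>vecs X. snorm X x < r \<longrightarrow> D 0 x [] = F x \<and> (\<forall>j\<le>p. bounded_multilinear X Y j (D j x)) \<and>
           (\<forall>j<p. \<forall>\<epsilon>>0. \<exists>\<delta>>0. \<forall>h\<in>vecs X. snorm X h < \<delta> \<longrightarrow>
              opnorm_le X Y j (\<lambda>hs. D j (x + h) hs - D j x hs - D (Suc j) x (h # hs)) (\<epsilon> * snorm X h))"
    and Dc': "\<forall>\<epsilon>>0. \<exists>\<delta>>0. \<forall>x\<in>vecs X. snorm X x < \<delta> \<longrightarrow> opnorm_le X Y p (\<lambda>hs. D p x hs - D p 0 hs) \<epsilon>"
    by (elim exE conjE)
  note D = D'[rule_format] and Dc = Dc'[rule_format]
  obtain K where K: "\<And>\<phi>. \<phi> \<in> vecs X \<Longrightarrow> snorm Y (D p 0 (replicate p \<phi>)) \<le> K * snorm X \<phi> ^ p" and K0: "0 \<le> K"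
  proof (cases "vecs X = {}")
    case False
    then obtain x where "x \<in> vecs X" by blast
    from X(1)[OF this, of 0] X(2)[OF this, of 0] have z: "0 \<in> vecs X" "snorm X 0 = 0" by auto
    with D[of 0] r have "bounded_multilinear X Y p (D p 0)" by auto
    then obtain K where K: "opnorm_le X Y p (D p 0) K" unfolding bounded_multilinear_def by blast
    have "snorm Y (D p 0 (replicate p \<phi>)) \<le> \<bar>K\<bar> * snorm X \<phi> ^ p" if \<phi>: "\<phi> \<in> vecs X" for \<phi>
    proof -
      have "snorm Y (D p 0 (replicate p \<phi>)) \<le> K * snorm X \<phi> ^ p"
        using K[unfolded opnorm_le_def, rule_format, of "replicate p \<phi>"] \<phi> p
        by (simp add: prod_list_replicate)
      also have "\<dots> \<le> \<bar>K\<bar> * snorm X \<phi> ^ p" using X(3)[OF \<phi>] by (intro mult_right_mono) auto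
      finally show ?thesis .
    qed
    thus ?thesis using that[of "\<bar>K\<bar>"] by auto
  qed (use that[of 0] in auto)
  show ?thesis
  proof (rule that[of "C * K / fact p"])
    fix \<phi> \<alpha> assume \<phi>: "\<phi> \<in> vecs X"
      and lim: "((\<lambda>h. (l (F (h *\<^sub>R \<phi>)) - \<alpha> * h ^ p) / h ^ p) \<longlongrightarrow> 0) (at_right 0)"
    define n where "n = snorm X \<phi>"
    have n: "0 \<le> n" using X(3)[OF \<phi>] by (simp add: n_def)
    define G where "G j \<epsilon> = l (D j (\<epsilon> *\<^sub>R \<phi>) (replicate j \<phi>))" for j \<epsilon>
    \<comment> \<open>The \<open>+ 1\<close> covers a vector \<open>\<phi>\<close> of seminorm
      zero.\<close>
    define \<rho> where "\<rho> = r / (n + 1)"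
    have \<rho>: "\<rho> > 0" using r n by (simp add: \<rho>_def)
    have small: "\<epsilon> *\<^sub>R \<phi> \<in> vecs X" "snorm X (\<epsilon> *\<^sub>R \<phi>) = \<bar>\<epsilon>\<bar> * n" for \<epsilon>
      using X(1,2)[OF \<phi>] by (auto simp: n_def)
    have lt: "\<bar>\<epsilon>\<bar> * n < d" if "d > 0" "\<bar>\<epsilon>\<bar> < d / (n + 1)" for \<epsilon> d
    proof -
      have "\<bar>\<epsilon>\<bar> * n \<le> \<bar>\<epsilon>\<bar> * (n + 1)" by (intro mult_left_mono) auto
      also have "\<dots> < d" using that n by (simp add: field_simps)
      finally show ?thesis .
    qed
    note DD = D[OF small(1), unfolded small(2), OF lt[OF r], folded \<rho>_def]
    have bm: "bounded_multilinear X Y j (D j (\<epsilon> *\<^sub>R \<phi>))" if "j \<le> p" "\<bar>\<epsilon>\<bar> < \<rho>" for j \<epsilon>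
      using DD[OF that(2)] that(1) by blast
    have DY: "D j (\<epsilon> *\<^sub>R \<phi>) hs \<in> vecs Y"
      if "j \<le> p" "\<bar>\<epsilon>\<bar> < \<rho>" "length hs = j" "set hs \<subseteq> vecs X" for j \<epsilon> hs
      using bm[OF that(1,2), unfolded bounded_multilinear_def, THEN conjunct1, rule_format] that(3,4) by simp
    have G0: "G 0 \<epsilon> = l (F (\<epsilon> *\<^sub>R \<phi>))" if "\<bar>\<epsilon>\<bar> < \<rho>" for \<epsilon>
      using DD[OF that] by (simp add: G_def)
    have rep: "set (replicate j \<phi>) \<subseteq> vecs X" "prod_list (map (snorm X) (replicate j \<phi>)) = n ^ j" for j
      using \<phi> by (auto simp: n_def prod_list_replicate set_replicate_conv_if)
    have deriv: "(G j has_real_derivative G (Suc j) \<epsilon>) (at \<epsilon>)" if j: "j < p" and \<epsilon>: "\<bar>\<epsilon>\<bar> < \<rho>" for j \<epsilon>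
    proof -
      \<comment> \<open>Linearity in the first slot, valid up to seminorm zero, turns the increment
        \<open>h \<phi>\<close> into the factor \<open>h\<close>.\<close>
      have lin: "l (D (Suc j) (\<epsilon> *\<^sub>R \<phi>) ((h *\<^sub>R \<phi>) # replicate j \<phi>)) = h * G (Suc j) \<epsilon>" for h
      proof -
        have "bounded_multilinear X Y (Suc j) (D (Suc j) (\<epsilon> *\<^sub>R \<phi>))"
          using bm j \<epsilon> by simp
        from this[unfolded bounded_multilinear_def, THEN conjunct2, THEN conjunct1, rule_format,
            of "replicate (Suc j) \<phi>" 0 \<phi> \<phi> h 0]
        have "snorm Y (D (Suc j) (\<epsilon> *\<^sub>R \<phi>) ((replicate (Suc j) \<phi>)[0 := h *\<^sub>R \<phi> + 0 *\<^sub>R \<phi>]) -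
            (h *\<^sub>R D (Suc j) (\<epsilon> *\<^sub>R \<phi>) ((replicate (Suc j) \<phi>)[0 := \<phi>]) + 0 *\<^sub>R D (Suc j) (\<epsilon> *\<^sub>R \<phi>) ((replicate (Suc j) \<phi>)[0 := \<phi>]))) = 0"
          using rep(1)[of "Suc j"] \<phi> by (simp only: length_replicate)
        hence z: "snorm Y (D (Suc j) (\<epsilon> *\<^sub>R \<phi>) ((h *\<^sub>R \<phi>) # replicate j \<phi>) - h *\<^sub>R D (Suc j) (\<epsilon> *\<^sub>R \<phi>) (replicate (Suc j) \<phi>)) = 0"
          by simp
        have m1: "D (Suc j) (\<epsilon> *\<^sub>R \<phi>) ((h *\<^sub>R \<phi>) # replicate j \<phi>) \<in> vecs Y"
          by (rule DY) (use j \<epsilon> small(1) rep(1) in auto)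
        have m2: "D (Suc j) (\<epsilon> *\<^sub>R \<phi>) (replicate (Suc j) \<phi>) \<in> vecs Y"
          by (rule DY) (use j \<epsilon> rep(1)[of "Suc j"] in auto)
        from l(3)[OF Ydiff(1)[OF m1 Y(1)[OF m2, of h]]] z
        show ?thesis unfolding Ydiff(2)[OF m1 Y(1)[OF m2]] l(1)[OF m2] by (simp add: G_def)
      qed
      show ?thesis unfolding has_field_derivative_iff
      proof (rule LIM_I)
        fix e :: real assume e: "e > 0"
        \<comment> \<open>The error is multiplied by \<open>C\<close> for the functional, by
          \<open>n\<close> for the increment and by \<open>n^j\<close> for the remaining
          arguments.\<close>
        define e' where "e' = e / (2 * (C * n ^ Suc j + 1))"
        have Cn: "0 \<le> C * n ^ Suc j" using C n by simp
        have e': "e' > 0" using e Cn by (simp add: e'_def)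
        have e'2: "C * (e' * n ^ Suc j) < e" using half_fraction_less[OF e Cn] by (simp add: e'_def mult_ac)
        from DD[OF \<epsilon>, THEN conjunct2, THEN conjunct2, rule_format, OF j e']
        obtain d where d: "d > 0" "\<And>h. h \<in> vecs X \<Longrightarrow> snorm X h < d \<Longrightarrow>
              opnorm_le X Y j (\<lambda>hs. D j (\<epsilon> *\<^sub>R \<phi> + h) hs - D j (\<epsilon> *\<^sub>R \<phi>) hs - D (Suc j) (\<epsilon> *\<^sub>R \<phi>) (h # hs)) (e' * snorm X h)"
          by blast
        define s where "s = min (d / (n + 1)) (\<rho> - \<bar>\<epsilon>\<bar>)"
        have s: "s > 0" using d(1) n \<epsilon> by (simp add: s_def)
        show "\<exists>s>0. \<forall>x. x \<noteq> \<epsilon> \<and> norm (x - \<epsilon>) < s \<longrightarrow> norm ((G j x - G j \<epsilon>) / (x - \<epsilon>) - G (Suc j) \<epsilon>) < e"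
        proof (intro exI[of _ s] conjI s allI impI, elim conjE)
          fix x assume x: "x \<noteq> \<epsilon>" "norm (x - \<epsilon>) < s"
          define h where "h = x - \<epsilon>"
          have h: "h \<noteq> 0" "\<bar>h\<bar> < d / (n + 1)" "\<bar>x\<bar> < \<rho>" using x by (auto simp: h_def s_def)
          have xh: "\<epsilon> *\<^sub>R \<phi> + h *\<^sub>R \<phi> = x *\<^sub>R \<phi>" by (simp add: h_def scaleR_left_diff_distrib)
          let ?R = "replicate j \<phi>"
          let ?y = "D j (x *\<^sub>R \<phi>) ?R - D j (\<epsilon> *\<^sub>R \<phi>) ?R - D (Suc j) (\<epsilon> *\<^sub>R \<phi>) ((h *\<^sub>R \<phi>) # ?R)"
          have m: "D j (x *\<^sub>R \<phi>) ?R \<in> vecs Y" "D j (\<epsilon> *\<^sub>R \<phi>) ?R \<in> vecs Y"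
              "D (Suc j) (\<epsilon> *\<^sub>R \<phi>) ((h *\<^sub>R \<phi>) # ?R) \<in> vecs Y"
            by (rule DY; use j \<epsilon> h(3) rep(1)[of j] small(1) in auto)+
          have "opnorm_le X Y j (\<lambda>hs. D j (x *\<^sub>R \<phi>) hs - D j (\<epsilon> *\<^sub>R \<phi>) hs - D (Suc j) (\<epsilon> *\<^sub>R \<phi>) ((h *\<^sub>R \<phi>) # hs)) (e' * (\<bar>h\<bar> * n))"
            using d(2)[OF small(1)[of h]] lt[OF d(1) h(2)] unfolding small(2) xh by blast
          hence "snorm Y ?y \<le> e' * (\<bar>h\<bar> * n) * n ^ j"
            unfolding opnorm_le_def using rep[of j] by (metis length_replicate)
          hence "\<bar>l ?y\<bar> \<le> C * (e' * (\<bar>h\<bar> * n) * n ^ j)"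
            using l(3)[OF Ydiff(1)[OF Ydiff(1)[OF m(1,2)] m(3)]] C by (meson mult_left_mono order_trans)
          also have "\<dots> = C * (e' * n ^ Suc j) * \<bar>h\<bar>" by (simp add: mult_ac)
          also have "\<dots> < e * \<bar>h\<bar>" using h(1) e'2 by (intro mult_strict_right_mono) auto
          also have "l ?y = G j x - G j \<epsilon> - h * G (Suc j) \<epsilon>"
            using Ydiff(2)[OF Ydiff(1)[OF m(1,2)] m(3)] Ydiff(2)[OF m(1,2)] lin[of h] by (simp add: G_def)
          finally have "\<bar>G j x - G j \<epsilon> - h * G (Suc j) \<epsilon>\<bar> / \<bar>h\<bar> < e" using h(1) by (simp add: pos_divide_less_eq)
          moreover have "(G j x - G j \<epsilon>) / h - G (Suc j) \<epsilon> = (G j x - G j \<epsilon> - h * G (Suc j) \<epsilon>) / h"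
            using h(1) by (simp add: field_simps)
          ultimately show "norm ((G j x - G j \<epsilon>) / (x - \<epsilon>) - G (Suc j) \<epsilon>) < e"
            by (simp add: h_def[symmetric] abs_divide)
        qed
      qed
    qed
    have ev: "\<forall>\<^sub>F h in at_right (0::real). 0 < h \<and> h < \<rho>"
      using \<rho> by (auto simp: eventually_at_right_field intro!: exI[of _ \<rho>])
    have cont: "(G p \<longlongrightarrow> G p 0) (at_right 0)"
    proof (rule tendstoI)
      fix e :: real assume e: "e > 0"
      define e' where "e' = e / (2 * (C * n ^ p + 1))"
      have Cn: "0 \<le> C * n ^ p" using C n by simp
      have e': "e' > 0" using e Cn by (simp add: e'_def)
      have e'2: "C * (e' * n ^ p) < e" using half_fraction_less[OF e Cn] by (simp add: e'_def mult_ac)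
      from Dc[OF e'] obtain d where d: "d > 0" "\<And>x. x \<in> vecs X \<Longrightarrow> snorm X x < d \<Longrightarrow> opnorm_le X Y p (\<lambda>hs. D p x hs - D p 0 hs) e'"
        by blast
      have "\<forall>\<^sub>F h in at_right (0::real). h < d / (n + 1)"
        using d(1) n by (auto simp: eventually_at_right_field intro!: exI[of _ "d / (n + 1)"])
      with ev show "\<forall>\<^sub>F h in at_right 0. dist (G p h) (G p 0) < e"
      proof eventually_elim
        case (elim h)
        let ?R = "replicate p \<phi>"
        have m: "D p (h *\<^sub>R \<phi>) ?R \<in> vecs Y" by (rule DY) (use elim rep(1)[of p] in auto)
        have m0: "D p (0 *\<^sub>R \<phi>) ?R \<in> vecs Y" by (rule DY) (use \<rho> rep(1)[of p] in auto)
        have "opnorm_le X Y p (\<lambda>hs. D p (h *\<^sub>R \<phi>) hs - D p 0 hs) e'"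
          using d(2)[OF small(1)[of h]] lt[OF d(1), of h] elim unfolding small(2) by auto
        hence "snorm Y (D p (h *\<^sub>R \<phi>) ?R - D p 0 ?R) \<le> e' * n ^ p"
          unfolding opnorm_le_def using rep[of p] by (metis length_replicate)
        hence "\<bar>l (D p (h *\<^sub>R \<phi>) ?R - D p 0 ?R)\<bar> \<le> C * (e' * n ^ p)"
          using l(3)[OF Ydiff(1)[OF m m0]] C by (simp, meson mult_left_mono order_trans)
        also have "\<dots> < e" by (rule e'2)
        finally show ?case using Ydiff(2)[OF m m0] by (simp add: G_def dist_real_def)
      qed
    qed
    have "((\<lambda>h. (G 0 h - \<alpha> * h ^ p) / h ^ p) \<longlongrightarrow> 0) (at_right 0)"
    proof (rule Lim_transform_eventually[OF lim])
      show "\<forall>\<^sub>F h in at_right 0. (l (F (h *\<^sub>R \<phi>)) - \<alpha> * h ^ p) / h ^ p = (G 0 h - \<alpha> * h ^ p) / h ^ p"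
        using ev by eventually_elim (simp add: G0)
    qed
    from taylor_remainder_small[OF \<rho> p deriv cont this]
    have "fact p * \<alpha> = l (D p 0 (replicate p \<phi>))" by (simp add: G_def)
    hence "fact p * \<bar>\<alpha>\<bar> = \<bar>l (D p 0 (replicate p \<phi>))\<bar>" by (simp add: abs_mult flip: \<open>fact p * \<alpha> = _\<close>)
    moreover have "D p (0 *\<^sub>R \<phi>) (replicate p \<phi>) \<in> vecs Y" by (rule DY) (use \<rho> rep(1)[of p] in auto)
    hence "\<bar>l (D p 0 (replicate p \<phi>))\<bar> \<le> C * (K * n ^ p)"
      using l(3)[of "D p 0 (replicate p \<phi>)"] mult_left_mono[OF K[OF \<phi>] C] by (simp add: n_def)
    ultimately have le: "fact p * \<bar>\<alpha>\<bar> \<le> C * (K * n ^ p)" by simp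
    have "\<bar>\<alpha>\<bar> = (fact p * \<bar>\<alpha>\<bar>) / fact p" by simp
    also have "\<dots> \<le> (C * (K * n ^ p)) / fact p" by (rule divide_right_mono[OF le]) simp
    also have "\<dots> = C * K / fact p * n ^ p" by simp
    finally show "\<bar>\<alpha>\<bar> \<le> C * K / fact p * snorm X \<phi> ^ p" by (simp only: n_def)
  qed
qed

section \<open>Sobolev spaces and solutions\<close>

text \<open>Recovers the Cauchy-Schwarz form from Young's inequality at all scales:
  \<open>q = b\<close> is the right scale, and small \<open>q\<close> settles
  \<open>b = 0\<close>.\<close>

lemma le_mult_of_all_scales:
  fixes x a b c :: real
  assumes "\<And>q. q > 0 \<Longrightarrow> x \<le> q * a + b\<^sup>2 / q * c" and "0 \<le> a" "0 \<le> b"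
  shows "x \<le> (a + c) * b"
proof (cases "b = 0")
  case False
  thus ?thesis using assms(1)[of b] assms(3) by (simp add: power2_eq_square algebra_simps)
next
  case True
  have "x \<le> 0 + e" if "e > 0" for e
  proof -
    have "e / (a + 1) * a \<le> e" using that assms(2) by (simp add: field_simps)
    thus ?thesis using assms(1)[of "e / (a + 1)"] that assms(2) True by simp
  qed
  hence "x \<le> 0" by (rule field_le_epsilon)
  thus ?thesis using True by simp
qed

text \<open>A window is used instead of a point value because elements of a Sobolev space on the
  line are determined only up to null sets.\<close>

definition window_functional :: "real measure \<Rightarrow> real \<Rightarrow> (real \<Rightarrow> complex) \<Rightarrow> real" where
  "window_functional m r g = (LINT \<xi>|m. indicator {1 - r..1 + r} \<xi> * Im (g \<xi>))"

context frequency_measure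
begin

text \<open>The window lies in \<open>[0, 2]\<close>, where \<open>1 + \<xi>^2\<close> is between
  \<open>1\<close> and \<open>5\<close>; hence \<open>(1 + \<xi>^2) powr s\<close> is at least
  \<open>5 powr (- \<bar>s\<bar>)\<close> for either sign of \<open>s\<close>. Young's inequality
  with a free scale \<open>q\<close> then gives the norm.\<close>

lemma window_functional_bound:
  assumes g: "g \<in> borel_measurable m" "integrable m (\<lambda>\<xi>. (1 + \<xi>\<^sup>2) powr s * (cmod (g \<xi>))\<^sup>2)"
    and r: "0 < r" "r \<le> 1"
  shows "integrable m (\<lambda>\<xi>. indicator {1 - r..1 + r} \<xi> * Im (g \<xi>))"
    and "\<bar>window_functional m r g\<bar> \<le> (ball_mass r / 2 + 5 powr \<bar>s\<bar> / 2) * sqrt (LINT \<xi>|m. (1 + \<xi>\<^sup>2) powr s * (cmod (g \<xi>))\<^sup>2)"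
proof -
  let ?I = "\<lambda>\<xi>. indicator {1 - r..1 + r} \<xi> :: real"
  let ?w = "\<lambda>\<xi>. (1 + \<xi>\<^sup>2) powr s * (cmod (g \<xi>))\<^sup>2"
  have pt: "\<bar>?I \<xi> * Im (g \<xi>)\<bar> \<le> q / 2 * ?I \<xi> + 1 / (2 * q) * (5 powr \<bar>s\<bar> * ?w \<xi>)" if q: "q > 0" for q \<xi> :: real
  proof (cases "\<xi> \<in> {1 - r..1 + r}")
    case False
    thus ?thesis using q by simp
  next
    case True
    have "\<bar>\<xi>\<bar> \<le> 2" using True r by auto
    hence "\<xi>\<^sup>2 \<le> 2\<^sup>2" using abs_le_square_iff[of \<xi> 2] by simp
    hence b: "1 \<le> 1 + \<xi>\<^sup>2" "1 + \<xi>\<^sup>2 \<le> 5" by auto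
    have "1 \<le> 5 powr \<bar>s\<bar> * (1 + \<xi>\<^sup>2) powr s"
    proof (cases "s \<ge> 0")
      case True
      have "1 * 1 \<le> 5 powr \<bar>s\<bar> * (1 + \<xi>\<^sup>2) powr s"
        by (intro mult_mono ge_one_powr_ge_zero) (use True b in auto)
      thus ?thesis by simp
    next
      case False
      have "1 = 5 powr \<bar>s\<bar> * 5 powr s" using False by (simp add: powr_minus)
      also have "\<dots> \<le> 5 powr \<bar>s\<bar> * (1 + \<xi>\<^sup>2) powr s"
        by (intro mult_left_mono powr_mono2') (use False b less_le_trans[OF zero_less_one b(1)] in auto)
      finally show ?thesis .
    qed
    from mult_right_mono[OF this, of "(cmod (g \<xi>))\<^sup>2"]
    have sq: "(cmod (g \<xi>))\<^sup>2 \<le> 5 powr \<bar>s\<bar> * ?w \<xi>" by (simp add: mult.assoc)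
    have "0 \<le> (cmod (g \<xi>) - q)\<^sup>2" by simp
    hence "2 * q * cmod (g \<xi>) \<le> q * q + (cmod (g \<xi>))\<^sup>2" by (simp add: power2_eq_square algebra_simps)
    hence "cmod (g \<xi>) \<le> (q * q + (cmod (g \<xi>))\<^sup>2) / (2 * q)" using q by (simp add: pos_le_divide_eq mult_ac)
    also have "\<dots> = q / 2 + 1 / (2 * q) * (cmod (g \<xi>))\<^sup>2" using q by (simp add: add_divide_distrib)
    also have "\<dots> \<le> q / 2 + 1 / (2 * q) * (5 powr \<bar>s\<bar> * ?w \<xi>)"
      using q by (intro add_left_mono mult_left_mono sq) auto
    finally show ?thesis using True abs_Im_le_cmod[of "g \<xi>"] by simp
  qed
  have i2: "integrable m (\<lambda>\<xi>. q / 2 * ?I \<xi> + 1 / (2 * q) * (5 powr \<bar>s\<bar> * ?w \<xi>))" for q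
    using g(2) integrable_indicator_cbox by simp
  have "?I \<in> borel_measurable m" by (intro measurable_freq) simp
  hence meas: "(\<lambda>\<xi>. ?I \<xi> * Im (g \<xi>)) \<in> borel_measurable m" using g(1) by simp
  show int: "integrable m (\<lambda>\<xi>. ?I \<xi> * Im (g \<xi>))"
    by (rule integrable_dominated[OF i2[of 1] meas]) (use pt[of 1] in simp)
  let ?S = "LINT \<xi>|m. ?w \<xi>"
  have S0: "0 \<le> ?S" by simp
  show "\<bar>window_functional m r g\<bar> \<le> (ball_mass r / 2 + 5 powr \<bar>s\<bar> / 2) * sqrt ?S"
  proof (rule le_mult_of_all_scales)
    fix q :: real assume q: "q > 0"
    have "norm (window_functional m r g) \<le> (LINT \<xi>|m. q / 2 * ?I \<xi> + 1 / (2 * q) * (5 powr \<bar>s\<bar> * ?w \<xi>))"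
      unfolding window_functional_def
      by (rule Bochner_Integration.integral_norm_bound_integral[OF int i2]) (use pt[OF q] in simp)
    also have "\<dots> = (LINT \<xi>|m. q / 2 * ?I \<xi>) + (LINT \<xi>|m. 1 / (2 * q) * (5 powr \<bar>s\<bar> * ?w \<xi>))"
      by (rule Bochner_Integration.integral_add) (use g(2) integrable_indicator_cbox in simp_all)
    also have "(LINT \<xi>|m. q / 2 * ?I \<xi>) = q / 2 * (LINT \<xi>|m. ?I \<xi>)" by (rule integral_mult_right_zero)
    also have "(LINT \<xi>|m. ?I \<xi>) = ball_mass r" by (rule ball_mass_eq) simp
    also have "(LINT \<xi>|m. 1 / (2 * q) * (5 powr \<bar>s\<bar> * ?w \<xi>)) = 1 / (2 * q) * (5 powr \<bar>s\<bar> * ?S)" by simp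
    finally show "\<bar>window_functional m r g\<bar> \<le> q * (ball_mass r / 2) + (sqrt ?S)\<^sup>2 / q * (5 powr \<bar>s\<bar> / 2)"
      using S0 q by (simp add: mult_ac real_norm_def)
  qed (use ball_mass_pos[OF r(1)] S0 in auto)
qed

lemma decays_window_functional:
  assumes "decays R g"
  shows "integrable m (\<lambda>\<xi>. indicator {1 - r..1 + r} \<xi> * Im (g \<xi>))"
    and "\<bar>window_functional m r g\<bar> \<le> R * weight_mass"
proof -
  note decays_measurable[OF assms, measurable]
  have bd: "norm (indicator {1 - r..1 + r} \<xi> * Im (g \<xi>)) \<le> R * weight \<xi>" for \<xi>
    using order_trans[OF abs_Im_le_cmod decays_le[OF assms], of \<xi>] decays_nonneg[OF assms]
    by (auto simp: indicator_def)
  have i: "integrable m (\<lambda>\<xi>. R * weight \<xi>)" by (intro integrable_mult_right integrable_weight)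
  show int: "integrable m (\<lambda>\<xi>. indicator {1 - r..1 + r} \<xi> * Im (g \<xi>))"
  proof (rule integrable_dominated[OF i _ bd])
    show "(\<lambda>\<xi>. indicator {1 - r..1 + r} \<xi> * Im (g \<xi>)) \<in> borel_measurable m"
      by (intro measurable_freq) measurable
  qed
  have "norm (window_functional m r g) \<le> (LINT \<xi>|m. R * weight \<xi>)"
    unfolding window_functional_def by (rule Bochner_Integration.integral_norm_bound_integral[OF int i bd])
  also have "\<dots> = R * (LINT \<xi>|m. weight \<xi>)" by simp
  also have "\<dots> \<le> R * weight_mass" by (intro mult_left_mono integral_weight_le decays_nonneg[OF assms])
  finally show "\<bar>window_functional m r g\<bar> \<le> R * weight_mass" by simp
qed

end

section \<open>Sobolev spaces as seminormed spaces\<close>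

lemma sobolev_vecs_iff:
  "a \<in> vecs (sobolev M s) \<longleftrightarrow> a \<in> borel_measurable (freq_measure M) \<and>
     (AE \<xi> in freq_measure M. a (- \<xi>) = cnj (a \<xi>)) \<and>
     integrable (freq_measure M) (\<lambda>\<xi>. (1 + \<xi>\<^sup>2) powr s * (cmod (a \<xi>))\<^sup>2)"
  by (simp add: sobolev_def)

lemma sobolev_snorm: "snorm (sobolev M s) a = sqrt (LINT \<xi>|freq_measure M. (1 + \<xi>\<^sup>2) powr s * (cmod (a \<xi>))\<^sup>2)"
  by (simp add: sobolev_def)

lemma sobolev_scaleR:
  assumes "a \<in> vecs (sobolev M s)"
  shows "c *\<^sub>R a \<in> vecs (sobolev M s)" "snorm (sobolev M s) (c *\<^sub>R a) = \<bar>c\<bar> * snorm (sobolev M s) a"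
proof -
  have eq: "(1 + \<xi>\<^sup>2) powr s * (cmod ((c *\<^sub>R a) \<xi>))\<^sup>2 = c\<^sup>2 * ((1 + \<xi>\<^sup>2) powr s * (cmod (a \<xi>))\<^sup>2)" for \<xi>
    by (simp add: scaleR_fun_def power_mult_distrib)
  have ae: "AE \<xi> in freq_measure M. (c *\<^sub>R a) (- \<xi>) = cnj ((c *\<^sub>R a) \<xi>)"
    using assms unfolding sobolev_vecs_iff scaleR_fun_def by (elim conjE AE_mp) simp
  have "(c *\<^sub>R a) \<in> borel_measurable (freq_measure M)"
    using assms unfolding sobolev_vecs_iff scaleR_fun_def by (auto intro: borel_measurable_scaleR)
  with ae show "c *\<^sub>R a \<in> vecs (sobolev M s)"
    using assms unfolding sobolev_vecs_iff eq by simp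
  show "snorm (sobolev M s) (c *\<^sub>R a) = \<bar>c\<bar> * snorm (sobolev M s) a"
    unfolding sobolev_snorm eq by (simp add: real_sqrt_mult)
qed

lemma sobolev_add:
  assumes "a \<in> vecs (sobolev M s)" "b \<in> vecs (sobolev M s)"
  shows "a + b \<in> vecs (sobolev M s)"
  unfolding sobolev_vecs_iff
proof (intro conjI)
  show m: "a + b \<in> borel_measurable (freq_measure M)"
    using assms unfolding sobolev_vecs_iff plus_fun_def by (auto intro: borel_measurable_add)
  show "AE \<xi> in freq_measure M. (a + b) (- \<xi>) = cnj ((a + b) \<xi>)"
  proof -
    have "AE \<xi> in freq_measure M. a (- \<xi>) = cnj (a \<xi>)" "AE \<xi> in freq_measure M. b (- \<xi>) = cnj (b \<xi>)"
      using assms by (auto simp: sobolev_vecs_iff)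
    thus ?thesis by eventually_elim simp
  qed
  obtain C where "frequency_measure (freq_measure M) C" using frequency_measure_freq_measure by blast
  then interpret frequency_measure "freq_measure M" C .
  have [measurable]: "(\<lambda>\<xi>. (1 + \<xi>\<^sup>2) powr s) \<in> borel_measurable (freq_measure M)"
    by (intro measurable_freq) measurable
  note m[measurable]
  show "integrable (freq_measure M) (\<lambda>\<xi>. (1 + \<xi>\<^sup>2) powr s * (cmod ((a + b) \<xi>))\<^sup>2)"
  proof (rule integrable_dominated)
    show "integrable (freq_measure M) (\<lambda>\<xi>. 2 * ((1 + \<xi>\<^sup>2) powr s * (cmod (a \<xi>))\<^sup>2) + 2 * ((1 + \<xi>\<^sup>2) powr s * (cmod (b \<xi>))\<^sup>2))"
      using assms unfolding sobolev_vecs_iff by simp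
    show "norm ((1 + \<xi>\<^sup>2) powr s * (cmod ((a + b) \<xi>))\<^sup>2)
      \<le> 2 * ((1 + \<xi>\<^sup>2) powr s * (cmod (a \<xi>))\<^sup>2) + 2 * ((1 + \<xi>\<^sup>2) powr s * (cmod (b \<xi>))\<^sup>2)" for \<xi>
    proof -
      have "(cmod (a \<xi> + b \<xi>))\<^sup>2 \<le> (cmod (a \<xi>) + cmod (b \<xi>))\<^sup>2"
        by (intro power_mono norm_triangle_ineq) simp
      also have "\<dots> \<le> 2 * (cmod (a \<xi>))\<^sup>2 + 2 * (cmod (b \<xi>))\<^sup>2"
      proof -
        have "0 \<le> (cmod (a \<xi>) - cmod (b \<xi>))\<^sup>2" by simp
        thus ?thesis by (simp add: power2_eq_square algebra_simps)
      qed
      finally have "(1 + \<xi>\<^sup>2) powr s * (cmod (a \<xi> + b \<xi>))\<^sup>2 \<le> (1 + \<xi>\<^sup>2) powr s * (2 * (cmod (a \<xi>))\<^sup>2 + 2 * (cmod (b \<xi>))\<^sup>2)"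
        by (rule mult_left_mono) simp
      thus ?thesis by (simp add: algebra_simps)
    qed
  qed measurable
qed

lemma sobolev_memI:
  assumes "b \<in> borel_measurable borel" "hermitian b" "integrable (freq_measure M) g"
    and "\<And>\<xi>. (1 + \<xi>\<^sup>2) powr s * (cmod (b \<xi>))\<^sup>2 \<le> g \<xi>"
  shows "b \<in> vecs (sobolev M s)" "(snorm (sobolev M s) b)\<^sup>2 \<le> (LINT \<xi>|freq_measure M. g \<xi>)"
proof -
  obtain C where "frequency_measure (freq_measure M) C" using frequency_measure_freq_measure by blast
  then interpret frequency_measure "freq_measure M" C .
  have i: "integrable (freq_measure M) (\<lambda>\<xi>. (1 + \<xi>\<^sup>2) powr s * (cmod (b \<xi>))\<^sup>2)"
  proof (rule integrable_dominated[OF assms(3)])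
    note assms(1)[measurable]
    show "(\<lambda>\<xi>. (1 + \<xi>\<^sup>2) powr s * (cmod (b \<xi>))\<^sup>2) \<in> borel_measurable (freq_measure M)"
      by (intro measurable_freq) measurable
  qed (use assms(4) in simp)
  show "b \<in> vecs (sobolev M s)"
    unfolding sobolev_vecs_iff using i measurable_freq[OF assms(1)] assms(2) by (simp add: hermitian_def)
  show "(snorm (sobolev M s) b)\<^sup>2 \<le> (LINT \<xi>|freq_measure M. g \<xi>)"
    unfolding sobolev_snorm using integral_mono[OF i assms(3,4)] by simp
qed

lemma weight_eq_powr: "(1 + \<xi>\<^sup>2) powr 1 * (weight \<xi>)\<^sup>2 = weight \<xi>"
proof -
  have "(0::real) < 1 + \<xi>\<^sup>2" by (simp add: add_pos_nonneg)
  thus ?thesis by (simp add: weight_def power2_eq_square)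
qed

text \<open>\<open>(1 + \<xi>^2) weight^2 = weight\<close> is integrable. Order \<open>1\<close>
  exceeds \<open>1/2\<close>, so such curves fall under the requirement on \<open>S\<close> in
  \<open>flow_map\<close>.\<close>

lemma decays_sobolev_1:
  assumes "decays R a" "hermitian a"
  shows "a \<in> vecs (sobolev M 1)"
proof -
  obtain C where "frequency_measure (freq_measure M) C" using frequency_measure_freq_measure by blast
  then interpret frequency_measure "freq_measure M" C .
  show ?thesis
  proof (rule sobolev_memI(1)[OF decays_measurable[OF assms(1)] assms(2)])
    show "integrable (freq_measure M) (\<lambda>\<xi>. R\<^sup>2 * weight \<xi>)" by (intro integrable_mult_right integrable_weight)
    show "(1 + \<xi>\<^sup>2) powr 1 * (cmod (a \<xi>))\<^sup>2 \<le> R\<^sup>2 * weight \<xi>" for \<xi>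
    proof -
      have "(1 + \<xi>\<^sup>2) powr 1 * (cmod (a \<xi>))\<^sup>2 \<le> (1 + \<xi>\<^sup>2) powr 1 * (R * weight \<xi>)\<^sup>2"
        by (intro mult_left_mono power_mono decays_le[OF assms(1)]) auto
      also have "\<dots> = R\<^sup>2 * weight \<xi>" using weight_eq_powr[of \<xi>] by (simp add: power_mult_distrib mult_ac)
      finally show ?thesis .
    qed
  qed
qed

section \<open>Data of travelling waves, and fixed points as solutions\<close>

definition wave_data :: "(real \<Rightarrow> real) \<Rightarrow> (real \<Rightarrow> complex) \<times> (real \<Rightarrow> complex)" where
  "wave_data a = (\<lambda>\<xi>. complex_of_real (a \<xi>), \<lambda>\<xi>. - \<i> * complex_of_real (phase \<xi> * a \<xi>))"

lemma wave_data_scaleR: "c *\<^sub>R wave_data a = wave_data (\<lambda>\<xi>. c * a \<xi>)"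
  by (simp add: wave_data_def scaleR_prod_def scaleR_fun_def scaleR_conv_of_real mult_ac)

text \<open>The initial velocity is the time derivative of \<open>wave a\<close> at
  \<open>0\<close>, so one of the two exponentials in the linear flow drops out at each frequency.
  At \<open>\<xi> = 0\<close> the second datum vanishes and both sides are constant in time.\<close>

lemma lin_flow_wave_data: "lin_flow (wave_data a) \<tau> \<xi> = wave a \<tau> \<xi>"
proof -
  consider "\<xi> = 0" | "\<xi> > 0" | "\<xi> < 0" by linarith
  thus ?thesis
  proof cases
    case 1
    thus ?thesis by (simp add: lin_flow_def wave_data_def wave_def phase_def dispersion_eq)
  next
    case 2
    hence "phase \<xi> = dispersion \<xi>" "dispersion \<xi> \<noteq> 0" by (simp_all add: phase_eq dispersion_eq_0_iff)
    thus ?thesis by (simp add: lin_flow_def wave_data_def wave_def complex_eq_iff)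
  next
    case 3
    hence "phase \<xi> = - dispersion \<xi>" "dispersion \<xi> \<noteq> 0" by (simp_all add: phase_eq dispersion_eq_0_iff)
    thus ?thesis by (simp add: lin_flow_def wave_data_def wave_def complex_eq_iff)
  qed
qed

text \<open>\<open>\<bar>phase \<xi>\<bar> \<le> 1 + \<xi>^2\<close>: the multiplier has order two,
  exactly the gap between the two data spaces.\<close>

lemma wave_data_second_le:
  "(1 + \<xi>\<^sup>2) powr (s - 2) * (cmod (- \<i> * complex_of_real (phase \<xi> * a \<xi>)))\<^sup>2 \<le> (1 + \<xi>\<^sup>2) powr s * (a \<xi>)\<^sup>2"
proof -
  have p: "(0::real) < 1 + \<xi>\<^sup>2" by (simp add: add_pos_nonneg)
  have "(phase \<xi>)\<^sup>2 = \<xi>\<^sup>2 * (1 + \<xi>\<^sup>2)" using p by (simp add: phase_def power_mult_distrib)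
  also have "\<dots> \<le> (1 + \<xi>\<^sup>2) * (1 + \<xi>\<^sup>2)" using p by (intro mult_right_mono) auto
  also have "\<dots> = (1 + \<xi>\<^sup>2) powr 2" using p by (simp add: powr_numeral power2_eq_square)
  finally have "(1 + \<xi>\<^sup>2) powr (s - 2) * (phase \<xi>)\<^sup>2 \<le> (1 + \<xi>\<^sup>2) powr (s - 2) * (1 + \<xi>\<^sup>2) powr 2"
    by (rule mult_left_mono) simp
  also have "\<dots> = (1 + \<xi>\<^sup>2) powr s" by (simp only: powr_add[symmetric]) simp
  finally have "(1 + \<xi>\<^sup>2) powr (s - 2) * (phase \<xi>)\<^sup>2 * (a \<xi>)\<^sup>2 \<le> (1 + \<xi>\<^sup>2) powr s * (a \<xi>)\<^sup>2"
    by (rule mult_right_mono) simp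
  thus ?thesis by (simp add: norm_mult power_mult_distrib mult.assoc)
qed

lemma wave_data_mem:
  assumes a: "continuous_on UNIV a" "\<And>\<xi>. a (- \<xi>) = a \<xi>"
    and g: "integrable (freq_measure M) g" "\<And>\<xi>. (1 + \<xi>\<^sup>2) powr s * (a \<xi>)\<^sup>2 \<le> g \<xi>"
  shows "wave_data a \<in> vecs (sobolev_data M s)"
    and "snorm (sobolev_data M s) (wave_data a) \<le> sqrt (2 * (LINT \<xi>|freq_measure M. g \<xi>))"
proof -
  let ?b = "\<lambda>\<xi>. - \<i> * complex_of_real (phase \<xi> * a \<xi>)"
  have m0: "(\<lambda>\<xi>. complex_of_real (a \<xi>)) \<in> borel_measurable borel"
    by (intro borel_measurable_continuous_onI continuous_intros a(1))
  have m1: "?b \<in> borel_measurable borel"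
    by (intro borel_measurable_continuous_onI continuous_intros a(1))
  have h0: "hermitian (\<lambda>\<xi>. complex_of_real (a \<xi>))" "hermitian ?b"
    using a(2) by (simp_all add: hermitian_def)
  have g0: "(1 + \<xi>\<^sup>2) powr s * (cmod (complex_of_real (a \<xi>)))\<^sup>2 \<le> g \<xi>" for \<xi> using g(2) by simp
  have g1: "(1 + \<xi>\<^sup>2) powr (s - 2) * (cmod (?b \<xi>))\<^sup>2 \<le> g \<xi>" for \<xi>
    using order_trans[OF wave_data_second_le g(2)] .
  note 0 = sobolev_memI[OF m0 h0(1) g(1) g0] and 1 = sobolev_memI[OF m1 h0(2) g(1) g1]
  show "wave_data a \<in> vecs (sobolev_data M s)"
    using 0(1) 1(1) by (simp add: wave_data_def sobolev_data_def prod_seminormed_def)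
  show "snorm (sobolev_data M s) (wave_data a) \<le> sqrt (2 * (LINT \<xi>|freq_measure M. g \<xi>))"
    using 0(2) 1(2) by (simp add: wave_data_def sobolev_data_def prod_seminormed_def)
qed

lemma sobolev_data_scaleR:
  assumes "d \<in> vecs (sobolev_data M s)"
  shows "c *\<^sub>R d \<in> vecs (sobolev_data M s)" "snorm (sobolev_data M s) (c *\<^sub>R d) = \<bar>c\<bar> * snorm (sobolev_data M s) d"
proof -
  obtain a b where d: "d = (a, b)" by (cases d)
  have a: "a \<in> vecs (sobolev M s)" and b: "b \<in> vecs (sobolev M (s - 2))"
    using assms by (auto simp: d sobolev_data_def prod_seminormed_def)
  show "c *\<^sub>R d \<in> vecs (sobolev_data M s)"
    using sobolev_scaleR(1)[OF a] sobolev_scaleR(1)[OF b] by (simp add: d sobolev_data_def prod_seminormed_def)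
  have "(\<bar>c\<bar> * x)\<^sup>2 + (\<bar>c\<bar> * y)\<^sup>2 = c\<^sup>2 * (x\<^sup>2 + y\<^sup>2)" for x y :: real
    by (simp add: power_mult_distrib algebra_simps)
  thus "snorm (sobolev_data M s) (c *\<^sub>R d) = \<bar>c\<bar> * snorm (sobolev_data M s) d"
    using sobolev_scaleR(2)[OF a] sobolev_scaleR(2)[OF b]
    by (simp add: d sobolev_data_def prod_seminormed_def real_sqrt_mult)
qed

lemma sobolev_data_snorm_nonneg: "0 \<le> snorm (sobolev_data M s) d"
  by (cases d) (simp add: sobolev_data_def prod_seminormed_def)

text \<open>Passes from the fixed point on all times to the integral equation on
  \<open>{0..T}\<close>, with \<open>\<kappa>\<close> fixed by \<open>fourier_power\<close> and by
  the sign \<open>\<sigma>\<close>.\<close>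

lemma duhamel_solution_of_fixed_point:
  fixes \<sigma> :: real
  assumes L: "decays \<rho> (\<lambda>\<xi>. complex_of_real (a \<xi>))" "\<And>\<xi>. a (- \<xi>) = a \<xi>"
    and v: "decaying_curve R v" and T: "0 \<le> T" and k: "k \<ge> 1"
    and f: "f = (\<lambda>x. \<sigma> * x ^ Suc k)"
    and eq: "\<And>\<tau> \<xi>. v \<tau> \<xi> = wave a \<tau> \<xi> + duhamel (freq_measure M) T (\<sigma> / (2 * pi) ^ k) k v \<tau> \<xi>"
  shows "duhamel_solution M f 1 T (wave_data a) v"
proof -
  let ?m = "freq_measure M"
  obtain C where "frequency_measure ?m C" using frequency_measure_freq_measure by blast
  then interpret frequency_measure ?m C .
  note vd = curve_decays[OF v T] and vh = curve_hermitian[OF v T] and vc = curve_continuous[OF v T]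
  have rep: "(\<rho>\<^sup>2 * weight \<xi>) \<ge> (1 + \<xi>\<^sup>2) powr 1 * (a \<xi>)\<^sup>2" for \<xi>
  proof -
    have "\<bar>a \<xi>\<bar> \<le> \<rho> * weight \<xi>" using decays_le[OF L(1), of \<xi>] by simp
    hence "\<bar>a \<xi>\<bar>\<^sup>2 \<le> (\<rho> * weight \<xi>)\<^sup>2" by (intro power_mono) auto
    hence "(1 + \<xi>\<^sup>2) powr 1 * (a \<xi>)\<^sup>2 \<le> (1 + \<xi>\<^sup>2) powr 1 * (\<rho> * weight \<xi>)\<^sup>2" by (intro mult_left_mono) auto
    also have "\<dots> = \<rho>\<^sup>2 * weight \<xi>" using weight_eq_powr[of \<xi>] by (simp add: power_mult_distrib mult_ac)
    finally show ?thesis .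
  qed
  have ac: "continuous_on UNIV a"
    using continuous_on_Re[OF decays_continuous[OF L(1)]] by simp
  have data: "wave_data a \<in> vecs (sobolev_data M 1)"
    by (rule wave_data_mem(1)[OF ac L(2) integrable_mult_right[OF integrable_weight] rep])
  \<comment> \<open>Joint continuity of \<open>v\<close> gives convergence at each frequency; the
    decay gives a majorant for the norm integral that is uniform in time.\<close>
  have cont: "((\<lambda>r. snorm (sobolev M 1) (v r - v t)) \<longlongrightarrow> 0) (at t within {0..T})" for t
  proof -
    have "continuous_on UNIV (\<lambda>r. LINT \<xi>|?m. (1 + \<xi>\<^sup>2) powr 1 * (cmod ((v r - v t) \<xi>))\<^sup>2)"
    proof (rule continuous_on_LINT)
      show "continuous_on UNIV (\<lambda>r. (1 + \<xi>\<^sup>2) powr 1 * (cmod ((v r - v t) \<xi>))\<^sup>2)" for \<xi>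
      proof -
        have "continuous_on UNIV (\<lambda>r. case_prod v (r, \<xi>))"
          by (rule continuous_on_compose2[OF vc]) (auto intro!: continuous_intros)
        hence "continuous_on UNIV (\<lambda>r. v r \<xi>)" by simp
        thus ?thesis by (auto intro!: continuous_intros)
      qed
      show "(\<lambda>\<xi>. (1 + \<xi>\<^sup>2) powr 1 * (cmod ((v r - v t) \<xi>))\<^sup>2) \<in> borel_measurable ?m" for r
      proof -
        have [measurable]: "v r \<in> borel_measurable borel" "v t \<in> borel_measurable borel"
          using decays_measurable[OF vd] by auto
        show ?thesis unfolding fun_diff_def by (intro measurable_freq) measurable
      qed
      show "integrable ?m (\<lambda>\<xi>. (2 * R)\<^sup>2 * weight \<xi>)" by (intro integrable_mult_right integrable_weight)
      show "norm ((1 + \<xi>\<^sup>2) powr 1 * (cmod ((v r - v t) \<xi>))\<^sup>2) \<le> (2 * R)\<^sup>2 * weight \<xi>" for r \<xi>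
      proof -
        have "cmod (v r \<xi> - v t \<xi>) \<le> 2 * R * weight \<xi>"
          using norm_triangle_ineq4[of "v r \<xi>" "v t \<xi>"] decays_le[OF vd[of r], of \<xi>] decays_le[OF vd[of t], of \<xi>] by linarith
        hence "(cmod (v r \<xi> - v t \<xi>))\<^sup>2 \<le> (2 * R * weight \<xi>)\<^sup>2" by (intro power_mono) auto
        hence "(1 + \<xi>\<^sup>2) powr 1 * (cmod (v r \<xi> - v t \<xi>))\<^sup>2 \<le> (1 + \<xi>\<^sup>2) powr 1 * (2 * R * weight \<xi>)\<^sup>2" by (intro mult_left_mono) auto
        also have "\<dots> = (2 * R)\<^sup>2 * weight \<xi>" using weight_eq_powr[of \<xi>] by (simp add: power_mult_distrib mult_ac)
        finally show ?thesis by simp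
      qed
    qed
    hence "continuous_on UNIV (\<lambda>r. snorm (sobolev M 1) (v r - v t))"
      unfolding sobolev_snorm by (intro continuous_intros)
    hence "((\<lambda>r. snorm (sobolev M 1) (v r - v t)) \<longlongrightarrow> snorm (sobolev M 1) (v t - v t)) (at t)"
      unfolding continuous_on_def by blast
    moreover have "snorm (sobolev M 1) (v t - v t) = 0" by (simp add: sobolev_snorm)
    ultimately show ?thesis using tendsto_within_subset[of _ _ t UNIV "{0..T}"] by simp
  qed
  have nonlin: "nonlin_xx M f (v \<tau>) \<xi> = - complex_of_real (\<xi>\<^sup>2 * (\<sigma> / (2 * pi) ^ k)) * conv_power ?m (v \<tau>) k \<xi>"
    if "\<xi> \<in> space ?m" for \<tau> \<xi>
  proof -
    have "fourier M (\<lambda>x. f (inv_fourier M (v \<tau>) x)) \<xi> = complex_of_real \<sigma> * fourier M (\<lambda>x. inv_fourier M (v \<tau>) x ^ Suc k) \<xi>"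
      unfolding fourier_def integral_mult_right_zero[symmetric] f
      by (rule Bochner_Integration.integral_cong) (simp_all add: mult_ac)
    thus ?thesis unfolding nonlin_xx_def fourier_power[OF vd vh that k] by simp
  qed
  have integral_eq: "v t \<xi> = lin_flow (wave_data a) t \<xi>
      - (LINT \<tau>:{0..t}|lborel. lin_flow (\<lambda>_. 0, nonlin_xx M f (v \<tau>)) (t - \<tau>) \<xi>)"
    if t: "t \<in> {0..T}" and \<xi>: "\<xi> \<in> space ?m" for t \<xi>
  proof -
    let ?\<kappa> = "\<sigma> / (2 * pi) ^ k"
    have "(LINT \<tau>:{0..t}|lborel. lin_flow (\<lambda>_. 0, nonlin_xx M f (v \<tau>)) (t - \<tau>) \<xi>)
       = (LINT \<tau>|lborel. - complex_of_real ?\<kappa> * (indicator {0..T} \<tau> *\<^sub>R (complex_of_real (duhamel_kernel (t - \<tau>) \<xi>) * conv_power ?m (v \<tau>) k \<xi>)))"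
      unfolding set_lebesgue_integral_def
    proof (rule Bochner_Integration.integral_cong)
      fix \<tau> :: real
      \<comment> \<open>Between \<open>t\<close> and \<open>T\<close> the truncated kernel vanishes,
        so the fixed interval \<open>{0..T}\<close> reproduces the integral up to
        \<open>t\<close>.\<close>
      consider "\<tau> \<in> {0..t}" | "\<tau> \<notin> {0..t}" "\<tau> \<in> {0..T}" | "\<tau> \<notin> {0..T}" by blast
      thus "indicator {0..t} \<tau> *\<^sub>R lin_flow (\<lambda>_. 0, nonlin_xx M f (v \<tau>)) (t - \<tau>) \<xi>
        = - complex_of_real ?\<kappa> * (indicator {0..T} \<tau> *\<^sub>R (complex_of_real (duhamel_kernel (t - \<tau>) \<xi>) * conv_power ?m (v \<tau>) k \<xi>))"
      proof cases
        case 1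
        hence "\<tau> \<in> {0..T}" "0 \<le> t - \<tau>" using t by auto
        thus ?thesis using 1 by (simp add: lin_flow_def nonlin[OF \<xi>] duhamel_kernel_eq mult_ac)
      next
        case 2
        hence "t - \<tau> \<le> 0" by auto
        hence "duhamel_kernel (t - \<tau>) \<xi> = 0" by (simp add: duhamel_kernel_def)
        thus ?thesis using 2 by simp
      next
        case 3
        thus ?thesis using t by auto
      qed
    qed simp
    also have "\<dots> = - duhamel ?m T ?\<kappa> k v t \<xi>"
      unfolding integral_mult_right_zero duhamel_def by simp
    finally show ?thesis using eq[of t \<xi>] by (simp add: lin_flow_wave_data)
  qed
  show ?thesis
    unfolding duhamel_solution_def
    using data decays_sobolev_1[OF vd vh] cont integral_eq by (auto intro!: AE_I2)
qed

section \<open>Expansion of the flow map\<close>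

lemma conv_power_scale:
  "conv_power m (\<lambda>\<xi>. c * a \<xi>) k \<xi> = c ^ Suc k * conv_power m a k \<xi>"
proof (induction k arbitrary: \<xi>)
  case (Suc k)
  have "conv m (\<lambda>\<xi>. c * a \<xi>) (conv_power m (\<lambda>\<xi>. c * a \<xi>) k) \<xi>
      = (LINT \<eta>|m. c ^ Suc (Suc k) * (a \<eta> * conv_power m a k (\<xi> - \<eta>)))"
    unfolding conv_def Suc by (simp add: mult_ac)
  thus ?case by (simp add: conv_def)
qed simp

lemma wave_scale: "wave (\<lambda>\<xi>. c * a \<xi>) \<tau> = (\<lambda>\<xi>. complex_of_real c * wave a \<tau> \<xi>)"
  by (simp add: wave_def fun_eq_iff)

lemma duhamel_wave_scale:
  "duhamel m t \<kappa> k (wave (\<lambda>\<xi>. c * a \<xi>)) \<tau> \<xi> = complex_of_real (c ^ Suc k) * duhamel m t \<kappa> k (wave a) \<tau> \<xi>"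
proof -
  have "duhamel m t \<kappa> k (wave (\<lambda>\<xi>. c * a \<xi>)) \<tau> \<xi> = complex_of_real \<kappa> * (LINT r|lborel. complex_of_real (c ^ Suc k) *
     (indicator {0..t} r *\<^sub>R (complex_of_real (duhamel_kernel (\<tau> - r) \<xi>) * conv_power m (wave a r) k \<xi>)))"
    unfolding duhamel_def wave_scale conv_power_scale by (simp add: mult_ac)
  also have "\<dots> = complex_of_real (c ^ Suc k) * duhamel m t \<kappa> k (wave a) \<tau> \<xi>"
    unfolding duhamel_def integral_mult_right_zero by (simp only: mult_ac)
  finally show ?thesis .
qed

lemma duhamel_coefficient: "duhamel m t \<kappa> k v \<tau> \<xi> = complex_of_real \<kappa> * duhamel m t 1 k v \<tau> \<xi>"
  by (simp add: duhamel_def)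

lemma decaying_curve_mono:
  assumes "decaying_curve R v" "R \<le> Q"
  shows "decaying_curve Q v"
proof (rule decaying_curveI)
  show "cmod (v \<tau> \<xi>) \<le> Q * weight \<xi>" for \<tau> \<xi>
  proof -
    have "cmod (v \<tau> \<xi>) \<le> R * weight \<xi>"
      using assms(1) by (simp add: decaying_curve_def decays_def)
    also have "\<dots> \<le> Q * weight \<xi>" by (rule mult_right_mono[OF assms(2)]) simp
    finally show ?thesis .
  qed
qed (use assms(1) in \<open>simp_all add: decaying_curve_def\<close>)

context frequency_measure
begin

lemma decays_duhamel:
  assumes "decaying_curve R v" "0 \<le> t"
  shows "decaying_curve (\<bar>\<kappa>\<bar> * t * (4 * weight_mass) ^ k * R ^ Suc k) (duhamel m t \<kappa> k v)"
  by (rule decaying_curveI)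
     (use duhamel_continuous[OF assms] norm_duhamel_le[OF assms] hermitian_duhamel[OF assms] in auto)

text \<open>The solution differs from the linear wave by \<open>O(h^(k+1))\<close>, and on data of
  this size the Duhamel operator has Lipschitz constant \<open>O(h^k)\<close>. Replacing the
  solution by the linear wave inside the operator thus costs \<open>h^(2 k + 1)\<close>, of higher
  order than \<open>h^(k+1)\<close> because \<open>k \<ge> 1\<close>.\<close>

lemma solution_expansion:
  fixes a :: "real \<Rightarrow> real"
  assumes a: "decays R (\<lambda>\<xi>. complex_of_real (a \<xi>))" "\<And>\<xi>. a (- \<xi>) = a \<xi>" and t: "0 \<le> t" and k: "k \<ge> 1"
  obtains h0 E where "h0 > 0" "0 \<le> E"
    and "\<And>h. 0 < h \<Longrightarrow> h < h0 \<Longrightarrow> \<exists>v. decaying_curve (2 * (h * R)) v \<and>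
       (\<forall>\<tau> \<xi>. v \<tau> \<xi> = wave (\<lambda>\<xi>. h * a \<xi>) \<tau> \<xi> + duhamel m t \<kappa> k v \<tau> \<xi>) \<and>
       (\<forall>\<tau> \<xi>. cmod (v \<tau> \<xi> - wave (\<lambda>\<xi>. h * a \<xi>) \<tau> \<xi> - complex_of_real (h ^ Suc k) * duhamel m t \<kappa> k (wave a) \<tau> \<xi>)
          \<le> E * h ^ (2 * k + 1) * weight \<xi>)"
proof -
  let ?D = "4 * weight_mass"
  have R: "0 \<le> R" by (rule decays_nonneg[OF a(1)])
  have D: "0 \<le> ?D" using weight_mass_nonneg by simp
  define Z where "Z = \<bar>\<kappa>\<bar> * t * real (Suc k) * ?D ^ k * (2 * R) ^ k"
  have Z: "0 \<le> Z" unfolding Z_def using R t D by (intro mult_nonneg_nonneg) auto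
  define E where "E = Z * (\<bar>\<kappa>\<bar> * t * ?D ^ k * (2 * R) ^ Suc k)"
  have E: "0 \<le> E" unfolding E_def using Z R t D by (intro mult_nonneg_nonneg) auto
  \<comment> \<open>\<open>h \<le> 1\<close> gives \<open>h^k \<le> h\<close>; the other bound then
    makes the contraction constant \<open>Z h^k\<close> at most \<open>1/2\<close>.\<close>
  define h0 where "h0 = min 1 (1 / (2 * (Z + 1)))"
  show ?thesis
  proof (rule that[of h0 E])
    show "h0 > 0" using Z by (simp add: h0_def)
    show "0 \<le> E" by (rule E)
    fix h :: real assume h: "0 < h" "h < h0"
    let ?L = "wave (\<lambda>\<xi>. h * a \<xi>)"
    have L: "decaying_curve (h * R) ?L"
    proof (rule decaying_curve_wave)
      have "cmod (complex_of_real (h * a x)) \<le> h * R * weight x" for x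
        using mult_left_mono[OF decays_le[OF a(1), of x], of h] h by (simp add: norm_mult mult.assoc)
      thus "decays (h * R) (\<lambda>\<xi>. complex_of_real (h * a \<xi>))"
        using decays_continuous[OF a(1)] by (auto simp: decays_def intro!: continuous_intros)
    qed (simp add: a(2))
    have "h ^ k \<le> h ^ 1" using h k by (intro power_decreasing) (auto simp: h0_def)
    hence "Z * h ^ k \<le> Z * h" using Z by (intro mult_left_mono) auto
    also have "\<dots> \<le> Z * (1 / (2 * (Z + 1)))" using Z h by (intro mult_left_mono) (auto simp: h0_def)
    also have "\<dots> \<le> 1 / 2" using Z by (simp add: pos_divide_le_eq)
    finally have Zh: "Z * h ^ k \<le> 1 / 2" .
    have eqZ: "\<bar>\<kappa>\<bar> * t * real (Suc k) * ?D ^ k * (2 * (h * R)) ^ k = Z * h ^ k"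
    proof -
      have "(2 * (h * R)) ^ k = (2 * R) ^ k * h ^ k" by (simp only: power_mult_distrib[symmetric] mult_ac)
      thus ?thesis unfolding Z_def by (simp only: mult_ac)
    qed
    obtain v where v: "decaying_curve (2 * (h * R)) v" "\<And>\<tau> \<xi>. v \<tau> \<xi> = ?L \<tau> \<xi> + duhamel m t \<kappa> k v \<tau> \<xi>"
    proof (rule duhamel_fixed_point[OF L t Zh[folded eqZ]])
      fix v
      assume "decaying_curve (2 * (h * R)) v" "\<And>\<tau> \<xi>. v \<tau> \<xi> = ?L \<tau> \<xi> + duhamel m t \<kappa> k v \<tau> \<xi>"
      thus thesis by (rule that)
    qed
    have L2: "decaying_curve (2 * (h * R)) ?L" by (rule decaying_curve_mono[OF L]) (use h R in simp)
    have d: "cmod (v \<tau> \<xi> - ?L \<tau> \<xi>) \<le> \<bar>\<kappa>\<bar> * t * ?D ^ k * (2 * (h * R)) ^ Suc k * weight \<xi>" for \<tau> \<xi>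
      using norm_duhamel_le[OF v(1) t, of \<kappa> k \<tau> \<xi>] v(2)[of \<tau> \<xi>] by simp
    have "cmod (v \<tau> \<xi> - ?L \<tau> \<xi> - complex_of_real (h ^ Suc k) * duhamel m t \<kappa> k (wave a) \<tau> \<xi>) \<le> E * h ^ (2 * k + 1) * weight \<xi>" for \<tau> \<xi>
    proof -
      have "v \<tau> \<xi> - ?L \<tau> \<xi> - complex_of_real (h ^ Suc k) * duhamel m t \<kappa> k (wave a) \<tau> \<xi>
         = duhamel m t \<kappa> k v \<tau> \<xi> - duhamel m t \<kappa> k ?L \<tau> \<xi>"
        using v(2)[of \<tau> \<xi>] unfolding duhamel_wave_scale by simp
      also have "cmod \<dots> \<le> \<bar>\<kappa>\<bar> * t * real (Suc k) * ?D ^ k * (2 * (h * R)) ^ k * (\<bar>\<kappa>\<bar> * t * ?D ^ k * (2 * (h * R)) ^ Suc k) * weight \<xi>"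
        by (rule duhamel_lipschitz[OF v(1) L2 t d])
      also have "\<dots> = E * h ^ (2 * k + 1) * weight \<xi>"
      proof -
        have e1: "(2 * (h * R)) ^ Suc k = (2 * R) ^ Suc k * h ^ Suc k" by (simp only: power_mult_distrib[symmetric] mult_ac)
        have "2 * k + 1 = k + Suc k" by simp
        hence e2: "h ^ (2 * k + 1) = h ^ k * h ^ Suc k" by (simp only: power_add)
        show ?thesis unfolding eqZ e1 e2 E_def by (simp only: mult_ac)
      qed
      finally show ?thesis .
    qed
    note rest = this
    show "\<exists>v. decaying_curve (2 * (h * R)) v \<and>
       (\<forall>\<tau> \<xi>. v \<tau> \<xi> = ?L \<tau> \<xi> + duhamel m t \<kappa> k v \<tau> \<xi>) \<and>
       (\<forall>\<tau> \<xi>. cmod (v \<tau> \<xi> - ?L \<tau> \<xi> - complex_of_real (h ^ Suc k) * duhamel m t \<kappa> k (wave a) \<tau> \<xi>)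
          \<le> E * h ^ (2 * k + 1) * weight \<xi>)" by (intro exI[of _ v] conjI v(1) allI v(2) rest)
  qed
qed

text \<open>Each bump is compared with the translate of \<open>weight\<close> to its own centre, so
  that the constant does not depend on \<open>N\<close> and \<open>K\<close>.\<close>

lemma packet_le_weights:
  assumes "0 < \<delta>" "\<delta> \<le> 1"
  shows "packet \<delta> N K \<xi> \<le> 2 * (weight (real N - \<xi>) + weight (- real N - \<xi>) + weight (real K - \<xi>) + weight (- real K - \<xi>))"
proof -
  have b: "bump \<delta> x \<le> 2 * weight x" for x
  proof (cases "\<bar>x\<bar> < 1")
    case True
    hence "x\<^sup>2 \<le> 1" by (simp add: abs_square_le_1)
    hence "1 \<le> 2 * weight x" by (simp add: weight_def pos_le_divide_eq add_pos_nonneg)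
    moreover have "bump \<delta> x \<le> 1" using assms by (simp add: bump_def)
    ultimately show ?thesis by linarith
  next
    case False
    hence "bump \<delta> x = 0" using assms by (simp add: bump_def)
    thus ?thesis by simp
  qed
  have "weight (- real N - \<xi>) = weight (\<xi> + real N)" "weight (- real K - \<xi>) = weight (\<xi> + real K)"
    using weight_commute[of "- real N" \<xi>] weight_commute[of "- real K" \<xi>] by simp_all
  thus ?thesis
    using b[of "\<xi> - real N"] b[of "\<xi> + real N"] b[of "\<xi> - real K"] b[of "\<xi> + real K"]
    by (simp add: packet_def weight_commute[of _ \<xi>])
qed

end

text \<open>On the support \<open>\<bar>\<xi>\<bar> \<ge> N / 2\<close>, so for \<open>s < 0\<close>
  the Sobolev weight compensates the amplitude \<open>N powr (- s)\<close> at both centres, as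
  \<open>K \<ge> N\<close>. The bound \<open>Q\<close> is uniform because translates of
  \<open>weight\<close> have uniformly bounded integrals.\<close>

lemma packet_data_norm_bound:
  fixes s :: real
  assumes \<delta>: "0 < \<delta>" "\<delta> \<le> 1" and s: "s < 0"
  obtains Q where "\<And>N K. 2 \<le> N \<Longrightarrow> N \<le> K \<Longrightarrow>
     wave_data (\<lambda>\<xi>. real N powr (- s) * packet \<delta> N K \<xi>) \<in> vecs (sobolev_data M s) \<and>
     snorm (sobolev_data M s) (wave_data (\<lambda>\<xi>. real N powr (- s) * packet \<delta> N K \<xi>)) \<le> Q"
proof -
  let ?m = "freq_measure M"
  obtain C where "frequency_measure ?m C" using frequency_measure_freq_measure by blast
  then interpret frequency_measure ?m C .
  show ?thesis
  proof (rule that[of "sqrt (2 * (4 powr (- s) * (8 * (4 * C))))"])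
    fix N K :: nat assume N: "2 \<le> N" "N \<le> K"
    let ?a = "\<lambda>\<xi>. real N powr (- s) * packet \<delta> N K \<xi>"
    let ?g = "\<lambda>\<xi>. 4 powr (- s) * (8 * (weight (real N - \<xi>) + weight (- real N - \<xi>) + weight (real K - \<xi>) + weight (- real K - \<xi>)))"
    have gi: "integrable ?m ?g" using integrable_weight_diff by simp
    have gI: "(LINT \<xi>|?m. ?g \<xi>) \<le> 4 powr (- s) * (8 * (4 * C))"
    proof -
      have "(LINT \<xi>|?m. ?g \<xi>) = 4 powr (- s) * (8 * ((LINT \<xi>|?m. weight (real N - \<xi>)) + (LINT \<xi>|?m. weight (- real N - \<xi>))
          + (LINT \<xi>|?m. weight (real K - \<xi>)) + (LINT \<xi>|?m. weight (- real K - \<xi>))))"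
        using integrable_weight_diff by simp
      also have "\<dots> \<le> 4 powr (- s) * (8 * (C + C + C + C))"
        by (intro mult_left_mono add_mono integral_weight_diff_le) auto
      finally show ?thesis by simp
    qed
    have le: "(1 + \<xi>\<^sup>2) powr s * (?a \<xi>)\<^sup>2 \<le> ?g \<xi>" for \<xi>
    proof (cases "packet \<delta> N K \<xi> = 0")
      case False
      have "real N / 2 \<le> \<bar>\<xi>\<bar>" using packet_neq_0D[OF False] N \<delta> by auto
      hence "(real N / 2)\<^sup>2 \<le> \<bar>\<xi>\<bar>\<^sup>2" by (intro power_mono) auto
      hence "(real N / 2)\<^sup>2 \<le> 1 + \<xi>\<^sup>2" by simp
      hence "(1 + \<xi>\<^sup>2) powr s \<le> ((real N / 2)\<^sup>2) powr s"
        using s N by (intro powr_mono2') auto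
      also have "\<dots> = 4 powr (- s) * (real N powr s)\<^sup>2"
      proof -
        have "(real N / 2)\<^sup>2 = real N * real N * (1 / 4)" by (simp add: power2_eq_square)
        hence "((real N / 2)\<^sup>2) powr s = real N powr s * real N powr s * (1 / 4) powr s"
          by (simp only: powr_mult of_nat_0_le_iff mult_nonneg_nonneg)
        moreover have "(1 / 4 :: real) powr s = 4 powr (- s)" by (simp add: powr_divide powr_minus_divide)
        ultimately show ?thesis by (simp add: power2_eq_square)
      qed
      finally have "(1 + \<xi>\<^sup>2) powr s * (?a \<xi>)\<^sup>2 \<le> 4 powr (- s) * (real N powr s)\<^sup>2 * (?a \<xi>)\<^sup>2"
        by (rule mult_right_mono) simp
      also have "\<dots> = 4 powr (- s) * (packet \<delta> N K \<xi>)\<^sup>2"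
      proof -
        have "real N powr s * real N powr (- s) = 1" using N by (simp add: powr_add[symmetric])
        hence "(real N powr s)\<^sup>2 * (real N powr (- s))\<^sup>2 = 1" by (metis power_mult_distrib power_one)
        thus ?thesis by (simp add: power_mult_distrib mult_ac)
      qed
      also have "\<dots> \<le> ?g \<xi>"
      proof (rule mult_left_mono)
        have "(packet \<delta> N K \<xi>)\<^sup>2 \<le> 4 * packet \<delta> N K \<xi>"
          unfolding power2_eq_square using packet_le[of \<delta> N K \<xi>] \<delta> by (intro mult_right_mono) auto
        also have "\<dots> \<le> 8 * (weight (real N - \<xi>) + weight (- real N - \<xi>) + weight (real K - \<xi>) + weight (- real K - \<xi>))"
          using packet_le_weights[OF \<delta>, of N K \<xi>] by simp
        finally show "(packet \<delta> N K \<xi>)\<^sup>2 \<le> 8 * (weight (real N - \<xi>) + weight (- real N - \<xi>) + weight (real K - \<xi>) + weight (- real K - \<xi>))" .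
      qed simp
      finally show ?thesis .
    qed (simp add: add_nonneg_nonneg)
    have cont: "continuous_on UNIV ?a" unfolding packet_def bump_def by (intro continuous_intros)
    have sym: "?a (- \<xi>) = ?a \<xi>" for \<xi> by simp
    note mem = wave_data_mem[OF cont sym gi le]
    from order_trans[OF mem(2)] gI mem(1)
    show "wave_data ?a \<in> vecs (sobolev_data M s) \<and> snorm (sobolev_data M s) (wave_data ?a) \<le> sqrt (2 * (4 powr (- s) * (8 * (4 * C))))"
      by simp
  qed
qed

text \<open>The solution from the contraction is regular of order \<open>1 \<ge> s\<close>, so
  \<open>S t\<close> must agree with it almost everywhere. On the window the linear wave vanishes,
  which leaves the first iterate and a remainder of order \<open>h^(2 k + 1)\<close>.\<close>

lemma flow_map_expansion:
  fixes a :: "real \<Rightarrow> real" and \<sigma> s t :: real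
  assumes S: "flow_map M f s S" and f: "f = (\<lambda>x. \<sigma> * x ^ Suc k)" and k: "k \<ge> 1" and s: "s \<le> 1" and t: "0 \<le> t"
    and a: "decays R (\<lambda>\<xi>. complex_of_real (a \<xi>))" "\<And>\<xi>. a (- \<xi>) = a \<xi>"
    and window: "\<And>\<xi>. \<xi> \<in> {1 - r..1 + r} \<Longrightarrow> a \<xi> = 0"
    and data: "wave_data a \<in> vecs (sobolev_data M s)"
  shows "((\<lambda>h. (window_functional (freq_measure M) r (S t (h *\<^sub>R wave_data a))
      - window_functional (freq_measure M) r (duhamel (freq_measure M) t (\<sigma> / (2 * pi) ^ k) k (wave a) t) * h ^ Suc k) / h ^ Suc k) \<longlongrightarrow> 0) (at_right 0)"
proof -
  let ?m = "freq_measure M" and ?\<kappa> = "\<sigma> / (2 * pi) ^ k"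
  obtain C where "frequency_measure ?m C" using frequency_measure_freq_measure by blast
  then interpret frequency_measure ?m C .
  let ?l = "window_functional ?m r"
  obtain h0 E where h0: "h0 > 0" and E: "0 \<le> E"
    and sol: "\<And>h. 0 < h \<Longrightarrow> h < h0 \<Longrightarrow> \<exists>v. decaying_curve (2 * (h * R)) v \<and>
       (\<forall>\<tau> \<xi>. v \<tau> \<xi> = wave (\<lambda>\<xi>. h * a \<xi>) \<tau> \<xi> + duhamel ?m t ?\<kappa> k v \<tau> \<xi>) \<and>
       (\<forall>\<tau> \<xi>. cmod (v \<tau> \<xi> - wave (\<lambda>\<xi>. h * a \<xi>) \<tau> \<xi> - complex_of_real (h ^ Suc k) * duhamel ?m t ?\<kappa> k (wave a) \<tau> \<xi>)
          \<le> E * h ^ (2 * k + 1) * weight \<xi>)"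
    using solution_expansion[OF a t k] by metis
  have bound: "\<bar>?l (S t (h *\<^sub>R wave_data a)) - ?l (duhamel ?m t ?\<kappa> k (wave a) t) * h ^ Suc k\<bar> \<le> E * h ^ (2 * k + 1) * C"
    if h: "0 < h" "h < h0" for h
  proof -
    let ?A = "\<lambda>\<xi>. h * a \<xi>"
    let ?d = "duhamel ?m t ?\<kappa> k (wave a)"
    from sol[OF h] obtain v where v: "decaying_curve (2 * (h * R)) v"
       "\<And>\<tau> \<xi>. v \<tau> \<xi> = wave ?A \<tau> \<xi> + duhamel ?m t ?\<kappa> k v \<tau> \<xi>"
       "\<And>\<tau> \<xi>. cmod (v \<tau> \<xi> - wave ?A \<tau> \<xi> - complex_of_real (h ^ Suc k) * ?d \<tau> \<xi>) \<le> E * h ^ (2 * k + 1) * weight \<xi>"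
      by blast
    have dA: "decays (h * R) (\<lambda>\<xi>. complex_of_real (?A \<xi>))"
    proof -
      have "cmod (complex_of_real (h * a x)) \<le> h * R * weight x" for x
        using mult_left_mono[OF decays_le[OF a(1), of x], of h] h by (simp add: norm_mult mult.assoc)
      thus ?thesis using decays_continuous[OF a(1)] by (auto simp: decays_def intro!: continuous_intros)
    qed
    have "duhamel_solution M f 1 t (wave_data ?A) v"
      by (rule duhamel_solution_of_fixed_point[OF dA _ v(1) t k f v(2)]) (simp add: a(2))
    hence ae: "AE \<xi> in ?m. S t (wave_data ?A) \<xi> = v t \<xi>"
      by (rule S[unfolded flow_map_def, THEN conjunct2, rule_format, rotated 2]) (use s t in auto)
    have hd: "wave_data ?A = h *\<^sub>R wave_data a" by (simp add: wave_data_scaleR)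
    have "S t (wave_data ?A) \<in> vecs (sobolev M s)"
      using S t sobolev_data_scaleR(1)[OF data, of h] unfolding flow_map_def hd by blast
    hence Sm: "S t (wave_data ?A) \<in> borel_measurable ?m" by (simp add: sobolev_vecs_iff)
    note vd = curve_decays[OF v(1) t, of t]
    note wd = decaying_curve_wave[OF a]
    note dd = curve_decays[OF decays_duhamel[OF wd t] t, of ?\<kappa> k t]
    have ind: "(indicator {1 - r..1 + r} :: real \<Rightarrow> real) \<in> borel_measurable ?m" by (intro measurable_freq) simp
    have lS: "?l (S t (wave_data ?A)) = ?l (v t)"
      unfolding window_functional_def
    proof (rule integral_cong_AE)
      show "AE x in ?m. indicator {1 - r..1 + r} x * Im (S t (wave_data ?A) x) = indicator {1 - r..1 + r} x * Im (v t x)"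
        using ae by eventually_elim simp
    qed (use ind Sm measurable_freq[OF decays_measurable[OF vd]] in simp_all)
    define R' where "R' = (\<lambda>\<xi>. v t \<xi> - wave ?A t \<xi> - complex_of_real (h ^ Suc k) * ?d t \<xi>)"
    have R': "decays (E * h ^ (2 * k + 1)) R'"
      unfolding decays_def R'_def
      using v(3) decays_continuous[OF vd] decays_continuous[OF dd]
        decays_continuous[OF curve_decays[OF decaying_curve_wave[OF dA] t, of t]] a(2)
      by (auto intro!: continuous_intros)
    have "?l (v t) = (LINT \<xi>|?m. h ^ Suc k * (indicator {1 - r..1 + r} \<xi> * Im (?d t \<xi>)) + indicator {1 - r..1 + r} \<xi> * Im (R' \<xi>))"
      unfolding window_functional_def
    proof (rule Bochner_Integration.integral_cong)
      fix \<xi>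
      show "indicator {1 - r..1 + r} \<xi> * Im (v t \<xi>) = h ^ Suc k * (indicator {1 - r..1 + r} \<xi> * Im (?d t \<xi>)) + indicator {1 - r..1 + r} \<xi> * Im (R' \<xi>)"
      proof (cases "\<xi> \<in> {1 - r..1 + r}")
        case True
        have "wave ?A t \<xi> = 0" using window[OF True] by (simp add: wave_def)
        hence "R' \<xi> = v t \<xi> - complex_of_real (h ^ Suc k) * ?d t \<xi>" by (simp add: R'_def)
        hence "v t \<xi> = complex_of_real (h ^ Suc k) * ?d t \<xi> + R' \<xi>" by simp
        hence "Im (v t \<xi>) = h ^ Suc k * Im (?d t \<xi>) + Im (R' \<xi>)"
          by (simp only: plus_complex.sel Im_complex_of_real times_complex.sel Re_complex_of_real)
        thus ?thesis using True by simp
      qed simp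
    qed simp
    also have "\<dots> = h ^ Suc k * ?l (?d t) + ?l R'"
      unfolding window_functional_def
      using decays_window_functional(1)[OF dd, of r] decays_window_functional(1)[OF R', of r] by simp
    finally have "?l (v t) = h ^ Suc k * ?l (?d t) + ?l R'" .
    with lS have "?l (S t (h *\<^sub>R wave_data a)) - ?l (?d t) * h ^ Suc k = ?l R'" by (simp add: hd)
    thus ?thesis using decays_window_functional(2)[OF R', of r] by simp
  qed
  have ev: "\<forall>\<^sub>F h in at_right (0::real). 0 < h \<and> h < h0"
    using h0 by (auto simp: eventually_at_right_field intro!: exI[of _ h0])
  show ?thesis
  proof (rule Lim_null_comparison)
    show "\<forall>\<^sub>F h in at_right 0. norm ((?l (S t (h *\<^sub>R wave_data a)) - ?l (duhamel ?m t ?\<kappa> k (wave a) t) * h ^ Suc k) / h ^ Suc k) \<le> E * C * h ^ k"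
      using ev
    proof eventually_elim
      case (elim h)
      have "2 * k + 1 = k + Suc k" by simp
      hence hk: "h ^ (2 * k + 1) = h ^ k * h ^ Suc k" by (simp only: power_add)
      have "E * h ^ (2 * k + 1) * C = E * C * h ^ k * h ^ Suc k" unfolding hk by (simp only: mult_ac)
      note eq = this
      have pos: "0 < h ^ Suc k" using elim by simp
      show ?case
        using bound[OF conjunct1[OF elim] conjunct2[OF elim]] unfolding eq
        by (simp only: real_norm_def abs_divide abs_of_pos[OF pos] pos_divide_le_eq[OF pos])
    qed
    have "((\<lambda>h. E * C * h ^ k) \<longlongrightarrow> E * C * 0 ^ k) (at_right (0::real))"
      by (intro tendsto_intros)
    thus "((\<lambda>h. E * C * h ^ k) \<longlongrightarrow> 0) (at_right (0::real))" using k by (simp add: power_0_left)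
  qed
qed

section \<open>Growth in \<open>N\<close> against the bound implied by differentiability\<close>

theorem theorem1p1:
  fixes M :: spatial_domain and p :: nat and f :: "real \<Rightarrow> real" and s :: real
  assumes "p > 1"
    and "f = (\<lambda>v. v ^ p) \<or> f = (\<lambda>v. - (v ^ p))"
    and "odd p \<Longrightarrow> s < - (2 / real p)"
    and "even p \<Longrightarrow> s < - (1 / real p)"
  shows "\<exists>T>0. \<forall>S. flow_map M f s S \<longrightarrow>
           (\<forall>t. 0 < t \<and> t < T \<longrightarrow>
              \<not> frechet_Ck_at p (sobolev_data M s) (sobolev M s) (S t) 0)"
proof (intro exI[of _ 1] conjI allI impI notI, simp, elim conjE)
  \<comment> \<open>\<open>T = 1\<close> is inherited from \<open>resonant_output\<close>, where
    \<open>2 t\<close> has to stay below \<open>pi\<close>.\<close>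
  fix S t
  assume S: "flow_map M f s S" and t: "0 < t" "t < (1::real)"
    and Ck: "frechet_Ck_at p (sobolev_data M s) (sobolev M s) (S t) 0"
  let ?m = "freq_measure M"
  obtain C where "frequency_measure ?m C" using frequency_measure_freq_measure by blast
  then interpret frequency_measure ?m C .
  define k where "k = p - 1"
  have k: "k \<ge> 1" "p = Suc k" using assms(1) by (auto simp: k_def)
  define \<sigma> :: real where "\<sigma> = (if f = (\<lambda>v. v ^ p) then 1 else - 1)"
  have \<sigma>: "\<bar>\<sigma>\<bar> = 1" "f = (\<lambda>x. \<sigma> * x ^ Suc k)"
    using assms(2) unfolding k(2)[symmetric] by (auto simp: \<sigma>_def)
  define e where "e = phase_exponent k"
  \<comment> \<open>The hypotheses on \<open>s\<close> say that the power of \<open>N\<close>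
    carried by the iterate is positive; the parity of \<open>k\<close> is opposite to that of
    \<open>p\<close>.\<close>
  have exponent: "0 < - s * real p - real e" and s: "s < 0"
  proof -
    have "real e / real p < - s" using assms(3,4) k(2) by (auto simp: e_def phase_exponent_def)
    thus "0 < - s * real p - real e" using assms(1) by (simp add: pos_divide_less_eq)
    have "0 \<le> real e / real p" by simp
    with \<open>real e / real p < - s\<close> show "s < 0" by linarith
  qed
  define \<delta> where "\<delta> = 1 / (8 * real (Suc k))"
  define r where "r = \<delta> / 2 ^ Suc k"
  have \<delta>: "0 < \<delta>" "\<delta> \<le> 1" by (auto simp: \<delta>_def)
  have r: "0 < r" "r \<le> 1"
  proof -
    show "0 < r" using \<delta> by (simp add: r_def)
    have "r \<le> \<delta> / 1" unfolding r_def using \<delta> by (intro divide_left_mono one_le_power) auto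
    thus "r \<le> 1" using \<delta>(2) by simp
  qed
  let ?l = "window_functional ?m r"
  obtain c N0 where c: "c > 0" and out: "\<And>N A. N \<ge> N0 \<Longrightarrow> 0 \<le> A \<Longrightarrow>
       c * A ^ Suc k / real N ^ e \<le> - ?l (duhamel ?m t 1 k (wave (\<lambda>\<xi>. A * packet \<delta> N (second_frequency k N) \<xi>)) t)"
  proof (rule resonant_output[OF t k(1), folded \<delta>_def, folded r_def window_functional_def e_def])
    fix c N0
    assume "c > 0" "\<And>N A. N \<ge> N0 \<Longrightarrow> 0 \<le> A \<Longrightarrow>
       c * A ^ Suc k / real N ^ e \<le> - ?l (duhamel ?m t 1 k (wave (\<lambda>\<xi>. A * packet \<delta> N (second_frequency k N) \<xi>)) t)"
    thus thesis by (rule that)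
  qed
  obtain Q where Q: "\<And>N K. 2 \<le> N \<Longrightarrow> N \<le> K \<Longrightarrow>
     wave_data (\<lambda>\<xi>. real N powr (- s) * packet \<delta> N K \<xi>) \<in> vecs (sobolev_data M s) \<and>
     snorm (sobolev_data M s) (wave_data (\<lambda>\<xi>. real N powr (- s) * packet \<delta> N K \<xi>)) \<le> Q"
  proof (rule packet_data_norm_bound[OF \<delta> s])
    fix Q
    assume "\<And>N K. 2 \<le> N \<Longrightarrow> N \<le> K \<Longrightarrow>
     wave_data (\<lambda>\<xi>. real N powr (- s) * packet \<delta> N K \<xi>) \<in> vecs (sobolev_data M s) \<and>
     snorm (sobolev_data M s) (wave_data (\<lambda>\<xi>. real N powr (- s) * packet \<delta> N K \<xi>)) \<le> Q"
    thus thesis by (rule that)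
  qed
  have window_int: "integrable ?m (\<lambda>\<xi>. indicator {1 - r..1 + r} \<xi> * Im (y \<xi>))" if "y \<in> vecs (sobolev M s)" for y
    using that window_functional_bound(1)[OF _ _ r] unfolding sobolev_vecs_iff by blast
  obtain B where B: "\<And>\<phi> \<alpha>. \<phi> \<in> vecs (sobolev_data M s) \<Longrightarrow> ((\<lambda>h. (?l (S t (h *\<^sub>R \<phi>)) - \<alpha> * h ^ p) / h ^ p) \<longlongrightarrow> 0) (at_right 0) \<Longrightarrow>
      \<bar>\<alpha>\<bar> \<le> B * snorm (sobolev_data M s) \<phi> ^ p"
  proof (rule frechet_Ck_coefficient_bound[OF Ck _ sobolev_data_scaleR sobolev_data_snorm_nonneg sobolev_scaleR(1) sobolev_add])
    fix B
    assume "\<And>\<phi> \<alpha>. \<phi> \<in> vecs (sobolev_data M s) \<Longrightarrow> ((\<lambda>h. (?l (S t (h *\<^sub>R \<phi>)) - \<alpha> * h ^ p) / h ^ p) \<longlongrightarrow> 0) (at_right 0) \<Longrightarrow>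
      \<bar>\<alpha>\<bar> \<le> B * snorm (sobolev_data M s) \<phi> ^ p"
    thus thesis by (rule that)
  next
    show "0 < p" using assms(1) by simp
    show "?l (c *\<^sub>R y) = c * ?l y" for c y
    proof -
      have "?l (c *\<^sub>R y) = (LINT \<xi>|?m. c * (indicator {1 - r..1 + r} \<xi> * Im (y \<xi>)))"
        unfolding window_functional_def scaleR_fun_def
        by (intro Bochner_Integration.integral_cong) (auto simp: mult_ac)
      thus ?thesis by (simp add: window_functional_def)
    qed
    show "?l (x + y) = ?l x + ?l y" if "x \<in> vecs (sobolev M s)" "y \<in> vecs (sobolev M s)" for x y
      using window_int[OF that(1)] window_int[OF that(2)] by (simp add: window_functional_def distrib_left)
    show "\<bar>?l y\<bar> \<le> (ball_mass r / 2 + 5 powr \<bar>s\<bar> / 2) * snorm (sobolev M s) y" if "y \<in> vecs (sobolev M s)" for y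
      using that window_functional_bound(2)[OF _ _ r] unfolding sobolev_vecs_iff sobolev_snorm by blast
    show "0 \<le> ball_mass r / 2 + 5 powr \<bar>s\<bar> / 2" using ball_mass_pos[OF r(1)] by simp
  qed
  have growth: "c / (2 * pi) ^ k * real N powr (- s * real p - real e) \<le> \<bar>B\<bar> * Q ^ p" if N: "N \<ge> max N0 4" for N
  proof -
    let ?K = "second_frequency k N" and ?A = "real N powr (- s)" and ?\<kappa> = "\<sigma> / (2 * pi) ^ k"
    define a where "a = (\<lambda>\<xi>. ?A * packet \<delta> N ?K \<xi>)"
    have NK: "N \<le> ?K" by (simp add: second_frequency_def)
    have data: "wave_data a \<in> vecs (sobolev_data M s)" "snorm (sobolev_data M s) (wave_data a) \<le> Q"
      using Q[of N ?K] N NK by (auto simp: a_def)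
    have da: "decays (?A * (4 * \<delta> * (1 + (real ?K + 1)\<^sup>2))) (\<lambda>\<xi>. complex_of_real (a \<xi>))"
      unfolding a_def by (rule decays_packet[OF \<delta> NK]) simp
    have sym: "a (- \<xi>) = a \<xi>" for \<xi> by (simp add: a_def)
    \<comment> \<open>The window lies in \<open>[0, 2]\<close>, and \<open>N \<ge> 4\<close> keeps
      bumps of width at most \<open>1\<close> away from it.\<close>
    have "a \<xi> = 0" if "\<xi> \<in> {1 - r..1 + r}" for \<xi>
    proof (rule ccontr)
      assume "a \<xi> \<noteq> 0"
      hence "packet \<delta> N ?K \<xi> \<noteq> 0" by (auto simp: a_def)
      from packet_neq_0D[OF this] show False using that r \<delta> N NK by auto
    qed
    from flow_map_expansion[OF S \<sigma>(2) k(1) _ _ da sym this data(1)] s t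
    have "\<bar>?l (duhamel ?m t ?\<kappa> k (wave a) t)\<bar> \<le> B * snorm (sobolev_data M s) (wave_data a) ^ p"
      by (intro B[OF data(1)]) (simp add: k(2))
    also have "\<dots> \<le> \<bar>B\<bar> * Q ^ p"
      using data(2) sobolev_data_snorm_nonneg by (intro mult_mono power_mono) auto
    \<comment> \<open>\<open>\<kappa>\<close> enters linearly, so the sign of the nonlinearity
      disappears in the absolute value.\<close>
    also have "?l (duhamel ?m t ?\<kappa> k (wave a) t) = ?\<kappa> * ?l (duhamel ?m t 1 k (wave a) t)"
    proof -
      have "?l (duhamel ?m t ?\<kappa> k (wave a) t) = (LINT \<xi>|?m. ?\<kappa> * (indicator {1 - r..1 + r} \<xi> * Im (duhamel ?m t 1 k (wave a) t \<xi>)))"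
        unfolding window_functional_def duhamel_coefficient[of _ _ ?\<kappa>]
        by (intro Bochner_Integration.integral_cong) (auto simp: mult_ac)
      thus ?thesis by (simp only: window_functional_def integral_mult_right_zero)
    qed
    finally have le: "1 / (2 * pi) ^ k * \<bar>?l (duhamel ?m t 1 k (wave a) t)\<bar> \<le> \<bar>B\<bar> * Q ^ p"
      by (simp add: abs_mult \<sigma>(1) abs_divide)
    have "c * ?A ^ Suc k / real N ^ e \<le> \<bar>?l (duhamel ?m t 1 k (wave a) t)\<bar>"
      using out[of N ?A] N unfolding a_def by simp
    hence le2: "1 / (2 * pi) ^ k * (c * ?A ^ Suc k / real N ^ e) \<le> 1 / (2 * pi) ^ k * \<bar>?l (duhamel ?m t 1 k (wave a) t)\<bar>"
      by (rule mult_left_mono) simp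
    have G: "?A ^ Suc k / real N ^ e = real N powr (- s * real p - real e)"
    proof -
      have "?A ^ Suc k = real N powr (- s * real p)"
      proof -
        have "?A ^ Suc k = ?A powr real (Suc k)" using N by (subst powr_realpow) auto
        thus ?thesis by (simp only: powr_powr k(2))
      qed
      moreover have "real N ^ e = real N powr real e" using N by (simp add: powr_realpow)
      ultimately show ?thesis by (simp only: powr_diff)
    qed
    have "c / (2 * pi) ^ k * real N powr (- s * real p - real e) = 1 / (2 * pi) ^ k * (c * ?A ^ Suc k / real N ^ e)"
      unfolding G[symmetric] by (simp only: times_divide_eq_left times_divide_eq_right mult_1_left)
    with le le2 show ?thesis by linarith
  qed
  \<comment> \<open>The positive power of \<open>N\<close>, written as an exponential, exceeds the
    bound given by \<open>growth\<close>, which does not depend on \<open>N\<close>.\<close>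
  have "filterlim (\<lambda>N. exp ((- s * real p - real e) * ln (real N))) at_top sequentially"
    by (rule filterlim_compose[OF exp_at_top filterlim_tendsto_pos_mult_at_top[OF tendsto_const exponent
          filterlim_compose[OF ln_at_top filterlim_real_sequentially]]])
  hence "filterlim (\<lambda>N. c / (2 * pi) ^ k * exp ((- s * real p - real e) * ln (real N))) at_top sequentially"
    using c by (intro filterlim_tendsto_pos_mult_at_top[OF tendsto_const]) auto
  hence "\<forall>\<^sub>F N in sequentially. \<bar>B\<bar> * Q ^ p < c / (2 * pi) ^ k * exp ((- s * real p - real e) * ln (real N))"
    unfolding filterlim_at_top_dense by (rule spec)
  hence "\<forall>\<^sub>F N in sequentially. False"
    using eventually_ge_at_top[of "max N0 4"]
  proof eventually_elim
    case (elim N)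
    have eq: "real N powr (- s * real p - real e) = exp ((- s * real p - real e) * ln (real N))"
      using elim(2) by (simp add: powr_def)
    show False using growth[OF elim(2)] elim(1) unfolding eq by linarith
  qed
  thus False by simp
qed

end
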